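(* Consider noisy circuits on $n\ge 2$ qubits with layers $\Phi_\ell=\mathcal D_\lambda^{\otimes n}\circ\mathcal U_\ell$, where $\mathcal U_\ell(\cdot)=U_\ell(\cdot)U_\ell^\dagger$ for an arbitrary $n$-qubit unitary $U_\ell$ and $\mathcal D_\lambda$ is single-qubit depolarizing noise of fixed strength $\lambda$. For an $n$-qubit initial density matrix $\rho_0$, put $\rho_\ell=\Phi_\ell(\rho_{\ell-1})$. (i) For every $\lambda\in(0,1]$ there are constants $L_{\mathrm{abs}}=O(1)$ and $C>0$, depending only on $\lambda$, such that for every $n\ge2$, every $\rho_0$, every choice of unitaries $U_1,U_2,\dots$, every bipartition $A\mid B$ of the $n$ qubits and every $\ell\ge L_{\mathrm{abs}}$, $$S_{OE}(\rho_\ell)\le C\log n .$$ (ii) For every $\lambda\in(0,1]$ there are constants $K,C>0$, depending only on $\lambda$, such that, with $L_{\mathrm{rel}}=K\log n$, for every $n\ge 2$, every $\rho_0$, every choice of unitaries, every bipartition $A\mid B$ and every $\ell\ge L_{\mathrm{rel}}$, $$\widetilde S_{OE}(\rho_\ell)\le C\log n .$$ (iii) The logarithmic scale in (ii) is optimal: for every $\lambda\in(0,1)$ there is $\kappa>0$ depending only on $\lambda$, and for infinitely many $n$ there are an initial state $\rho_0$, unitaries $U_1,U_2,\dots$ and a bipartition $A\mid B$, such that $$\frac{1}{\log n}\min_{0\le \ell\le \kappa\log n}\widetilde S_{OE}(\rho_\ell)\longrightarrow\infty$$ as $n\to\infty$ along this sequence. Hence the crossover depth for $\widetilde S_{OE}=O(\log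 n)$ is $\Theta(\log n)$.
   Context: Single-qubit depolarizing noise: $\mathcal D_\lambda(\sigma)=(1-\lambda)\sigma+\lambda\,\mathrm{tr}(\sigma)\,\mathbb I/2$. Operator Schmidt decomposition of $\rho$ across $A\mid B$: $\rho=\sum_{\alpha=1}^r\lambda_\alpha L_\alpha\otimes R_\alpha$ with $\lambda_\alpha>0$, where $\{L_\alpha\}$ (operators on $A$) and $\{R_\alpha\}$ (operators on $B$) are orthonormal for the Hilbert-Schmidt inner product. The operator entanglement entropy is $S_{OE}(\rho)=-\sum_\alpha\lambda_\alpha^2\log_2\lambda_\alpha^2$ and the normalized one is $\widetilde S_{OE}(\rho)=-\sum_\alpha p_\alpha\log_2p_\alpha$ with $p_\alpha=\lambda_\alpha^2/\mathrm{tr}(\rho^2)$. *)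

theory Defs
  imports
    "Jordan_Normal_Form.Schur_Decomposition"
    "HOL-Library.Landau_Symbols"
begin

text \<open>
  Operators on qubits are square complex matrices. The computational basis of
  \<open>n\<close> qubits is indexed by the naturals below \<open>2 ^ n\<close>; the state of qubit \<open>i\<close> in the
  basis vector with index \<open>x\<close> is the binary digit \<open>i\<close> of \<open>x\<close>.
\<close>

definition mat_trace :: "complex mat \<Rightarrow> complex" where
  "mat_trace M = (\<Sum>i<dim_row M. M $$ (i, i))"

definition unitary_op :: "nat \<Rightarrow> complex mat \<Rightarrow> bool" where
  "unitary_op n U \<longleftrightarrow> U \<in> carrier_mat (2 ^ n) (2 ^ n)
     \<and> U * mat_adjoint U = 1\<^sub>m (2 ^ n) \<and> mat_adjoint U * U = 1\<^sub>m (2 ^ n)"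

definition density_op :: "nat \<Rightarrow> complex mat \<Rightarrow> bool" where
  "density_op n \<rho> \<longleftrightarrow> \<rho> \<in> carrier_mat (2 ^ n) (2 ^ n)
     \<and> mat_adjoint \<rho> = \<rho>
     \<and> (\<forall>v \<in> carrier_vec (2 ^ n). 0 \<le> Re ((\<rho> *\<^sub>v v) \<bullet>c v))
     \<and> mat_trace \<rho> = 1"


definition depolarize :: "real \<Rightarrow> complex mat \<Rightarrow> complex mat" where
  "depolarize lam \<sigma> =
     complex_of_real (1 - lam) \<cdot>\<^sub>m \<sigma> + (complex_of_real lam * mat_trace \<sigma> / 2) \<cdot>\<^sub>m 1\<^sub>m 2"

definition qubit :: "nat \<Rightarrow> nat \<Rightarrow> nat" where
  "qubit x i = of_bool (bit x i)"

definition unit_mat2 :: "nat \<Rightarrow> nat \<Rightarrow> complex mat" where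
  "unit_mat2 a b = mat 2 2 (\<lambda>(i, j). if i = a \<and> j = b then 1 else 0)"

text \<open>
  The \<open>n\<close>-fold tensor power of a linear map \<open>\<Phi>\<close> on single-qubit operators: the
  linear map that sends the matrix unit \<open>E\<^bsub>x' y'\<^esub>\<close>, which is the tensor product over the
  qubits \<open>i\<close> of the single-qubit matrix units at the digits \<open>i\<close> of \<open>x'\<close> and \<open>y'\<close>, to the tensor
  product of their images under \<open>\<Phi>\<close>.
\<close>
definition channel_power :: "nat \<Rightarrow> (complex mat \<Rightarrow> complex mat) \<Rightarrow> complex mat \<Rightarrow> complex mat" where
  "channel_power n \<Phi> \<rho> = mat (2 ^ n) (2 ^ n) (\<lambda>(x, y).
     \<Sum>x'<2 ^ n. \<Sum>y'<2 ^ n. \<rho> $$ (x', y') *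
       (\<Prod>i<n. \<Phi> (unit_mat2 (qubit x' i) (qubit y' i)) $$ (qubit x i, qubit y i)))"

primrec noisy_state ::
    "nat \<Rightarrow> real \<Rightarrow> (nat \<Rightarrow> complex mat) \<Rightarrow> complex mat \<Rightarrow> nat \<Rightarrow> complex mat" where
  "noisy_state n lam U \<rho>\<^sub>0 0 = \<rho>\<^sub>0"
| "noisy_state n lam U \<rho>\<^sub>0 (Suc l) =
     channel_power n (depolarize lam)
       (U (Suc l) * noisy_state n lam U \<rho>\<^sub>0 l * mat_adjoint (U (Suc l)))"


definition bipartition :: "nat \<Rightarrow> nat set \<Rightarrow> nat set \<Rightarrow> bool" where
  "bipartition n A B \<longleftrightarrow> A \<union> B = {..<n} \<and> A \<inter> B = {} \<and> A \<noteq> {} \<and> B \<noteq> {}"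

text \<open>
  The basis index, below \<open>2 ^ card S\<close>, of the qubits in \<open>S\<close> alone: the digits of \<open>x\<close> at the
  positions in \<open>S\<close>, kept in increasing order of position.
\<close>
definition sub_index :: "nat set \<Rightarrow> nat \<Rightarrow> nat" where
  "sub_index S x = horner_sum of_bool 2 (map (bit x) (sorted_list_of_set S))"

definition tensor_op ::
    "nat \<Rightarrow> nat set \<Rightarrow> nat set \<Rightarrow> complex mat \<Rightarrow> complex mat \<Rightarrow> complex mat" where
  "tensor_op n A B L R = mat (2 ^ n) (2 ^ n) (\<lambda>(x, y).
     L $$ (sub_index A x, sub_index A y) * R $$ (sub_index B x, sub_index B y))"

definition hs_inner :: "complex mat \<Rightarrow> complex mat \<Rightarrow> complex" where
  "hs_inner X Y = mat_trace (mat_adjoint X * Y)"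

definition hs_orthonormal :: "nat \<Rightarrow> nat \<Rightarrow> (nat \<Rightarrow> complex mat) \<Rightarrow> bool" where
  "hs_orthonormal d r X \<longleftrightarrow> (\<forall>\<alpha><r. X \<alpha> \<in> carrier_mat d d)
     \<and> (\<forall>\<alpha><r. \<forall>\<beta><r. hs_inner (X \<alpha>) (X \<beta>) = (if \<alpha> = \<beta> then 1 else 0))"

definition op_schmidt_decomp ::
    "nat \<Rightarrow> nat set \<Rightarrow> nat set \<Rightarrow> complex mat \<Rightarrow>
     real list \<Rightarrow> (nat \<Rightarrow> complex mat) \<Rightarrow> (nat \<Rightarrow> complex mat) \<Rightarrow> bool" where
  "op_schmidt_decomp n A B \<rho> cs L R \<longleftrightarrow>
     (\<forall>c \<in> set cs. 0 < c)
     \<and> hs_orthonormal (2 ^ card A) (length cs) L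
     \<and> hs_orthonormal (2 ^ card B) (length cs) R
     \<and> \<rho> = mat (2 ^ n) (2 ^ n) (\<lambda>(x, y).
         \<Sum>\<alpha><length cs. complex_of_real (cs ! \<alpha>) * tensor_op n A B (L \<alpha>) (R \<alpha>) $$ (x, y))"

text \<open>
  The coefficients are determined by \<open>\<rho>\<close> up to their order, which the entropies below
  do not depend on.
\<close>
definition op_schmidt_coeffs :: "nat \<Rightarrow> nat set \<Rightarrow> nat set \<Rightarrow> complex mat \<Rightarrow> real list" where
  "op_schmidt_coeffs n A B \<rho> = (SOME cs. \<exists>L R. op_schmidt_decomp n A B \<rho> cs L R)"

definition op_entropy :: "nat \<Rightarrow> nat set \<Rightarrow> nat set \<Rightarrow> complex mat \<Rightarrow> real" where
  "op_entropy n A B \<rho> = - (\<Sum>c\<leftarrow>op_schmidt_coeffs n A B \<rho>. c\<^sup>2 * log 2 (c\<^sup>2))"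

definition op_entropy_norm :: "nat \<Rightarrow> nat set \<Rightarrow> nat set \<Rightarrow> complex mat \<Rightarrow> real" where
  "op_entropy_norm n A B \<rho> =
     - (\<Sum>c\<leftarrow>op_schmidt_coeffs n A B \<rho>.
          let p = c\<^sup>2 / Re (mat_trace (\<rho> * \<rho>)) in p * log 2 p)"


definition low_entropy_from :: "real \<Rightarrow> real \<Rightarrow> nat \<Rightarrow> nat \<Rightarrow> bool" where
  "low_entropy_from lam C n L \<longleftrightarrow>
     (\<forall>\<rho>\<^sub>0 U A B l. density_op n \<rho>\<^sub>0 \<longrightarrow> (\<forall>k\<ge>1. unitary_op n (U k)) \<longrightarrow> bipartition n A B \<longrightarrow>
        L \<le> l \<longrightarrow> op_entropy_norm n A B (noisy_state n lam U \<rho>\<^sub>0 l) \<le> C * log 2 (real n))"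

text \<open>Only meaningful if some depth satisfies \<^const>\<open>low_entropy_from\<close>.\<close>
definition crossover_depth :: "real \<Rightarrow> real \<Rightarrow> nat \<Rightarrow> nat" where
  "crossover_depth lam C n = (LEAST L. low_entropy_from lam C n L)"

end

theory Submission
  imports
    Defs
    "Jordan_Normal_Form.Spectral_Radius"
    "HOL-Analysis.L2_Norm"
    "HOL-Real_Asymp.Real_Asymp"
begin

text \<open>
  Write \<open>\<mu> = 1 - \<lambda>\<close> and \<open>Q(\<rho>) = 2\<^sup>n tr \<rho>\<^sup>2\<close>, so that \<open>log Q\<close> is the collision entropy
  deficit of \<open>\<rho>\<close>. The upper bounds rest on the one-layer contraction
  \<open>Q(D \<rho>) \<le> Q(\<rho>)\<^sup>\<theta>\<close> with \<open>\<theta> < 1\<close> depending only on \<open>\<lambda>\<close>, where \<open>D\<close> is the tensor power of the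
  depolarizing channel. For very strong noise it follows with \<open>\<theta> = 1/2\<close> from the hypercontractive
  inequality \<open>tr |D X|\<^sup>4 \<le> 2\<^sup>-\<^sup>n (tr |X|\<^sup>2)\<^sup>2\<close> and duality, using \<open>\<rho> \<ge> 0\<close> and \<open>tr \<rho> = 1\<close>.
  The inequality is proved in a quadrilinear form, which survives an induction over the qubits
  without any inequality for Schatten norms. For arbitrary noise, \<open>D\<close> with parameter \<open>\<mu>\<close> is
  interpolated between the identity and \<open>D\<close> with parameter \<open>\<mu>^(2^k)\<close>, iterating
  \<open>\<parallel>D\<^sub>\<mu> \<rho>\<parallel>\<^sup>2 = \<langle>\<rho>, D\<^sub>\<mu>\<^sub>\<mu> \<rho>\<rangle> \<le> \<parallel>\<rho>\<parallel> \<parallel>D\<^sub>\<mu>\<^sub>\<mu> \<rho>\<parallel>\<close>. Unitaries do not change \<open>Q\<close>, hence \<open>Q\<close> is at most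
  \<open>4\<^sup>n\<close> to the power \<open>\<theta>\<^sup>l\<close> at depth \<open>l\<close>. For (i), this makes \<open>tr \<rho>\<^sup>2\<close> exponentially
  small at constant depth, while the entropy is at most \<open>2 n tr \<rho>\<^sup>2 + O(1)\<close>. For (ii), the
  largest normalized Schmidt weight is at least \<open>1 / Q\<close>, because \<open>\<rho>\<close> has trace one, and \<open>1 - 1 / Q \<le> ln Q = O(1 / n)\<close> at logarithmic depth.

  For (iii), start from \<open>n / 2\<close> perfectly correlated pairs of classical bits across the cut and
  use trivial unitaries. The state stays diagonal with correlations \<open>t = \<mu>\<^sup>2\<^sup>l\<close> per pair, its largest
  normalized weight is at most \<open>(1 + t\<^sup>2) powr (- n / 2)\<close>, and so the entropy is at least
  \<open>n t\<^sup>2 / 4\<close>, which is \<open>\<surd>n / 4\<close> for \<open>l\<close> up to a small multiple of \<open>log n\<close>.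
\<close>

section \<open>Tensor powers of the depolarizing channel\<close>

text \<open>Entry (c, d) of the depolarized matrix unit E_ab, for noise strength 1 - \<mu>. The
  survival factor \<mu> is the parameter throughout, since it multiplies under composition.\<close>

definition dep_kernel :: "real \<Rightarrow> nat \<Rightarrow> nat \<Rightarrow> nat \<Rightarrow> nat \<Rightarrow> real" where
  "dep_kernel \<mu> a b c d =
     \<mu> * of_bool (a = c \<and> b = d) + (1 - \<mu>) / 2 * of_bool (a = b \<and> c = d)"

definition noise_kernel :: "nat \<Rightarrow> real \<Rightarrow> nat \<Rightarrow> nat \<Rightarrow> nat \<Rightarrow> nat \<Rightarrow> real" where
  "noise_kernel n \<mu> x' y' x y =
     (\<Prod>i<n. dep_kernel \<mu> (qubit x' i) (qubit y' i) (qubit x i) (qubit y i))"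

text \<open>Operators are handled as functions of two indices instead of matrices, which makes
  blocks and linear combinations plain function expressions. Only input entries with indices below
  \<open>2 ^ n\<close> enter, so inputs that agree there have equal images.\<close>

definition noise :: "nat \<Rightarrow> real \<Rightarrow> (nat \<Rightarrow> nat \<Rightarrow> complex) \<Rightarrow> nat \<Rightarrow> nat \<Rightarrow> complex" where
  "noise n \<mu> f x y =
     (\<Sum>x'<2 ^ n. \<Sum>y'<2 ^ n. f x' y' * complex_of_real (noise_kernel n \<mu> x' y' x y))"

lemma qubit_less_2: "qubit x i < 2"
  by (simp add: qubit_def)

lemma qubit_concat:
  assumes "u < 2 ^ m"
  shows "qubit (u + 2 ^ m * v) i = (if i < m then qubit u i else qubit v (i - m))"
proof -
  have t: "take_bit m (u + 2 ^ m * v) = u" using assms by (simp add: take_bit_eq_mod)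
  have d: "drop_bit m (u + 2 ^ m * v) = v" using assms by (simp add: drop_bit_eq_div)
  have "bit (u + 2 ^ m * v) i = (if i < m then bit u i else bit v (i - m))"
    using bit_take_bit_iff[of m "u + 2 ^ m * v" i, unfolded t] bit_drop_bit_eq[of m "u + 2 ^ m * v", unfolded d]
    by auto
  then show ?thesis by (simp add: qubit_def)
qed

lemma qubit_append:
  assumes "x < 2 ^ n" "b < 2"
  shows "i < n \<Longrightarrow> qubit (x + 2 ^ n * b) i = qubit x i"
    and "qubit (x + 2 ^ n * b) n = b"
  unfolding qubit_concat[OF assms(1)] using assms(2)
  by (auto simp: less_2_cases_iff qubit_def bit_Suc_0_iff bit_1_iff)

lemma sum_lessThan_mult:
  fixes g :: "nat \<Rightarrow> 'a::comm_monoid_add"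
  shows "(\<Sum>x<m * k. g x) = (\<Sum>b<k. \<Sum>x<m. g (x + m * b))"
proof (induction k)
  case (Suc k)
  have "(\<Sum>x<m * Suc k. g x) = (\<Sum>x<m * k. g x) + (\<Sum>x<m. g (x + m * k))"
    by (simp add: lessThan_atLeast0 sum.atLeastLessThan_concat[of 0 "m*k" "m + m*k" g, symmetric]
        sum.shift_bounds_nat_ivl[of g 0 "m*k" m, simplified] add.commute)
  then show ?case using Suc by simp
qed simp

lemma sum_lessThan_power2_Suc:
  fixes g :: "nat \<Rightarrow> 'a::comm_monoid_add"
  shows "(\<Sum>x<2 ^ Suc n. g x) = (\<Sum>b<2. \<Sum>x<2 ^ n. g (x + 2 ^ n * b))"
  using sum_lessThan_mult[of g "2 ^ n" 2] by (simp add: mult.commute)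

lemma sum_less_2: "(\<Sum>b<(2::nat). g b) = g 0 + g 1" for g :: "nat \<Rightarrow> 'a::comm_monoid_add"
  by (simp add: numeral_2_eq_2)

text \<open>The digits of an index vary independently, so for tensor products a sum over indices
  becomes a product over qubits. The induction splits off the top digit.\<close>

lemma sum_sum_prod_qubit:
  fixes f :: "nat \<Rightarrow> nat \<Rightarrow> nat \<Rightarrow> 'a::comm_semiring_1"
  shows "(\<Sum>x<2 ^ n. \<Sum>y<2 ^ n. \<Prod>i<n. f i (qubit x i) (qubit y i)) =
    (\<Prod>i<n. \<Sum>a<2. \<Sum>b<2. f i a b)"
proof (induction n)
  case (Suc n)
  have "(\<Sum>x<2 ^ Suc n. \<Sum>y<2 ^ Suc n. \<Prod>i<Suc n. f i (qubit x i) (qubit y i)) =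
     (\<Sum>a<2. \<Sum>x<2 ^ n. \<Sum>b<2. \<Sum>y<2 ^ n. (\<Prod>i<n. f i (qubit x i) (qubit y i)) * f n a b)"
    unfolding sum_lessThan_power2_Suc
    by (intro sum.cong refl) (simp add: qubit_append)
  also have "\<dots> = (\<Sum>a<2. \<Sum>b<2. (\<Sum>x<2 ^ n. \<Sum>y<2 ^ n. \<Prod>i<n. f i (qubit x i) (qubit y i)) * f n a b)"
    by (rule sum.cong[OF refl], subst sum.swap) (simp add: sum_distrib_right)
  also have "\<dots> = (\<Sum>x<2 ^ n. \<Sum>y<2 ^ n. \<Prod>i<n. f i (qubit x i) (qubit y i)) * (\<Sum>a<2. \<Sum>b<2. f n a b)"
    by (simp add: sum_distrib_left)
  finally show ?case using Suc by simp
qed simp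

lemma sum_prod_qubit:
  fixes f :: "nat \<Rightarrow> nat \<Rightarrow> 'a::comm_semiring_1"
  shows "(\<Sum>x<2 ^ n. \<Prod>i<n. f i (qubit x i)) = (\<Prod>i<n. \<Sum>a<2. f i a)"
proof (induction n)
  case (Suc n)
  have "(\<Sum>x<2 ^ Suc n. \<Prod>i<Suc n. f i (qubit x i)) =
     (\<Sum>a<2. \<Sum>x<2 ^ n. (\<Prod>i<n. f i (qubit x i)) * f n a)"
    unfolding sum_lessThan_power2_Suc
    by (intro sum.cong refl) (simp add: qubit_append)
  also have "\<dots> = (\<Sum>x<2 ^ n. \<Prod>i<n. f i (qubit x i)) * (\<Sum>a<2. f n a)"
    by (simp add: sum_distrib_left sum_distrib_right)
  finally show ?case using Suc by simp
qed simp

lemma qubit_eqI: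
  assumes "x < 2 ^ n" "y < 2 ^ n" "\<And>i. i < n \<Longrightarrow> qubit x i = qubit y i"
  shows "x = y"
proof (rule bit_eqI)
  fix i
  show "bit x i = bit y i"
  proof (cases "i < n")
    case True
    then show ?thesis using assms(3)[of i] by (simp add: qubit_def of_bool_def split: if_splits)
  next
    case False
    have "take_bit n x = x" "take_bit n y = y" using assms by (simp_all add: take_bit_nat_eq_self)
    then show ?thesis using False by (metis bit_take_bit_iff)
  qed
qed

lemma noise_kernel_commute: "noise_kernel n \<mu> x' y' x y = noise_kernel n \<mu> x y x' y'"
  unfolding noise_kernel_def by (intro prod.cong refl) (auto simp: dep_kernel_def)

lemma dep_kernel_semigroup:
  assumes "a < 2" "b < 2" "c < 2" "d < 2"
  shows "(\<Sum>e<2. \<Sum>f<2. dep_kernel \<mu> a b e f * dep_kernel \<nu> e f c d) = dep_kernel (\<mu> * \<nu>) a b c d"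
proof -
  have "a = 0 \<or> a = 1" "b = 0 \<or> b = 1" "c = 0 \<or> c = 1" "d = 0 \<or> d = 1" using assms by auto
  then show ?thesis
    by (elim disjE) (simp_all add: dep_kernel_def sum_less_2 field_simps)
qed

text \<open>Single-qubit channels compose by multiplying their survival factors; factorization over
  the qubits carries this to the tensor power.\<close>

lemma noise_kernel_semigroup:
  "(\<Sum>x<2 ^ n. \<Sum>y<2 ^ n. noise_kernel n \<mu> x' y' x y * noise_kernel n \<nu> x y x'' y'') =
    noise_kernel n (\<mu> * \<nu>) x' y' x'' y''"
proof -
  have "(\<Sum>x<2 ^ n. \<Sum>y<2 ^ n. noise_kernel n \<mu> x' y' x y * noise_kernel n \<nu> x y x'' y'') =
    (\<Sum>x<2 ^ n. \<Sum>y<2 ^ n. \<Prod>i<n. dep_kernel \<mu> (qubit x' i) (qubit y' i) (qubit x i) (qubit y i)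
       * dep_kernel \<nu> (qubit x i) (qubit y i) (qubit x'' i) (qubit y'' i))"
    unfolding noise_kernel_def by (simp add: prod.distrib)
  also have "\<dots> = noise_kernel n (\<mu> * \<nu>) x' y' x'' y''"
    using sum_sum_prod_qubit[where n = n and f = "\<lambda>i a b. dep_kernel \<mu> (qubit x' i) (qubit y' i) a b
       * dep_kernel \<nu> a b (qubit x'' i) (qubit y'' i)"]
    by (simp add: dep_kernel_semigroup qubit_less_2 noise_kernel_def)
  finally show ?thesis .
qed

text \<open>Ties the channel of the circuit to \<open>noise\<close>: strength \<open>lam\<close>
  becomes survival factor \<open>1 - lam\<close>. It suffices to compare the images of single-qubit
  matrix units.\<close>

lemma channel_power_depolarize:
  "channel_power n (depolarize lam) \<rho> =
     mat (2 ^ n) (2 ^ n) (\<lambda>(x, y). noise n (1 - lam) (\<lambda>x y. \<rho> $$ (x, y)) x y)"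
proof -
  have *: "depolarize lam (unit_mat2 a b) $$ (c, d) = complex_of_real (dep_kernel (1 - lam) a b c d)"
    if "a < 2" "b < 2" "c < 2" "d < 2" for a b c d
  proof -
    have "mat_trace (unit_mat2 a b) = of_bool (a = b)"
      using that by (auto simp: mat_trace_def unit_mat2_def sum_less_2)
    then show ?thesis
      using that by (auto simp: depolarize_def unit_mat2_def dep_kernel_def)
  qed
  show ?thesis
    unfolding channel_power_def noise_def noise_kernel_def
    by (intro cong_mat refl) (simp add: * qubit_less_2)
qed

section \<open>Hilbert-Schmidt products in coordinates\<close>

definition hs_sum :: "nat \<Rightarrow> (nat \<Rightarrow> nat \<Rightarrow> complex) \<Rightarrow> (nat \<Rightarrow> nat \<Rightarrow> complex) \<Rightarrow> complex" where
  "hs_sum d f g = (\<Sum>x<d. \<Sum>y<d. cnj (f x y) * g x y)"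

definition hs_sq :: "nat \<Rightarrow> (nat \<Rightarrow> nat \<Rightarrow> complex) \<Rightarrow> real" where
  "hs_sq d f = (\<Sum>x<d. \<Sum>y<d. (cmod (f x y))\<^sup>2)"

lemma hs_sq_nonneg: "0 \<le> hs_sq d f"
  by (simp add: hs_sq_def sum_nonneg)

lemma hs_sum_self: "hs_sum d f f = complex_of_real (hs_sq d f)"
  by (simp add: hs_sum_def hs_sq_def complex_norm_square mult.commute[of "cnj _"] del: of_real_power)

lemma cmod_sum_mult_le:
  "cmod (\<Sum>i\<in>A. f i * g i) \<le> sqrt (\<Sum>i\<in>A. (cmod (f i))\<^sup>2) * sqrt (\<Sum>i\<in>A. (cmod (g i))\<^sup>2)"
proof -
  have "cmod (\<Sum>i\<in>A. f i * g i) \<le> (\<Sum>i\<in>A. \<bar>cmod (f i)\<bar> * \<bar>cmod (g i)\<bar>)"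
    using norm_sum[of "\<lambda>i. f i * g i" A] by (simp add: norm_mult)
  also have "\<dots> \<le> L2_set (\<lambda>i. cmod (f i)) A * L2_set (\<lambda>i. cmod (g i)) A"
    by (rule L2_set_mult_ineq)
  finally show ?thesis by (simp add: L2_set_def)
qed

lemma hs_sum_le: "cmod (hs_sum d f g) \<le> sqrt (hs_sq d f) * sqrt (hs_sq d g)"
  using cmod_sum_mult_le[of "\<lambda>(x, y). cnj (f x y)" "\<lambda>(x, y). g x y" "{..<d} \<times> {..<d}"]
  by (simp add: hs_sum_def hs_sq_def sum.cartesian_product case_prod_beta)

lemma noise_noise: "noise n \<mu> (noise n \<nu> f) = noise n (\<nu> * \<mu>) f"
proof (intro ext)
  fix x y
  let ?I = "{..<2 ^ n} \<times> {..<2 ^ n} :: (nat \<times> nat) set"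
  let ?k = "\<lambda>\<mu> p q. complex_of_real (noise_kernel n \<mu> (fst p) (snd p) (fst q) (snd q))"
  have "noise n \<mu> (noise n \<nu> f) x y =
      (\<Sum>p\<in>?I. (\<Sum>q\<in>?I. f (fst q) (snd q) * ?k \<nu> q p) * ?k \<mu> p (x, y))"
    by (simp add: noise_def sum.cartesian_product case_prod_beta)
  also have "\<dots> = (\<Sum>q\<in>?I. f (fst q) (snd q) * (\<Sum>p\<in>?I. ?k \<nu> q p * ?k \<mu> p (x, y)))"
    unfolding sum_distrib_right sum_distrib_left by (subst sum.swap) (simp add: mult.assoc)
  also have "\<dots> = noise n (\<nu> * \<mu>) f x y"
  proof -
    have "(\<Sum>p\<in>?I. ?k \<nu> q p * ?k \<mu> p (x, y)) = ?k (\<nu> * \<mu>) q (x, y)" for q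
      using noise_kernel_semigroup[where n = n and \<mu> = \<nu> and \<nu> = \<mu> and x' = "fst q" and y' = "snd q" and x'' = x and y'' = y]
      by (simp add: sum.cartesian_product case_prod_beta flip: of_real_mult of_real_sum)
    then show ?thesis
      by (simp add: noise_def sum.cartesian_product case_prod_beta)
  qed
  finally show "noise n \<mu> (noise n \<nu> f) x y = noise n (\<nu> * \<mu>) f x y" .
qed

lemma hs_sum_noise: "hs_sum (2 ^ n) (noise n \<mu> f) g = hs_sum (2 ^ n) f (noise n \<mu> g)"
proof -
  let ?I = "{..<2 ^ n} \<times> {..<2 ^ n} :: (nat \<times> nat) set"
  let ?k = "\<lambda>p q. complex_of_real (noise_kernel n \<mu> (fst p) (snd p) (fst q) (snd q))"
  have hs: "hs_sum (2 ^ n) f g = (\<Sum>p\<in>?I. cnj (f (fst p) (snd p)) * g (fst p) (snd p))" for f g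
    by (simp add: hs_sum_def sum.cartesian_product case_prod_beta)
  have ns: "noise n \<mu> f (fst p) (snd p) = (\<Sum>q\<in>?I. f (fst q) (snd q) * ?k q p)" for f p
    by (simp add: noise_def sum.cartesian_product case_prod_beta)
  have "hs_sum (2 ^ n) (noise n \<mu> f) g =
    (\<Sum>p\<in>?I. \<Sum>q\<in>?I. cnj (f (fst q) (snd q)) * g (fst p) (snd p) * ?k q p)"
    unfolding hs ns cnj_sum sum_distrib_right by (intro sum.cong refl) (simp add: mult_ac)
  also have "\<dots> = (\<Sum>q\<in>?I. \<Sum>p\<in>?I. cnj (f (fst q) (snd q)) * g (fst p) (snd p) * ?k p q)"
    by (subst sum.swap) (intro sum.cong refl, metis noise_kernel_commute)
  also have "\<dots> = hs_sum (2 ^ n) f (noise n \<mu> g)"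
    unfolding hs ns sum_distrib_left by (intro sum.cong refl) (simp add: mult_ac)
  finally show ?thesis .
qed

lemma hs_sq_noise: "complex_of_real (hs_sq (2 ^ n) (noise n \<mu> f)) = hs_sum (2 ^ n) f (noise n (\<mu>\<^sup>2) f)"
  by (simp add: hs_sum_noise noise_noise power2_eq_square flip: hs_sum_self)

text \<open>Self-adjointness and the semigroup law turn the squared norm into the product of f with
  its noisy version at survival factor \<mu>^2; Cauchy-Schwarz finishes. This is the interpolation
  step that trades weak noise for stronger noise.\<close>

lemma hs_sq_noise_le:
  "hs_sq (2 ^ n) (noise n \<mu> f) \<le> sqrt (hs_sq (2 ^ n) f * hs_sq (2 ^ n) (noise n (\<mu>\<^sup>2) f))"
proof -
  have "hs_sq (2 ^ n) (noise n \<mu> f) = cmod (hs_sum (2 ^ n) f (noise n (\<mu>\<^sup>2) f))"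
    by (metis hs_sq_noise norm_of_real abs_of_nonneg hs_sq_nonneg)
  then show ?thesis using hs_sum_le[of "2 ^ n" f] by (simp add: real_sqrt_mult)
qed

text \<open>This is tr (X Y^dag Z W^dag). With four equal arguments it is the fourth power of the
  Schatten 4-norm; the slots are kept separate so that different blocks can be inserted.\<close>

definition quad_tr :: "nat \<Rightarrow> (nat \<Rightarrow> nat \<Rightarrow> complex) \<Rightarrow> (nat \<Rightarrow> nat \<Rightarrow> complex) \<Rightarrow>
    (nat \<Rightarrow> nat \<Rightarrow> complex) \<Rightarrow> (nat \<Rightarrow> nat \<Rightarrow> complex) \<Rightarrow> complex" where
  "quad_tr d X Y Z W =
     (\<Sum>a<d. \<Sum>b<d. \<Sum>c<d. \<Sum>e<d. X a b * cnj (Y c b) * Z c e * cnj (W a e))"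

text \<open>A named combination, so that the multilinear expansion in all four slots is plain
  rewriting.\<close>

definition add_scaled :: "(nat \<Rightarrow> nat \<Rightarrow> complex) \<Rightarrow> real \<Rightarrow> (nat \<Rightarrow> nat \<Rightarrow> complex) \<Rightarrow> nat \<Rightarrow> nat \<Rightarrow> complex" where
  "add_scaled f \<mu> g x y = f x y + complex_of_real \<mu> * g x y"

lemma quad_tr_add_scaled:
  "quad_tr d (add_scaled X \<mu> X') Y Z W = quad_tr d X Y Z W + of_real \<mu> * quad_tr d X' Y Z W"
  "quad_tr d X (add_scaled Y \<mu> Y') Z W = quad_tr d X Y Z W + of_real \<mu> * quad_tr d X Y' Z W"
  "quad_tr d X Y (add_scaled Z \<mu> Z') W = quad_tr d X Y Z W + of_real \<mu> * quad_tr d X Y Z' W"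
  "quad_tr d X Y Z (add_scaled W \<mu> W') = quad_tr d X Y Z W + of_real \<mu> * quad_tr d X Y Z W'"
  by (simp_all add: quad_tr_def add_scaled_def sum_distrib_left algebra_simps sum.distrib)

text \<open>The blocks with respect to qubit \<open>n\<close>, the most significant digit, whose row
  and column values are \<open>a\<close> and \<open>b\<close>.\<close>

definition block :: "nat \<Rightarrow> (nat \<Rightarrow> nat \<Rightarrow> complex) \<Rightarrow> nat \<Rightarrow> nat \<Rightarrow> nat \<Rightarrow> nat \<Rightarrow> complex" where
  "block n X a b x y = X (x + 2 ^ n * a) (y + 2 ^ n * b)"

lemma quad_tr_cong:
  assumes "\<And>x y. x < d \<Longrightarrow> y < d \<Longrightarrow> X x y = X' x y" "\<And>x y. x < d \<Longrightarrow> y < d \<Longrightarrow> Y x y = Y' x y"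
    "\<And>x y. x < d \<Longrightarrow> y < d \<Longrightarrow> Z x y = Z' x y" "\<And>x y. x < d \<Longrightarrow> y < d \<Longrightarrow> W x y = W' x y"
  shows "quad_tr d X Y Z W = quad_tr d X' Y' Z' W'"
  unfolding quad_tr_def using assms by (intro sum.cong refl) simp

text \<open>Block matrices multiply like matrices of blocks. The proof moves the four digit sums in
  front of the four sums over the remaining indices.\<close>

lemma quad_tr_Suc:
  "quad_tr (2 ^ Suc n) X Y Z W = (\<Sum>a<2. \<Sum>b<2. \<Sum>c<2. \<Sum>e<2.
     quad_tr (2 ^ n) (block n X a b) (block n Y c b) (block n Z c e) (block n W a e))"
proof -
  have "quad_tr (2 ^ Suc n) X Y Z W = (\<Sum>a<2. \<Sum>x<2^n. \<Sum>b<2. \<Sum>y<2^n. \<Sum>c<2. \<Sum>z<2^n. \<Sum>e<2. \<Sum>w<2^n.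
     block n X a b x y * cnj (block n Y c b z y) * block n Z c e z w * cnj (block n W a e x w))"
    unfolding quad_tr_def sum_lessThan_power2_Suc block_def ..
  also have "\<dots> = (\<Sum>a<2. \<Sum>x<2^n. \<Sum>b<2. \<Sum>c<2. \<Sum>y<2^n. \<Sum>e<2. \<Sum>z<2^n. \<Sum>w<2^n.
     block n X a b x y * cnj (block n Y c b z y) * block n Z c e z w * cnj (block n W a e x w))"
    by (subst (3) sum.swap, subst (4) sum.swap) (rule refl)
  also have "\<dots> = (\<Sum>a<2. \<Sum>b<2. \<Sum>c<2. \<Sum>x<2^n. \<Sum>e<2. \<Sum>y<2^n. \<Sum>z<2^n. \<Sum>w<2^n.
     block n X a b x y * cnj (block n Y c b z y) * block n Z c e z w * cnj (block n W a e x w))"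
    by (subst (2) sum.swap, subst (3) sum.swap, subst (4) sum.swap) (rule refl)
  also have "\<dots> = (\<Sum>a<2. \<Sum>b<2. \<Sum>c<2. \<Sum>e<2. \<Sum>x<2^n. \<Sum>y<2^n. \<Sum>z<2^n. \<Sum>w<2^n.
     block n X a b x y * cnj (block n Y c b z y) * block n Z c e z w * cnj (block n W a e x w))"
    by (subst (4) sum.swap) (rule refl)
  finally show ?thesis unfolding quad_tr_def .
qed

lemma block_noise:
  assumes "x < 2 ^ n" "y < 2 ^ n" "a < 2" "b < 2"
  shows "block n (noise (Suc n) \<mu> X) a b x y =
    (\<Sum>a'<2. \<Sum>b'<2. complex_of_real (dep_kernel \<mu> a' b' a b) * noise n \<mu> (block n X a' b') x y)"
proof -
  have "block n (noise (Suc n) \<mu> X) a b x y = (\<Sum>a'<2. \<Sum>x'<2 ^ n. \<Sum>b'<2. \<Sum>y'<2 ^ n.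
    block n X a' b' x' y' * (noise_kernel n \<mu> x' y' x y * dep_kernel \<mu> a' b' a b))"
    unfolding block_def noise_def sum_lessThan_power2_Suc
    using assms by (intro sum.cong refl) (simp add: noise_kernel_def qubit_append)
  also have "\<dots> = (\<Sum>a'<2. \<Sum>b'<2. \<Sum>x'<2 ^ n. \<Sum>y'<2 ^ n.
    block n X a' b' x' y' * (noise_kernel n \<mu> x' y' x y * dep_kernel \<mu> a' b' a b))"
    by (subst (2) sum.swap) (rule refl)
  also have "\<dots> = (\<Sum>a'<2. \<Sum>b'<2. complex_of_real (dep_kernel \<mu> a' b' a b) * noise n \<mu> (block n X a' b') x y)"
    unfolding noise_def sum_distrib_left by (simp add: mult_ac)
  finally show ?thesis .
qed

lemma hs_sq_Suc: "hs_sq (2 ^ Suc n) X = (\<Sum>a<2. \<Sum>b<2. hs_sq (2 ^ n) (block n X a b))"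
  unfolding hs_sq_def sum_lessThan_power2_Suc block_def
  by (subst (2) sum.swap) (rule refl)

section \<open>A hypercontractive inequality\<close>

text \<open>The products with exactly one index \<open>1\<close> are missing: the corresponding terms of the
  block expansion below have trace zero. Without that cancellation no such bound could hold.\<close>

lemma two_point_real_normalized:
  fixes a0 b0 c0 d0 a1 b1 c1 d1 :: real
  assumes nn: "0 \<le> a0" "0 \<le> b0" "0 \<le> c0" "0 \<le> d0" "0 \<le> a1" "0 \<le> b1" "0 \<le> c1" "0 \<le> d1"
    and n1: "a0\<^sup>2 + a1\<^sup>2 = 1" "b0\<^sup>2 + b1\<^sup>2 = 1" "c0\<^sup>2 + c1\<^sup>2 = 1" "d0\<^sup>2 + d1\<^sup>2 = 1"
  shows "a0 * b0 * c0 * d0 + (a1 * b1 * c0 * d0 + a1 * b0 * c1 * d0 + a1 * b0 * c0 * d1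
     + a0 * b1 * c1 * d0 + a0 * b1 * c0 * d1 + a0 * b0 * c1 * d1
     + a1 * b1 * c1 * d0 + a1 * b1 * c0 * d1 + a1 * b0 * c1 * d1 + a0 * b1 * c1 * d1
     + a1 * b1 * c1 * d1) / 32 \<le> 1"
proof -
  have le1: "x \<le> 1" "y \<le> 1" if "x\<^sup>2 + y\<^sup>2 = 1" for x y :: real
  proof -
    have "x\<^sup>2 \<le> 1" "y\<^sup>2 \<le> 1" using that(1) zero_le_power2[of x] zero_le_power2[of y] by linarith+
    then show "x \<le> 1" "y \<le> 1" by (simp_all add: abs_square_le_1 abs_le_iff)
  qed
  note le = le1[OF n1(1)] le1[OF n1(2)] le1[OF n1(3)] le1[OF n1(4)]
  \<comment> \<open>\<open>u\<close> is the total weight of the components with index 1. A product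
    containing at least two of these is at most u / 2, while the product of the index-0 components
    falls short of 1 by at least u / 4.\<close>
  define u where "u = a1\<^sup>2 + b1\<^sup>2 + c1\<^sup>2 + d1\<^sup>2"
  have u0: "0 \<le> u" by (simp add: u_def)
  have pr: "t \<le> u / 2"
    if "t = x * y * z * w" "0 \<le> x" "0 \<le> y" "0 \<le> z" "z \<le> 1" "0 \<le> w" "w \<le> 1" "x\<^sup>2 + y\<^sup>2 \<le> u"
    for t x y z w :: real
  proof -
    have "t = (x * y) * (z * w)" using that(1) by simp
    also have "\<dots> \<le> (x * y) * 1"
      using that by (intro mult_left_mono mult_le_one) auto
    also have "\<dots> \<le> (x\<^sup>2 + y\<^sup>2) / 2" using sum_squares_bound[of x y] by simp
    finally show ?thesis using that by simp
  qed
  have sq: "a1\<^sup>2 + b1\<^sup>2 \<le> u" "a1\<^sup>2 + c1\<^sup>2 \<le> u" "a1\<^sup>2 + d1\<^sup>2 \<le> u"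
    "b1\<^sup>2 + c1\<^sup>2 \<le> u" "b1\<^sup>2 + d1\<^sup>2 \<le> u" "c1\<^sup>2 + d1\<^sup>2 \<le> u"
    unfolding u_def by simp_all
  have t1: "a1 * b1 * c0 * d0 \<le> u / 2"
    by (rule pr[of _ a1 b1 c0 d0]) (simp_all add: nn le sq mult_ac)
  have t2: "a1 * b0 * c1 * d0 \<le> u / 2"
    by (rule pr[of _ a1 c1 b0 d0]) (simp_all add: nn le sq mult_ac)
  have t3: "a1 * b0 * c0 * d1 \<le> u / 2"
    by (rule pr[of _ a1 d1 b0 c0]) (simp_all add: nn le sq mult_ac)
  have t4: "a0 * b1 * c1 * d0 \<le> u / 2"
    by (rule pr[of _ b1 c1 a0 d0]) (simp_all add: nn le sq mult_ac)
  have t5: "a0 * b1 * c0 * d1 \<le> u / 2"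
    by (rule pr[of _ b1 d1 a0 c0]) (simp_all add: nn le sq mult_ac)
  have t6: "a0 * b0 * c1 * d1 \<le> u / 2"
    by (rule pr[of _ c1 d1 a0 b0]) (simp_all add: nn le sq mult_ac)
  have t7: "a1 * b1 * c1 * d0 \<le> u / 2"
    by (rule pr[of _ a1 b1 c1 d0]) (simp_all add: nn le sq mult_ac)
  have t8: "a1 * b1 * c0 * d1 \<le> u / 2"
    by (rule pr[of _ a1 b1 d1 c0]) (simp_all add: nn le sq mult_ac)
  have t9: "a1 * b0 * c1 * d1 \<le> u / 2"
    by (rule pr[of _ a1 c1 d1 b0]) (simp_all add: nn le sq mult_ac)
  have t10: "a0 * b1 * c1 * d1 \<le> u / 2"
    by (rule pr[of _ b1 c1 d1 a0]) (simp_all add: nn le sq mult_ac)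
  have t11: "a1 * b1 * c1 * d1 \<le> u / 2"
    by (rule pr[of _ a1 b1 c1 d1]) (simp_all add: nn le sq mult_ac)
  have p4: "(x\<^sup>2)\<^sup>2 \<le> x\<^sup>2" if "0 \<le> x" "x \<le> 1" for x :: real
    using that power_le_one[of x 2] by (simp add: power2_eq_square mult_left_le)
  have "a0 * b0 * c0 * d0 = (a0 * b0) * (c0 * d0)" by simp
  also have "\<dots> \<le> ((a0 * b0)\<^sup>2 + (c0 * d0)\<^sup>2) / 2"
    using sum_squares_bound[of "a0 * b0" "c0 * d0"] by simp
  also have "(a0 * b0)\<^sup>2 \<le> ((a0\<^sup>2)\<^sup>2 + (b0\<^sup>2)\<^sup>2) / 2"
    using sum_squares_bound[of "a0\<^sup>2" "b0\<^sup>2"] by (simp add: power_mult_distrib)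
  also have "(c0 * d0)\<^sup>2 \<le> ((c0\<^sup>2)\<^sup>2 + (d0\<^sup>2)\<^sup>2) / 2"
    using sum_squares_bound[of "c0\<^sup>2" "d0\<^sup>2"] by (simp add: power_mult_distrib)
  also have "(a0\<^sup>2)\<^sup>2 \<le> a0\<^sup>2" using nn le by (intro p4)
  also have "(b0\<^sup>2)\<^sup>2 \<le> b0\<^sup>2" using nn le by (intro p4)
  also have "(c0\<^sup>2)\<^sup>2 \<le> c0\<^sup>2" using nn le by (intro p4)
  also have "(d0\<^sup>2)\<^sup>2 \<le> d0\<^sup>2" using nn le by (intro p4)
  also have "((a0\<^sup>2 + b0\<^sup>2) / 2 + (c0\<^sup>2 + d0\<^sup>2) / 2) / 2 = (4 - u) / 4"
    using n1 unfolding u_def by (simp add: field_simps)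
  also have "(4 - u) / 4 = 1 - u / 4"
    by (simp add: field_simps)
  finally have main: "a0 * b0 * c0 * d0 \<le> 1 - u / 4" by simp
  have "a1 * b1 * c0 * d0 + a1 * b0 * c1 * d0 + a1 * b0 * c0 * d1
     + a0 * b1 * c1 * d0 + a0 * b1 * c0 * d1 + a0 * b0 * c1 * d1
     + a1 * b1 * c1 * d0 + a1 * b1 * c0 * d1 + a1 * b0 * c1 * d1 + a0 * b1 * c1 * d1
     + a1 * b1 * c1 * d1 \<le> u/2 + u/2 + u/2 + u/2 + u/2 + u/2 + u/2 + u/2 + u/2 + u/2 + u/2" (is "?s \<le> _")
    by (intro add_mono t1 t2 t3 t4 t5 t6 t7 t8 t9 t10 t11)
  then have "?s / 32 \<le> u / 4" using u0 by simp
  then show ?thesis using main by linarith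
qed

text \<open>Both sides are positively homogeneous of degree one in each of the four pairs, so each
  pair can be scaled to a unit vector.\<close>

lemma two_point_real:
  fixes a0 b0 c0 d0 a1 b1 c1 d1 :: real
  assumes nn: "0 \<le> a0" "0 \<le> b0" "0 \<le> c0" "0 \<le> d0" "0 \<le> a1" "0 \<le> b1" "0 \<le> c1" "0 \<le> d1"
  shows "a0 * b0 * c0 * d0 + (a1 * b1 * c0 * d0 + a1 * b0 * c1 * d0 + a1 * b0 * c0 * d1
     + a0 * b1 * c1 * d0 + a0 * b1 * c0 * d1 + a0 * b0 * c1 * d1
     + a1 * b1 * c1 * d0 + a1 * b1 * c0 * d1 + a1 * b0 * c1 * d1 + a0 * b1 * c1 * d1
     + a1 * b1 * c1 * d1) / 32
     \<le> sqrt (a0\<^sup>2 + a1\<^sup>2) * sqrt (b0\<^sup>2 + b1\<^sup>2) * sqrt (c0\<^sup>2 + c1\<^sup>2) * sqrt (d0\<^sup>2 + d1\<^sup>2)"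
proof -
  have ex: "\<exists>p0 p1 r. x0 = r * p0 \<and> x1 = r * p1 \<and> 0 \<le> p0 \<and> 0 \<le> p1 \<and> p0\<^sup>2 + p1\<^sup>2 = 1
      \<and> r = sqrt (x0\<^sup>2 + x1\<^sup>2)" if "0 \<le> x0" "0 \<le> x1" for x0 x1 :: real
  proof (cases "x0\<^sup>2 + x1\<^sup>2 = 0")
    case True
    then have "x0 = 0" "x1 = 0" by (auto simp: sum_power2_eq_zero_iff)
    \<comment> \<open>A zero pair is 0 times the unit vector (1, 0).\<close>
    then show ?thesis by (intro exI[of _ 1] exI[of _ 0]) auto
  next
    case False
    define r where "r = sqrt (x0\<^sup>2 + x1\<^sup>2)"
    have r: "r \<noteq> 0" "0 \<le> r" "r\<^sup>2 = x0\<^sup>2 + x1\<^sup>2" using False by (auto simp: r_def)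
    have "(x0 / r)\<^sup>2 + (x1 / r)\<^sup>2 = 1"
      using r by (metis False add_divide_distrib divide_self power_divide)
    then show ?thesis
      using r that by (intro exI[of _ "x0 / r"] exI[of _ "x1 / r"] exI[of _ r]) (auto simp: r_def)
  qed
  obtain p0 p1 r where p: "a0 = r * p0" "a1 = r * p1" "0 \<le> p0" "0 \<le> p1" "p0\<^sup>2 + p1\<^sup>2 = 1" "r = sqrt (a0\<^sup>2 + a1\<^sup>2)"
    using ex[OF nn(1) nn(5)] by blast
  obtain q0 q1 s where q: "b0 = s * q0" "b1 = s * q1" "0 \<le> q0" "0 \<le> q1" "q0\<^sup>2 + q1\<^sup>2 = 1" "s = sqrt (b0\<^sup>2 + b1\<^sup>2)"
    using ex[OF nn(2) nn(6)] by blast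
  obtain v0 v1 t where v: "c0 = t * v0" "c1 = t * v1" "0 \<le> v0" "0 \<le> v1" "v0\<^sup>2 + v1\<^sup>2 = 1" "t = sqrt (c0\<^sup>2 + c1\<^sup>2)"
    using ex[OF nn(3) nn(7)] by blast
  obtain w0 w1 u where w: "d0 = u * w0" "d1 = u * w1" "0 \<le> w0" "0 \<le> w1" "w0\<^sup>2 + w1\<^sup>2 = 1" "u = sqrt (d0\<^sup>2 + d1\<^sup>2)"
    using ex[OF nn(4) nn(8)] by blast
  have "0 \<le> r * s * t * u" using p(6) q(6) v(6) w(6) by simp
  from mult_left_mono[OF two_point_real_normalized[OF p(3) q(3) v(3) w(3) p(4) q(4) v(4) w(4) p(5) q(5) v(5) w(5)] this]
  show ?thesis
    unfolding p(6)[symmetric] q(6)[symmetric] v(6)[symmetric] w(6)[symmetric]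
    unfolding p(1,2) q(1,2) v(1,2) w(1,2) by (simp only: algebra_simps times_divide_eq_right mult_1_right)
qed

text \<open>The sum of \<open>quad_tr_Suc\<close> with the blocks as free arguments, so that mean
  and traceless parts can be substituted for them independently.\<close>

definition block_tr :: "nat \<Rightarrow> (nat \<Rightarrow> nat \<Rightarrow> nat \<Rightarrow> nat \<Rightarrow> complex) \<Rightarrow> (nat \<Rightarrow> nat \<Rightarrow> nat \<Rightarrow> nat \<Rightarrow> complex) \<Rightarrow>
    (nat \<Rightarrow> nat \<Rightarrow> nat \<Rightarrow> nat \<Rightarrow> complex) \<Rightarrow> (nat \<Rightarrow> nat \<Rightarrow> nat \<Rightarrow> nat \<Rightarrow> complex) \<Rightarrow> complex" where
  "block_tr d p q r v = (\<Sum>a<2. \<Sum>b<2. \<Sum>c<2. \<Sum>e<2.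
     quad_tr d (p a b) (q c b) (r c e) (v a e))"

lemma block_tr_add_scaled:
  "block_tr d (\<lambda>a b. add_scaled (p a b) \<mu> (p' a b)) q r v = block_tr d p q r v + of_real \<mu> * block_tr d p' q r v"
  "block_tr d p (\<lambda>a b. add_scaled (q a b) \<mu> (q' a b)) r v = block_tr d p q r v + of_real \<mu> * block_tr d p q' r v"
  "block_tr d p q (\<lambda>a b. add_scaled (r a b) \<mu> (r' a b)) v = block_tr d p q r v + of_real \<mu> * block_tr d p q r' v"
  "block_tr d p q r (\<lambda>a b. add_scaled (v a b) \<mu> (v' a b)) = block_tr d p q r v + of_real \<mu> * block_tr d p q r v'"
  by (simp_all only: block_tr_def quad_tr_add_scaled sum.distrib sum_distrib_left)

text \<open>The component proportional to the identity on the last qubit: half the partial trace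
  sits in both diagonal blocks.\<close>

definition block_mean :: "nat \<Rightarrow> (nat \<Rightarrow> nat \<Rightarrow> complex) \<Rightarrow> nat \<Rightarrow> nat \<Rightarrow> nat \<Rightarrow> nat \<Rightarrow> complex" where
  "block_mean n X a b x y = (if a = b then (block n X 0 0 x y + block n X 1 1 x y) / 2 else 0)"

text \<open>The complementary component, traceless on the last qubit: the power of -1 gives its two
  diagonal blocks opposite signs.\<close>

definition block_diff :: "nat \<Rightarrow> (nat \<Rightarrow> nat \<Rightarrow> complex) \<Rightarrow> nat \<Rightarrow> nat \<Rightarrow> nat \<Rightarrow> nat \<Rightarrow> complex" where
  "block_diff n X a b x y = (if a \<noteq> b then block n X a b x y
     else (-1) ^ a * ((block n X 0 0 x y - block n X 1 1 x y) / 2))"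

lemma noise_lincomb:
  "noise n \<mu> (\<lambda>x y. s * f x y + t * g x y) x y = s * noise n \<mu> f x y + t * noise n \<mu> g x y"
  by (simp add: noise_def sum.distrib sum_distrib_left algebra_simps)

text \<open>Noise on the last qubit fixes the identity component and multiplies the traceless one by
  \<mu>; the powers of \<mu> in the expansion below come from here.\<close>

lemma block_noise_split:
  assumes "x < 2 ^ n" "y < 2 ^ n" "a < 2" "b < 2"
  shows "block n (noise (Suc n) \<mu> X) a b x y =
    add_scaled (noise n \<mu> (block_mean n X a b)) \<mu> (noise n \<mu> (block_diff n X a b)) x y"
proof -
  have mean: "noise n \<mu> (block_mean n X a a) x y =
      1/2 * noise n \<mu> (block n X 0 0) x y + 1/2 * noise n \<mu> (block n X 1 1) x y" for a
    unfolding noise_lincomb[symmetric] by (simp add: noise_def block_mean_def field_simps)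
  have mean': "noise n \<mu> (block_mean n X a b) x y = 0" if "a \<noteq> b" for a b
    using that by (simp add: noise_def block_mean_def)
  have diff: "noise n \<mu> (block_diff n X 0 0) x y =
      1/2 * noise n \<mu> (block n X 0 0) x y + (- (1/2)) * noise n \<mu> (block n X 1 1) x y"
    "noise n \<mu> (block_diff n X 1 1) x y =
      (- (1/2)) * noise n \<mu> (block n X 0 0) x y + 1/2 * noise n \<mu> (block n X 1 1) x y"
    unfolding noise_lincomb[symmetric] by (simp_all add: noise_def block_diff_def field_simps)
  have diff': "a \<noteq> b \<Longrightarrow> block_diff n X a b = block n X a b" for a b
    by (intro ext) (simp add: block_diff_def)
  have "a = 0 \<or> a = 1" "b = 0 \<or> b = 1" using assms(3,4) by auto
  then show ?thesis
    unfolding block_noise[OF assms] add_scaled_def sum_less_2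
    by (elim disjE)
      (simp_all del: One_nat_def add: mean mean' diff diff' dep_kernel_def field_simps)
qed

text \<open>The two components are orthogonal, by the parallelogram law on the diagonal blocks.
  Diagonal contributions count twice because each occurs, up to sign, in two blocks.\<close>

lemma block_norms:
  "hs_sq (2 ^ Suc n) X = 2 * hs_sq (2 ^ n) (block_mean n X 0 0) + 2 * hs_sq (2 ^ n) (block_diff n X 0 0)
     + hs_sq (2 ^ n) (block_diff n X 0 1) + hs_sq (2 ^ n) (block_diff n X 1 0)"
proof -
  have pl: "(cmod (u + v))\<^sup>2 + (cmod (u - v))\<^sup>2 = 2 * (cmod u)\<^sup>2 + 2 * (cmod v)\<^sup>2" for u v
    by (simp only: cmod_power2 plus_complex.sel minus_complex.sel power2_sum power2_diff) (simp add: algebra_simps)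
  have half: "(cmod u)\<^sup>2 + (cmod v)\<^sup>2 = 2 * (cmod ((u + v) / 2))\<^sup>2 + 2 * (cmod ((u - v) / 2))\<^sup>2" for u v
    using pl[of u v] by (simp only: norm_divide power_divide norm_numeral) simp
  have "hs_sq (2 ^ n) (block n X 0 0) + hs_sq (2 ^ n) (block n X 1 1) =
    2 * hs_sq (2 ^ n) (block_mean n X 0 0) + 2 * hs_sq (2 ^ n) (block_diff n X 0 0)"
    unfolding hs_sq_def sum_distrib_left sum.distrib[symmetric]
    by (intro sum.cong refl) (simp only: half block_mean_def block_diff_def, simp)
  moreover have "block_diff n X 0 1 = block n X 0 1" "block_diff n X 1 0 = block n X 1 0"
    by (intro ext; simp add: block_diff_def)+
  ultimately show ?thesis unfolding hs_sq_Suc sum_less_2 by simp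
qed

lemma quad_tr_zero:
  "quad_tr d (\<lambda>x y. 0) Y Z W = 0" "quad_tr d X (\<lambda>x y. 0) Z W = 0"
  "quad_tr d X Y (\<lambda>x y. 0) W = 0" "quad_tr d X Y Z (\<lambda>x y. 0) = 0"
  by (simp_all add: quad_tr_def)

lemma quad_tr_uminus:
  "quad_tr d (\<lambda>x y. - X x y) Y Z W = - quad_tr d X Y Z W"
  "quad_tr d X (\<lambda>x y. - Y x y) Z W = - quad_tr d X Y Z W"
  "quad_tr d X Y (\<lambda>x y. - Z x y) W = - quad_tr d X Y Z W"
  "quad_tr d X Y Z (\<lambda>x y. - W x y) = - quad_tr d X Y Z W"
  by (simp_all add: quad_tr_def sum_negf)

text \<open>If three factors are proportional to the identity on the last qubit, the fourth enters
  through its partial trace over that qubit, which vanishes for a traceless factor. With four such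
  factors, the trace of the identity on the qubit gives the factor 2.\<close>

lemma block_tr_diff_mean:
  fixes n \<mu>
  defines "P \<equiv> \<lambda>X a b. noise n \<mu> (block_mean n X a b)"
    and "V \<equiv> \<lambda>X a b. noise n \<mu> (block_diff n X a b)"
  shows "block_tr d (V X) (P Y) (P Z) (P W) = 0" "block_tr d (P X) (V Y) (P Z) (P W) = 0"
    "block_tr d (P X) (P Y) (V Z) (P W) = 0" "block_tr d (P X) (P Y) (P Z) (V W) = 0"
    "block_tr d (P X) (P Y) (P Z) (P W) = 2 * quad_tr d (P X 0 0) (P Y 0 0) (P Z 0 0) (P W 0 0)"
proof -
  have P0: "P X 0 1 = (\<lambda>x y. 0)" "P X 1 0 = (\<lambda>x y. 0)" for X
    unfolding P_def by (intro ext; simp add: noise_def block_mean_def)+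
  have P1: "P X 1 1 = P X 0 0" for X
    unfolding P_def by (intro ext; simp add: noise_def block_mean_def)+
  have V: "V X 1 1 = (\<lambda>x y. - V X 0 0 x y)" for X
  proof (intro ext)
    fix x y
    have "block_diff n X 1 1 = (\<lambda>x y. (-1) * block_diff n X 0 0 x y + 0 * block_diff n X 0 0 x y)"
      by (intro ext) (simp add: block_diff_def)
    then show "V X 1 1 x y = - V X 0 0 x y"
      unfolding V_def using noise_lincomb[of n \<mu> "-1" "block_diff n X 0 0" 0 "block_diff n X 0 0" x y] by simp
  qed
  show "block_tr d (V X) (P Y) (P Z) (P W) = 0" "block_tr d (P X) (V Y) (P Z) (P W) = 0"
    "block_tr d (P X) (P Y) (V Z) (P W) = 0" "block_tr d (P X) (P Y) (P Z) (V W) = 0"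
    "block_tr d (P X) (P Y) (P Z) (P W) = 2 * quad_tr d (P X 0 0) (P Y 0 0) (P Z 0 0) (P W 0 0)"
    unfolding block_tr_def sum_less_2 P0 P1 V quad_tr_zero quad_tr_uminus by simp_all
qed

lemma cmod_block_tr_le:
  assumes "\<And>a b c e. a < 2 \<Longrightarrow> b < 2 \<Longrightarrow> c < 2 \<Longrightarrow> e < 2 \<Longrightarrow> cmod (quad_tr d (p a b) (q c b) (r c e) (v a e)) \<le> B"
  shows "cmod (block_tr d p q r v) \<le> 16 * B"
proof -
  have "cmod (block_tr d p q r v) \<le> (\<Sum>a<(2::nat). \<Sum>b<(2::nat). \<Sum>c<(2::nat). \<Sum>e<(2::nat). B)"
    unfolding block_tr_def by (intro sum_norm_le assms) auto
  then show ?thesis by simp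
qed

text \<open>The terms that survive in the expansion: one without \<open>m\<close>, six of second,
  four of third and one of fourth order. All powers of \<open>m\<close> involved are at most
  (1/32)^2 = 1/1024.\<close>

lemma cmod_sum16_le:
  fixes m :: real
  assumes m: "0 \<le> m" "m \<le> 1/32"
    and B0: "cmod z0 \<le> b0"
    and B: "cmod z1 \<le> b1" "cmod z2 \<le> b2" "cmod z3 \<le> b3" "cmod z4 \<le> b4" "cmod z5 \<le> b5" "cmod z6 \<le> b6"
    "cmod z7 \<le> b7" "cmod z8 \<le> b8" "cmod z9 \<le> b9" "cmod z10 \<le> b10" "cmod z11 \<le> b11"
  shows "cmod (z0 + of_real (m^2) * z1 + of_real (m^2) * z2 + of_real (m^2) * z3 + of_real (m^2) * z4
     + of_real (m^2) * z5 + of_real (m^2) * z6 + of_real (m^3) * z7 + of_real (m^3) * z8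
     + of_real (m^3) * z9 + of_real (m^3) * z10 + of_real (m^4) * z11)
     \<le> b0 + (b1 + b2 + b3 + b4 + b5 + b6 + b7 + b8 + b9 + b10 + b11) / 1024"
proof -
  have p: "cmod (of_real (m^k) * z) \<le> b / 1024" if "cmod z \<le> b" "2 \<le> k" for k z b
  proof -
    have "m ^ k \<le> m ^ 2" using m that by (intro power_decreasing) auto
    also have "\<dots> \<le> (1/32)^2" using m by (intro power_mono) auto
    finally have "m ^ k \<le> 1 / 1024" by (simp add: power2_eq_square)
    then have "m ^ k * cmod z \<le> 1 / 1024 * b" using that m by (intro mult_mono) auto
    then show ?thesis using m by (simp add: norm_mult norm_power)
  qed
  have "b0 + (b1 + b2 + b3 + b4 + b5 + b6 + b7 + b8 + b9 + b10 + b11) / 1024 =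
    b0 + b1 / 1024 + b2 / 1024 + b3 / 1024 + b4 / 1024 + b5 / 1024 + b6 / 1024 + b7 / 1024 + b8 / 1024
     + b9 / 1024 + b10 / 1024 + b11 / 1024"
    by (simp add: add_divide_distrib)
  then show ?thesis
    by (simp only:) (intro norm_triangle_mono p B B0; simp)
qed

text \<open>Split each argument into mean and traceless part on the last qubit. The four first-order
  terms cancel, the induction hypothesis bounds every remaining block product by norms, and
  \<open>two_point_real\<close> recombines the norms. The threshold 1/32 is chosen so that 16 block
  products times 1/1024 make 1/64, half of the coefficient 1/32 allowed there; the half pays for the
  new power of 2.\<close>

lemma quad_tr_noise_le:
  assumes \<mu>: "0 \<le> \<mu>" "\<mu> \<le> 1/32"
  shows "cmod (quad_tr (2 ^ n) (noise n \<mu> X) (noise n \<mu> Y) (noise n \<mu> Z) (noise n \<mu> W))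
    \<le> sqrt (hs_sq (2 ^ n) X) * sqrt (hs_sq (2 ^ n) Y) * sqrt (hs_sq (2 ^ n) Z) * sqrt (hs_sq (2 ^ n) W) / 2 ^ n"
proof (induction n arbitrary: X Y Z W)
  case 0
  show ?case
    by (simp add: quad_tr_def hs_sq_def noise_def noise_kernel_def norm_mult)
next
  case (Suc n)
  let ?d = "2 ^ n :: nat"
  define P where "P X a b = noise n \<mu> (block_mean n X a b)" for X a b
  define V where "V X a b = noise n \<mu> (block_diff n X a b)" for X a b
  let ?s = "\<lambda>X::nat \<Rightarrow> nat \<Rightarrow> complex. sqrt (hs_sq ?d (block_mean n X 0 0))"
  \<comment> \<open>\<open>x0\<close> and \<open>x1\<close> are the Hilbert-Schmidt norms of the
    mean and traceless parts over all blocks; sqrt 2 accounts for the two equal diagonal blocks of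
    the mean.\<close>
  define x0 where "x0 X = sqrt 2 * ?s X" for X :: "nat \<Rightarrow> nat \<Rightarrow> complex"
  define x1 where "x1 X = sqrt (2 * hs_sq ?d (block_diff n X 0 0)
     + hs_sq ?d (block_diff n X 0 1) + hs_sq ?d (block_diff n X 1 0))" for X
  have nn: "0 \<le> x0 X" "0 \<le> x1 X" for X
    by (simp_all add: x0_def x1_def hs_sq_nonneg)
  have norm: "sqrt (hs_sq (2 ^ Suc n) X) = sqrt ((x0 X)\<^sup>2 + (x1 X)\<^sup>2)" for X
    unfolding block_norms by (simp add: x0_def x1_def hs_sq_nonneg power_mult_distrib)
  have Pb: "sqrt (hs_sq ?d (block_mean n X a b)) \<le> x0 X" for X a b
  proof (cases "a = b")
    case True
    have "block_mean n X a a = block_mean n X 0 0" by (intro ext) (simp add: block_mean_def)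
    moreover have "1 * ?s X \<le> sqrt 2 * ?s X" by (intro mult_right_mono) (simp_all add: hs_sq_nonneg)
    ultimately show ?thesis using True by (simp add: x0_def)
  next
    case False
    then have "hs_sq ?d (block_mean n X a b) = 0" by (simp add: hs_sq_def block_mean_def)
    then show ?thesis using nn by simp
  qed
  have Vb: "sqrt (hs_sq ?d (block_diff n X a b)) \<le> x1 X" if "a < 2" "b < 2" for X a b
  proof -
    have "hs_sq ?d (block_diff n X 1 1) = hs_sq ?d (block_diff n X 0 0)"
      by (simp add: hs_sq_def block_diff_def norm_divide norm_minus_commute)
    moreover have "a = 0 \<or> a = 1" "b = 0 \<or> b = 1" using that by auto
    ultimately have "hs_sq ?d (block_diff n X a b) \<le> 2 * hs_sq ?d (block_diff n X 0 0)
     + hs_sq ?d (block_diff n X 0 1) + hs_sq ?d (block_diff n X 1 0)"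
      using hs_sq_nonneg[of ?d "block_diff n X 0 0"] hs_sq_nonneg[of ?d "block_diff n X 0 1"]
        hs_sq_nonneg[of ?d "block_diff n X 1 0"] by (elim disjE) simp_all
    then show ?thesis by (simp add: x1_def)
  qed
  \<comment> \<open>Each block is bounded by the norm of its whole component, so the 16 block
    products share one bound.\<close>
  have bound: "cmod (block_tr ?d (\<lambda>a b. noise n \<mu> (p a b)) (\<lambda>a b. noise n \<mu> (q a b))
      (\<lambda>a b. noise n \<mu> (r a b)) (\<lambda>a b. noise n \<mu> (v a b))) \<le> 16 * (x * y * z * w / 2 ^ n)"
    if "\<And>a b. a < 2 \<Longrightarrow> b < 2 \<Longrightarrow> sqrt (hs_sq ?d (p a b)) \<le> x" "\<And>a b. a < 2 \<Longrightarrow> b < 2 \<Longrightarrow> sqrt (hs_sq ?d (q a b)) \<le> y"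
      "\<And>a b. a < 2 \<Longrightarrow> b < 2 \<Longrightarrow> sqrt (hs_sq ?d (r a b)) \<le> z" "\<And>a b. a < 2 \<Longrightarrow> b < 2 \<Longrightarrow> sqrt (hs_sq ?d (v a b)) \<le> w"
      "0 \<le> x" "0 \<le> y" "0 \<le> z" "0 \<le> w"
    for p q r v x y z w
    by (intro cmod_block_tr_le order.trans[OF Suc.IH] divide_right_mono mult_mono that)
      (simp_all add: hs_sq_nonneg that)
  have expand: "quad_tr (2 ^ Suc n) (noise (Suc n) \<mu> X) (noise (Suc n) \<mu> Y) (noise (Suc n) \<mu> Z) (noise (Suc n) \<mu> W) =
     block_tr ?d (\<lambda>a b. add_scaled (P X a b) \<mu> (V X a b)) (\<lambda>a b. add_scaled (P Y a b) \<mu> (V Y a b))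
       (\<lambda>a b. add_scaled (P Z a b) \<mu> (V Z a b)) (\<lambda>a b. add_scaled (P W a b) \<mu> (V W a b))"
    unfolding quad_tr_Suc block_tr_def P_def V_def
    by (intro sum.cong refl quad_tr_cong block_noise_split) auto
  let ?B = "block_tr ?d"
  have lin: "?B (V X) (P Y) (P Z) (P W) = 0" "?B (P X) (V Y) (P Z) (P W) = 0"
    "?B (P X) (P Y) (V Z) (P W) = 0" "?B (P X) (P Y) (P Z) (V W) = 0"
    "?B (P X) (P Y) (P Z) (P W) = 2 * quad_tr ?d (P X 0 0) (P Y 0 0) (P Z 0 0) (P W 0 0)"
    unfolding P_def V_def by (fact block_tr_diff_mean)+
  let ?m = "complex_of_real"
  have e1: "quad_tr (2 ^ Suc n) (noise (Suc n) \<mu> X) (noise (Suc n) \<mu> Y) (noise (Suc n) \<mu> Z) (noise (Suc n) \<mu> W) =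
    2 * quad_tr ?d (P X 0 0) (P Y 0 0) (P Z 0 0) (P W 0 0)
    + ?m (\<mu>^2) * ?B (V X) (V Y) (P Z) (P W) + ?m (\<mu>^2) * ?B (V X) (P Y) (V Z) (P W)
    + ?m (\<mu>^2) * ?B (V X) (P Y) (P Z) (V W) + ?m (\<mu>^2) * ?B (P X) (V Y) (V Z) (P W)
    + ?m (\<mu>^2) * ?B (P X) (V Y) (P Z) (V W) + ?m (\<mu>^2) * ?B (P X) (P Y) (V Z) (V W)
    + ?m (\<mu>^3) * ?B (V X) (V Y) (V Z) (P W) + ?m (\<mu>^3) * ?B (V X) (V Y) (P Z) (V W)
    + ?m (\<mu>^3) * ?B (V X) (P Y) (V Z) (V W) + ?m (\<mu>^3) * ?B (P X) (V Y) (V Z) (V W)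
    + ?m (\<mu>^4) * ?B (V X) (V Y) (V Z) (V W)" (is "_ = ?R")
    unfolding expand
    by (simp only: block_tr_add_scaled lin of_real_power mult_zero_right add_0_left add_0_right)
      (simp only: distrib_left power2_eq_square power3_eq_cube power4_eq_xxxx mult.assoc add_ac)
  have e2: "cmod ?R \<le> 2 * (?s X * ?s Y * ?s Z * ?s W / 2 ^ n) +
     (16 * (x1 X * x1 Y * x0 Z * x0 W / 2 ^ n) + 16 * (x1 X * x0 Y * x1 Z * x0 W / 2 ^ n)
     + 16 * (x1 X * x0 Y * x0 Z * x1 W / 2 ^ n) + 16 * (x0 X * x1 Y * x1 Z * x0 W / 2 ^ n)
     + 16 * (x0 X * x1 Y * x0 Z * x1 W / 2 ^ n) + 16 * (x0 X * x0 Y * x1 Z * x1 W / 2 ^ n)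
     + 16 * (x1 X * x1 Y * x1 Z * x0 W / 2 ^ n) + 16 * (x1 X * x1 Y * x0 Z * x1 W / 2 ^ n)
     + 16 * (x1 X * x0 Y * x1 Z * x1 W / 2 ^ n) + 16 * (x0 X * x1 Y * x1 Z * x1 W / 2 ^ n)
     + 16 * (x1 X * x1 Y * x1 Z * x1 W / 2 ^ n)) / 1024" (is "_ \<le> ?B1")
    unfolding P_def V_def
    by (intro cmod_sum16_le \<mu> bound Pb Vb nn)
      (use Suc.IH[of "block_mean n X 0 0" "block_mean n Y 0 0" "block_mean n Z 0 0" "block_mean n W 0 0"] in \<open>simp_all add: norm_mult\<close>)
  have e3: "?B1 = (x0 X * x0 Y * x0 Z * x0 W + (x1 X * x1 Y * x0 Z * x0 W + x1 X * x0 Y * x1 Z * x0 W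
     + x1 X * x0 Y * x0 Z * x1 W + x0 X * x1 Y * x1 Z * x0 W
     + x0 X * x1 Y * x0 Z * x1 W + x0 X * x0 Y * x1 Z * x1 W
     + x1 X * x1 Y * x1 Z * x0 W + x1 X * x1 Y * x0 Z * x1 W
     + x1 X * x0 Y * x1 Z * x1 W + x0 X * x1 Y * x1 Z * x1 W
     + x1 X * x1 Y * x1 Z * x1 W) / 32) / 2 ^ Suc n" (is "_ = ?B2")
  proof -
    \<comment> \<open>The factor 2 from the trace over the new qubit, divided by the 4 arising from
      four factors sqrt 2, leaves exactly the required 1/2.\<close>
    have "x0 X * x0 Y * x0 Z * x0 W = 4 * (?s X * ?s Y * ?s Z * ?s W)"
      unfolding x0_def by (simp add: mult_ac)
    then have "2 * (?s X * ?s Y * ?s Z * ?s W / 2 ^ n) = x0 X * x0 Y * x0 Z * x0 W / 2 ^ Suc n"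
      by simp
    moreover have "(16 * (t1 / e) + 16 * (t2 / e) + 16 * (t3 / e) + 16 * (t4 / e) + 16 * (t5 / e) + 16 * (t6 / e)
       + 16 * (t7 / e) + 16 * (t8 / e) + 16 * (t9 / e) + 16 * (t10 / e) + 16 * (t11 / e)) / 1024
       = ((t1 + t2 + t3 + t4 + t5 + t6 + t7 + t8 + t9 + t10 + t11) / 32) / (2 * e)"
      for t1 t2 t3 t4 t5 t6 t7 t8 t9 t10 t11 e :: real
    proof -
      have "16 * (t1 / e) + 16 * (t2 / e) + 16 * (t3 / e) + 16 * (t4 / e) + 16 * (t5 / e) + 16 * (t6 / e)
       + 16 * (t7 / e) + 16 * (t8 / e) + 16 * (t9 / e) + 16 * (t10 / e) + 16 * (t11 / e)
       = 16 * (t1 + t2 + t3 + t4 + t5 + t6 + t7 + t8 + t9 + t10 + t11) / e"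
        by (simp only: distrib_left add_divide_distrib times_divide_eq_right)
      moreover have "16 * t / e / 1024 = t / 32 / (2 * e)" for t by simp
      ultimately show ?thesis by (simp only:)
    qed
    ultimately show ?thesis by (simp only: add_divide_distrib[of "x0 X * x0 Y * x0 Z * x0 W"] power_Suc)
  qed
  have e4: "?B2 \<le> sqrt (hs_sq (2 ^ Suc n) X) * sqrt (hs_sq (2 ^ Suc n) Y) * sqrt (hs_sq (2 ^ Suc n) Z) * sqrt (hs_sq (2 ^ Suc n) W) / 2 ^ Suc n"
    unfolding norm by (intro divide_right_mono two_point_real nn) simp
  show ?case unfolding e1 by (rule order.trans[OF e2 order.trans[OF eq_refl[OF e3] e4]])
qed

section \<open>Contraction of the collision entropy\<close>

definition is_state :: "nat \<Rightarrow> (nat \<Rightarrow> nat \<Rightarrow> complex) \<Rightarrow> bool" where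
  "is_state d f \<longleftrightarrow> (\<forall>x<d. \<forall>y<d. f y x = cnj (f x y))
     \<and> (\<forall>v. 0 \<le> Re (\<Sum>x<d. \<Sum>y<d. cnj (v x) * f x y * v y))
     \<and> (\<Sum>x<d. f x x) = 1"

lemma is_stateD:
  assumes "is_state d f"
  shows is_state_herm: "x < d \<Longrightarrow> y < d \<Longrightarrow> f y x = cnj (f x y)"
    and is_state_pos: "0 \<le> Re (\<Sum>x<d. \<Sum>y<d. cnj (v x) * f x y * v y)"
    and is_state_trace: "(\<Sum>x<d. f x x) = 1"
  using assms unfolding is_state_def by blast+

text \<open>With t = tr (f Y), this is nonnegativity of the variance: tr ((Y - t)^dag f (Y - t))
  equals tr (Y^dag f Y) - |t|^2 because f has trace one.\<close>

lemma is_state_cauchy_schwarz: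
  assumes "is_state d f"
  shows "(cmod (hs_sum d f Y))\<^sup>2 \<le> Re (\<Sum>z<d. \<Sum>x<d. \<Sum>y<d. cnj (Y x z) * f x y * Y y z)"
proof -
  note tr = is_state_trace[OF assms]
  define t where "t = hs_sum d f Y"
  have t1: "(\<Sum>z<d. \<Sum>x<d. cnj (Y x z) * f x z) = cnj t"
    unfolding t_def hs_sum_def by (subst sum.swap) (simp add: mult.commute)
  have t2: "(\<Sum>z<d. \<Sum>y<d. f z y * Y y z) = t"
    unfolding t_def hs_sum_def
    by (subst sum.swap) (intro sum.cong refl arg_cong2[of _ _ _ _ "(*)"] is_state_herm[OF assms]; simp)
  \<comment> \<open>\<open>v z\<close> is column z of Y minus t times the identity, so positivity of
    \<open>f\<close> can be applied column by column.\<close>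
  define v where "v z x = Y x z - (if x = z then t else 0)" for z x
  have "(\<Sum>z<d. \<Sum>x<d. \<Sum>y<d. cnj (v z x) * f x y * v z y) =
    (\<Sum>z<d. (\<Sum>x<d. \<Sum>y<d. cnj (Y x z) * f x y * Y y z) - t * (\<Sum>x<d. cnj (Y x z) * f x z)
       - cnj t * (\<Sum>y<d. f z y * Y y z) + t * cnj t * f z z)"
  proof (intro sum.cong refl)
    fix z assume z: "z \<in> {..<d}"
    have "(\<Sum>y<d. cnj (v z x) * f x y * v z y) = cnj (v z x) * (\<Sum>y<d. f x y * Y y z) - cnj (v z x) * f x z * t" for x
      using z by (simp add: v_def right_diff_distrib sum_subtractf sum_distrib_left mult.assoc
          if_distrib[of "\<lambda>u. _ * u"] sum.delta cong: if_cong)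
    then have "(\<Sum>x<d. \<Sum>y<d. cnj (v z x) * f x y * v z y) =
      (\<Sum>x<d. cnj (v z x) * ((\<Sum>y<d. f x y * Y y z) - f x z * t))"
      by (simp add: right_diff_distrib mult.assoc)
    also have "\<dots> = (\<Sum>x<d. cnj (Y x z) * ((\<Sum>y<d. f x y * Y y z) - f x z * t)) - cnj t * ((\<Sum>y<d. f z y * Y y z) - f z z * t)"
      using z by (simp add: v_def left_diff_distrib sum_subtractf
          if_distrib[of cnj] if_distrib[of "\<lambda>u. u * _"] sum.delta cong: if_cong)
    also have "\<dots> = (\<Sum>x<d. \<Sum>y<d. cnj (Y x z) * f x y * Y y z) - t * (\<Sum>x<d. cnj (Y x z) * f x z)
       - cnj t * (\<Sum>y<d. f z y * Y y z) + t * cnj t * f z z"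
      by (simp add: right_diff_distrib sum_subtractf sum_distrib_left mult_ac)
    finally show "(\<Sum>x<d. \<Sum>y<d. cnj (v z x) * f x y * v z y) =
      (\<Sum>x<d. \<Sum>y<d. cnj (Y x z) * f x y * Y y z) - t * (\<Sum>x<d. cnj (Y x z) * f x z)
       - cnj t * (\<Sum>y<d. f z y * Y y z) + t * cnj t * f z z" .
  qed
  also have "\<dots> = (\<Sum>z<d. \<Sum>x<d. \<Sum>y<d. cnj (Y x z) * f x y * Y y z) - t * cnj t"
    by (simp only: sum.distrib sum_subtractf sum_distrib_left[symmetric] t1 t2 tr) simp
  finally have eq: "(\<Sum>z<d. \<Sum>x<d. \<Sum>y<d. cnj (v z x) * f x y * v z y) =
     (\<Sum>z<d. \<Sum>x<d. \<Sum>y<d. cnj (Y x z) * f x y * Y y z) - of_real ((cmod t)\<^sup>2)"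
    by (simp only: complex_norm_square)
  have "0 \<le> Re (\<Sum>z<d. \<Sum>x<d. \<Sum>y<d. cnj (v z x) * f x y * v z y)"
    by (subst Re_sum) (intro sum_nonneg is_state_pos[OF assms])
  then show ?thesis unfolding eq t_def by simp
qed

text \<open>A substitute for the duality of Schatten norms: after
  \<open>is_state_cauchy_schwarz\<close>, apply Cauchy-Schwarz to tr (f M) with M = Y Y^dag, whose
  squared Hilbert-Schmidt norm is \<open>quad_tr\<close> at four copies of Y.\<close>

lemma is_state_hs_sum_le:
  assumes "is_state d f"
  shows "(cmod (hs_sum d f Y))\<^sup>2 \<le> sqrt (hs_sq d f) * sqrt (cmod (quad_tr d Y Y Y Y))"
proof -
  define M where "M y x = (\<Sum>z<d. Y y z * cnj (Y x z))" for y x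
  have herm: "cnj (M y x) = M x y" for x y by (simp add: M_def mult.commute)
  have "(\<Sum>z<d. \<Sum>x<d. \<Sum>y<d. cnj (Y x z) * f x y * Y y z) = (\<Sum>x<d. \<Sum>y<d. \<Sum>z<d. cnj (Y x z) * f x y * Y y z)"
    by (subst sum.swap, subst (2) sum.swap) (rule refl)
  also have "\<dots> = hs_sum d M f"
    unfolding hs_sum_def herm unfolding M_def sum_distrib_right by (intro sum.cong refl) (simp only: mult_ac)
  finally have "Re (\<Sum>z<d. \<Sum>x<d. \<Sum>y<d. cnj (Y x z) * f x y * Y y z) \<le> sqrt (hs_sq d M) * sqrt (hs_sq d f)"
    using order.trans[OF complex_Re_le_cmod hs_sum_le] by metis
  moreover have "complex_of_real (hs_sq d M) = quad_tr d Y Y Y Y"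
  proof -
    have "complex_of_real (hs_sq d M) = (\<Sum>a<d. \<Sum>c<d. M a c * M c a)"
      unfolding hs_sum_self[symmetric] hs_sum_def herm by (simp add: mult.commute)
    also have "\<dots> = (\<Sum>a<d. \<Sum>c<d. \<Sum>b<d. \<Sum>e<d. Y a b * cnj (Y c b) * Y c e * cnj (Y a e))"
      unfolding M_def sum_product by (simp add: mult.assoc)
    also have "\<dots> = quad_tr d Y Y Y Y"
      unfolding quad_tr_def by (subst (2) sum.swap) (rule refl)
    finally show ?thesis .
  qed
  then have "hs_sq d M = cmod (quad_tr d Y Y Y Y)"
    by (metis norm_of_real abs_of_nonneg hs_sq_nonneg)
  ultimately show ?thesis
    using is_state_cauchy_schwarz[OF assms, of Y] by (simp add: mult.commute)
qed

text \<open>The left side q' equals tr (f Y) with Y = D D f. Hypercontractivity for the outer D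
  bounds \<open>quad_tr\<close> of Y by q'^2 / 2^n, and one factor q' cancels. In terms of Q = 2^n q
  this reads Q' <= sqrt Q.\<close>

lemma hs_sq_noise_strong:
  assumes f: "is_state (2 ^ n) f" and \<mu>: "0 \<le> \<mu>" "\<mu> \<le> 1/32"
  shows "hs_sq (2 ^ n) (noise n \<mu> f) \<le> sqrt (hs_sq (2 ^ n) f / 2 ^ n)"
proof -
  define q where "q = hs_sq (2 ^ n) f"
  define q' where "q' = hs_sq (2 ^ n) (noise n \<mu> f)"
  have q': "0 \<le> q'" by (simp add: q'_def hs_sq_nonneg)
  have q: "0 \<le> q" by (simp add: q_def hs_sq_nonneg)
  define Y where "Y = noise n \<mu> (noise n \<mu> f)"
  have "complex_of_real q' = hs_sum (2 ^ n) f Y"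
    unfolding q'_def hs_sq_noise Y_def noise_noise power2_eq_square ..
  then have "q' = cmod (hs_sum (2 ^ n) f Y)"
    using q' by (metis norm_of_real abs_of_nonneg)
  then have "q'\<^sup>2 \<le> sqrt q * sqrt (cmod (quad_tr (2 ^ n) Y Y Y Y))"
    using is_state_hs_sum_le[OF f, of Y] by (simp add: q_def)
  also have "\<dots> \<le> sqrt q * sqrt (q'\<^sup>2 / 2 ^ n)"
  proof (intro mult_left_mono real_sqrt_le_mono)
    have "cmod (quad_tr (2 ^ n) Y Y Y Y) \<le> sqrt q' * sqrt q' * sqrt q' * sqrt q' / 2 ^ n"
      unfolding Y_def q'_def by (rule quad_tr_noise_le[OF \<mu>])
    also have "sqrt q' * sqrt q' * sqrt q' * sqrt q' = q'\<^sup>2"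
      using q' by (simp add: power2_eq_square)
    finally show "cmod (quad_tr (2 ^ n) Y Y Y Y) \<le> q'\<^sup>2 / 2 ^ n" .
  qed (use q in simp)
  also have "\<dots> = sqrt (q / 2 ^ n) * q'"
    using q' by (simp add: real_sqrt_divide)
  finally have "q' * q' \<le> sqrt (q / 2 ^ n) * q'" by (simp add: power2_eq_square)
  then have "q' \<le> sqrt (q / 2 ^ n)"
    using q' q by (cases "q' = 0") (auto simp: mult_le_cancel_right)
  then show ?thesis by (simp add: q'_def q_def)
qed

text \<open>Cauchy-Schwarz against the identity, whose squared norm is d. Hence the quantity Q never
  drops below 1 and its logarithm is nonnegative.\<close>

lemma is_state_hs_sq_ge:
  assumes "is_state d f"
  shows "1 \<le> real d * hs_sq d f"
proof -
  have "1 = cmod (\<Sum>x<d. f x x)" using is_state_trace[OF assms] by simp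
  also have "\<dots> = cmod (hs_sum d (\<lambda>x y. of_bool (x = y)) f)"
  proof -
    have "cnj (of_bool (x = y)) * f x y = (if x = y then f x x else 0)" for x y by simp
    then show ?thesis unfolding hs_sum_def by simp
  qed
  also have "\<dots> \<le> sqrt (hs_sq d (\<lambda>x y. of_bool (x = y))) * sqrt (hs_sq d f)" by (rule hs_sum_le)
  also have "hs_sq d (\<lambda>x y. of_bool (x = y)) = real d"
  proof -
    have "(cmod (of_bool (x = y)))\<^sup>2 = (if x = y then 1 else 0)" for x y :: nat by simp
    then show ?thesis unfolding hs_sq_def by simp
  qed
  finally show ?thesis by (simp flip: real_sqrt_mult)
qed

text \<open>Each interpolation step averages the exponent with 1, turning e into (1 + e) / 2.
  Starting from 1/2 at strong noise, k steps give 1 - 1 / 2^(k+1).\<close>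

lemma noise_contraction:
  assumes f: "is_state (2 ^ n) f" and \<mu>: "0 \<le> \<mu>" "\<mu> \<le> 1" and k: "\<mu> ^ (2 ^ k) \<le> 1/32"
  shows "2 ^ n * hs_sq (2 ^ n) (noise n \<mu> f) \<le> (2 ^ n * hs_sq (2 ^ n) f) powr (1 - 1 / 2 ^ Suc k)"
  using \<mu> k
proof (induction k arbitrary: \<mu>)
  case 0
  define Q where "Q = 2 ^ n * hs_sq (2 ^ n) f"
  have Q: "1 \<le> Q" unfolding Q_def using is_state_hs_sq_ge[OF f] by simp
  have "2 ^ n * hs_sq (2 ^ n) (noise n \<mu> f) \<le> 2 ^ n * sqrt (hs_sq (2 ^ n) f / 2 ^ n)"
    using 0 hs_sq_noise_strong[OF f, of \<mu>] by (intro mult_left_mono) auto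
  also have "\<dots> = sqrt ((2 ^ n)\<^sup>2 * (hs_sq (2 ^ n) f / 2 ^ n))"
    unfolding real_sqrt_mult by simp
  also have "\<dots> = sqrt Q" by (simp add: Q_def power2_eq_square)
  also have "\<dots> = Q powr (1 - 1 / 2 ^ Suc 0)" using Q by (simp add: powr_half_sqrt)
  finally show ?case unfolding Q_def .
next
  case (Suc k)
  define Q where "Q = 2 ^ n * hs_sq (2 ^ n) f"
  have Q: "1 \<le> Q" unfolding Q_def using is_state_hs_sq_ge[OF f] by simp
  let ?e = "1 - 1 / 2 ^ Suc k :: real"
  have "(\<mu>\<^sup>2) ^ (2 ^ k) \<le> 1/32" using Suc.prems(3) by (simp add: power_mult[symmetric])
  then have IH: "2 ^ n * hs_sq (2 ^ n) (noise n (\<mu>\<^sup>2) f) \<le> Q powr ?e"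
    unfolding Q_def using Suc.prems by (intro Suc.IH) (auto simp: power_le_one)
  have "2 ^ n * hs_sq (2 ^ n) (noise n \<mu> f) \<le> 2 ^ n * sqrt (hs_sq (2 ^ n) f * hs_sq (2 ^ n) (noise n (\<mu>\<^sup>2) f))"
    by (intro mult_left_mono hs_sq_noise_le) simp
  also have "\<dots> = sqrt (Q * (2 ^ n * hs_sq (2 ^ n) (noise n (\<mu>\<^sup>2) f)))"
    by (simp add: Q_def real_sqrt_mult)
  also have "\<dots> \<le> sqrt (Q * Q powr ?e)"
    using Q IH by (intro real_sqrt_le_mono mult_left_mono) auto
  also have "\<dots> = (Q powr (1 + ?e)) powr (1/2)"
    using Q by (subst powr_half_sqrt) (simp_all only: powr_add powr_one powr_ge_zero mult_nonneg_nonneg)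
  also have "\<dots> = Q powr (1 - 1 / 2 ^ Suc (Suc k))"
    unfolding powr_powr by (rule arg_cong[of _ _ "\<lambda>t. Q powr t"]) (simp add: field_simps)
  finally show ?case unfolding Q_def .
qed

section \<open>Noise maps states to states\<close>

lemma sum_diagonal_noise:
  "(\<Sum>x<2 ^ n. noise n \<mu> f x x) = (\<Sum>x<2 ^ n. f x x)"
proof -
  have k: "(\<Sum>x<2 ^ n. noise_kernel n \<mu> x' y' x x) = of_bool (x' = y')" if "x' < 2 ^ n" "y' < 2 ^ n" for x' y'
  proof -
    have one: "(\<Sum>c<2. dep_kernel \<mu> a b c c) = of_bool (a = b)" if "a < 2" "b < 2" for a b
      using that by (auto simp: dep_kernel_def less_2_cases_iff sum_less_2 field_simps)
    have "(\<Sum>x<2 ^ n. noise_kernel n \<mu> x' y' x x) = (\<Prod>i<n. of_bool (qubit x' i = qubit y' i))"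
      unfolding noise_kernel_def sum_prod_qubit[where n = n and f = "\<lambda>i c. dep_kernel \<mu> (qubit x' i) (qubit y' i) c c"]
      by (simp add: one qubit_less_2)
    also have "\<dots> = of_bool (x' = y')"
    proof (cases "x' = y'")
      case False
      have "\<exists>i<n. qubit x' i \<noteq> qubit y' i"
      proof (rule ccontr)
        assume "\<not> ?thesis"
        then have "x' = y'" by (intro qubit_eqI[OF that]) auto
        with False show False by simp
      qed
      then obtain i where "i < n" "qubit x' i \<noteq> qubit y' i" by auto
      then show ?thesis using False by (auto intro!: prod_zero bexI[of _ i])
    qed simp
    finally show ?thesis .
  qed
  have "(\<Sum>x<2 ^ n. noise n \<mu> f x x) =
      (\<Sum>x'<2 ^ n. \<Sum>y'<2 ^ n. f x' y' * complex_of_real (\<Sum>x<2 ^ n. noise_kernel n \<mu> x' y' x x))"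
    unfolding noise_def of_real_sum sum_distrib_left
    by (subst sum.swap, subst (2) sum.swap) (rule refl)
  also have "\<dots> = (\<Sum>x'<2 ^ n. \<Sum>y'<2 ^ n. if x' = y' then f x' x' else 0)"
    by (intro sum.cong refl) (simp add: k)
  finally show ?thesis by simp
qed

text \<open>Kraus operators of the depolarizing channel: \<open>\<surd>\<mu>\<close> times the identity, and
  \<open>\<surd>((1 - \<mu>) / 2)\<close> times the four matrix units.\<close>

definition dep_kraus :: "real \<Rightarrow> nat \<Rightarrow> nat \<Rightarrow> nat \<Rightarrow> real" where
  "dep_kraus \<mu> s c a = (if s = 0 then sqrt \<mu> * of_bool (c = a)
     else sqrt ((1 - \<mu>) / 2) * of_bool (c = (s - 1) div 2 \<and> a = (s - 1) mod 2))"

lemma dep_kernel_kraus: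
  assumes "0 \<le> \<mu>" "\<mu> \<le> 1" "a < 2" "b < 2" "c < 2" "d < 2"
  shows "dep_kernel \<mu> a b c d = (\<Sum>s<5. dep_kraus \<mu> s c a * dep_kraus \<mu> s d b)"
proof -
  have s5: "(\<Sum>s<(5::nat). g s) = g 0 + g 1 + g 2 + g 3 + g 4" for g :: "nat \<Rightarrow> real"
    by (simp add: eval_nat_numeral)
  have "a = 0 \<or> a = 1" "b = 0 \<or> b = 1" "c = 0 \<or> c = 1" "d = 0 \<or> d = 1" using assms by auto
  then show ?thesis
    using assms(1,2) unfolding s5
    by (elim disjE) (simp_all add: dep_kernel_def dep_kraus_def)
qed

definition noise_kraus :: "nat \<Rightarrow> real \<Rightarrow> (nat \<Rightarrow> nat) \<Rightarrow> nat \<Rightarrow> nat \<Rightarrow> real" where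
  "noise_kraus n \<mu> s x x' = (\<Prod>i<n. dep_kraus \<mu> (s i) (qubit x i) (qubit x' i))"

text \<open>Expanding the product over the qubits gives a sum over strings \<open>s\<close> of
  single-qubit Kraus labels.\<close>

lemma noise_kernel_kraus:
  assumes "0 \<le> \<mu>" "\<mu> \<le> 1"
  shows "noise_kernel n \<mu> x' y' x y =
    (\<Sum>s\<in>PiE {..<n} (\<lambda>_. {..<5}). noise_kraus n \<mu> s x x' * noise_kraus n \<mu> s y y')"
proof -
  have "noise_kernel n \<mu> x' y' x y = (\<Prod>i<n. \<Sum>s<5. dep_kraus \<mu> s (qubit x i) (qubit x' i) * dep_kraus \<mu> s (qubit y i) (qubit y' i))"
    unfolding noise_kernel_def by (intro prod.cong refl dep_kernel_kraus assms qubit_less_2)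
  also have "\<dots> = (\<Sum>s\<in>PiE {..<n} (\<lambda>_. {..<5}). noise_kraus n \<mu> s x x' * noise_kraus n \<mu> s y y')"
    unfolding noise_kraus_def prod.distrib[symmetric] by (rule prod_sum_PiE) auto
  finally show ?thesis .
qed

text \<open>For positivity, the Kraus form rewrites the quadratic form of the output at
  \<open>v\<close> as a sum, over Kraus strings, of quadratic forms of \<open>f\<close> at
  transformed vectors.\<close>

lemma is_state_noise:
  assumes f: "is_state (2 ^ n) f" and \<mu>: "0 \<le> \<mu>" "\<mu> \<le> 1"
  shows "is_state (2 ^ n) (noise n \<mu> f)"
  unfolding is_state_def
proof (intro conjI allI impI)
  fix x y
  have k: "noise_kernel n \<mu> x' y' y x = noise_kernel n \<mu> y' x' x y" for x' y'
    unfolding noise_kernel_def by (intro prod.cong refl) (auto simp: dep_kernel_def)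
  have "noise n \<mu> f y x = (\<Sum>y'<2 ^ n. \<Sum>x'<2 ^ n. f x' y' * complex_of_real (noise_kernel n \<mu> y' x' x y))"
    unfolding noise_def k by (rule sum.swap)
  also have "\<dots> = cnj (noise n \<mu> f x y)"
    unfolding noise_def cnj_sum
    by (intro sum.cong refl) (simp add: is_state_herm[OF f, symmetric])
  finally show "noise n \<mu> f y x = cnj (noise n \<mu> f x y)" .
next
  fix v
  let ?I = "{..<2 ^ n} :: nat set" and ?S = "PiE {..<n} (\<lambda>_. {..<5::nat})"
  define w where "w s x' = (\<Sum>x\<in>?I. v x * complex_of_real (noise_kraus n \<mu> s x x'))" for s x'
  have "(\<Sum>x\<in>?I. \<Sum>y\<in>?I. cnj (v x) * noise n \<mu> f x y * v y) =
    (\<Sum>x\<in>?I. \<Sum>y\<in>?I. \<Sum>x'\<in>?I. \<Sum>y'\<in>?I. \<Sum>s\<in>?S. cnj (v x) * noise_kraus n \<mu> s x x' * f x' y' * (v y * noise_kraus n \<mu> s y y'))"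
    unfolding noise_def noise_kernel_kraus[OF \<mu>] of_real_sum sum_distrib_left sum_distrib_right
    by (intro sum.cong refl) (simp only: of_real_mult mult_ac)
  also have "\<dots> = (\<Sum>s\<in>?S. \<Sum>x\<in>?I. \<Sum>y\<in>?I. \<Sum>x'\<in>?I. \<Sum>y'\<in>?I. cnj (v x) * noise_kraus n \<mu> s x x' * f x' y' * (v y * noise_kraus n \<mu> s y y'))"
    by (subst (4) sum.swap, subst (3) sum.swap, subst (2) sum.swap, subst (1) sum.swap) (rule refl)
  also have "\<dots> = (\<Sum>s\<in>?S. \<Sum>x'\<in>?I. \<Sum>y'\<in>?I. \<Sum>x\<in>?I. \<Sum>y\<in>?I. cnj (v x) * noise_kraus n \<mu> s x x' * f x' y' * (v y * noise_kraus n \<mu> s y y'))"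
    by (subst (3) sum.swap, subst (2) sum.swap, subst (4) sum.swap, subst (3) sum.swap) (rule refl)
  also have "\<dots> = (\<Sum>s\<in>?S. \<Sum>x'\<in>?I. \<Sum>y'\<in>?I. cnj (w s x') * f x' y' * w s y')"
    unfolding w_def cnj_sum sum_distrib_left sum_distrib_right
    by (intro sum.cong refl trans[OF sum.swap]) simp
  finally have "(\<Sum>x\<in>?I. \<Sum>y\<in>?I. cnj (v x) * noise n \<mu> f x y * v y) =
    (\<Sum>s\<in>?S. \<Sum>x'\<in>?I. \<Sum>y'\<in>?I. cnj (w s x') * f x' y' * w s y')" .
  then show "0 \<le> Re (\<Sum>x\<in>?I. \<Sum>y\<in>?I. cnj (v x) * noise n \<mu> f x y * v y)"
    by (simp only:) (subst Re_sum, intro sum_nonneg is_state_pos[OF f])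
next
  show "(\<Sum>x<2 ^ n. noise n \<mu> f x x) = 1"
    using is_state_trace[OF f] by (simp add: sum_diagonal_noise)
qed

section \<open>Conjugation by unitaries\<close>

definition conj_op :: "nat \<Rightarrow> (nat \<Rightarrow> nat \<Rightarrow> complex) \<Rightarrow> (nat \<Rightarrow> nat \<Rightarrow> complex) \<Rightarrow> nat \<Rightarrow> nat \<Rightarrow> complex" where
  "conj_op d U f x y = (\<Sum>a<d. \<Sum>b<d. U x a * f a b * cnj (U y b))"

lemma hs_sum_conj_op: "hs_sum d (conj_op d U f) g = hs_sum d f (conj_op d (\<lambda>x y. cnj (U y x)) g)"
proof -
  have "hs_sum d (conj_op d U f) g = (\<Sum>x<d. \<Sum>y<d. \<Sum>a<d. \<Sum>b<d. cnj (f a b) * (cnj (U x a) * g x y * U y b))"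
    unfolding hs_sum_def conj_op_def cnj_sum sum_distrib_left sum_distrib_right
    by (intro sum.cong refl) (simp add: mult_ac)
  also have "\<dots> = (\<Sum>a<d. \<Sum>b<d. \<Sum>x<d. \<Sum>y<d. cnj (f a b) * (cnj (U x a) * g x y * U y b))"
    by (subst (2) sum.swap, subst (1) sum.swap, subst (3) sum.swap, subst (2) sum.swap) (rule refl)
  also have "\<dots> = hs_sum d f (conj_op d (\<lambda>x y. cnj (U y x)) g)"
    unfolding hs_sum_def conj_op_def sum_distrib_left by simp
  finally show ?thesis .
qed

lemma conj_op_adjoint:
  assumes U: "\<And>a b. a < d \<Longrightarrow> b < d \<Longrightarrow> (\<Sum>x<d. cnj (U x a) * U x b) = of_bool (a = b)"
    and "a < d" "b < d"
  shows "conj_op d (\<lambda>x y. cnj (U y x)) (conj_op d U f) a b = f a b"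
proof -
  have "conj_op d (\<lambda>x y. cnj (U y x)) (conj_op d U f) a b =
      (\<Sum>x<d. \<Sum>y<d. \<Sum>a'<d. \<Sum>b'<d. f a' b' * (cnj (U x a) * U x a') * (cnj (U y b') * U y b))"
    unfolding conj_op_def sum_distrib_left sum_distrib_right
    by (intro sum.cong refl) (simp add: mult_ac)
  also have "\<dots> = (\<Sum>a'<d. \<Sum>b'<d. \<Sum>x<d. \<Sum>y<d. f a' b' * (cnj (U x a) * U x a') * (cnj (U y b') * U y b))"
    by (subst (2) sum.swap, subst (1) sum.swap, subst (3) sum.swap, subst (2) sum.swap) (rule refl)
  also have "\<dots> = (\<Sum>a'<d. \<Sum>b'<d. f a' b' * (\<Sum>x<d. cnj (U x a) * U x a') * (\<Sum>y<d. cnj (U y b') * U y b))"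
    unfolding sum_distrib_left sum_distrib_right by (intro sum.cong refl sum.swap)
  also have "\<dots> = (\<Sum>a'<d. \<Sum>b'<d. f a' b' * of_bool (a = a') * of_bool (b' = b))"
    using assms by (intro sum.cong refl) simp
  also have "\<dots> = f a b"
    using assms(2,3) by (simp add: of_bool_def if_distrib[of "\<lambda>u. _ * u"] cong: if_cong)
  finally show ?thesis .
qed

text \<open>The norm is preserved because conjugation by the adjoint undoes conjugation by U;
  positivity at v is positivity of f at U^dag v.\<close>

lemma conj_op_unitary:
  assumes U: "\<And>a b. a < d \<Longrightarrow> b < d \<Longrightarrow> (\<Sum>x<d. cnj (U x a) * U x b) = of_bool (a = b)"
    and f: "is_state d f"
  shows "is_state d (conj_op d U f)" and "hs_sq d (conj_op d U f) = hs_sq d f"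
proof -
  have "complex_of_real (hs_sq d (conj_op d U f)) = hs_sum d f f"
    unfolding hs_sum_self[symmetric] hs_sum_conj_op unfolding hs_sum_def
    by (intro sum.cong refl) (simp add: conj_op_adjoint[OF U])
  then show "hs_sq d (conj_op d U f) = hs_sq d f" by (simp add: hs_sum_self)
  show "is_state d (conj_op d U f)"
    unfolding is_state_def
  proof (intro conjI allI impI)
    fix x y
    have "conj_op d U f y x = (\<Sum>b<d. \<Sum>a<d. U y a * f a b * cnj (U x b))"
      unfolding conj_op_def by (rule sum.swap)
    also have "\<dots> = cnj (conj_op d U f x y)"
      unfolding conj_op_def cnj_sum
      by (intro sum.cong refl) (simp add: is_state_herm[OF f, symmetric] mult_ac)
    finally show "conj_op d U f y x = cnj (conj_op d U f x y)" .
  next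
    fix v
    define w where "w a = (\<Sum>x<d. cnj (U x a) * v x)" for a
    have "(\<Sum>x<d. \<Sum>y<d. cnj (v x) * conj_op d U f x y * v y) =
      (\<Sum>x<d. \<Sum>y<d. \<Sum>a<d. \<Sum>b<d. (U x a * cnj (v x)) * f a b * (cnj (U y b) * v y))"
      unfolding conj_op_def sum_distrib_left sum_distrib_right
      by (intro sum.cong refl) (simp only: mult_ac)
    also have "\<dots> = (\<Sum>a<d. \<Sum>b<d. \<Sum>x<d. \<Sum>y<d. (U x a * cnj (v x)) * f a b * (cnj (U y b) * v y))"
      by (subst (2) sum.swap, subst (1) sum.swap, subst (3) sum.swap, subst (2) sum.swap) (rule refl)
    also have "\<dots> = (\<Sum>a<d. \<Sum>b<d. cnj (w a) * f a b * w b)"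
      unfolding w_def cnj_sum sum_distrib_left sum_distrib_right
      by (intro sum.cong refl trans[OF sum.swap]) simp
    finally show "0 \<le> Re (\<Sum>x<d. \<Sum>y<d. cnj (v x) * conj_op d U f x y * v y)"
      by (simp only: is_state_pos[OF f])
  next
    have "(\<Sum>x<d. conj_op d U f x x) = (\<Sum>x<d. \<Sum>a<d. \<Sum>b<d. f a b * (cnj (U x b) * U x a))"
      unfolding conj_op_def by (intro sum.cong refl) (simp only: mult_ac)
    also have "\<dots> = (\<Sum>a<d. \<Sum>b<d. f a b * (\<Sum>x<d. cnj (U x b) * U x a))"
      unfolding sum_distrib_left by (subst (1) sum.swap, subst (2) sum.swap) (rule refl)
    also have "\<dots> = (\<Sum>a<d. \<Sum>b<d. f a b * of_bool (b = a))"
      by (intro sum.cong refl) (simp add: U)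
    also have "\<dots> = 1"
      using is_state_trace[OF f] by (simp add: of_bool_def if_distrib[of "\<lambda>u. _ * u"] cong: if_cong)
    finally show "(\<Sum>x<d. conj_op d U f x x) = 1" .
  qed
qed

text \<open>The sharp bound is 1; the crude one only enlarges the base of the final estimate from
  2^n to 4^n. It follows from |f_ab|^2 <= f_aa, which is \<open>is_state_cauchy_schwarz\<close> at
  the matrix unit E_ab.\<close>

lemma is_state_hs_sq_le:
  assumes "is_state d f"
  shows "hs_sq d f \<le> real d"
proof -
  have entry: "(cmod (f a b))\<^sup>2 \<le> Re (f a a)" if "a < d" "b < d" for a b
  proof -
    define Y :: "nat \<Rightarrow> nat \<Rightarrow> complex" where "Y x z = (if x = a then if z = b then 1 else 0 else 0)" for x z
    have "hs_sum d f Y = cnj (f a b)"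
    proof -
      have "(\<Sum>y<d. cnj (f x y) * Y x y) = (if x = a then cnj (f a b) else 0)" for x
        using that by (simp add: Y_def if_distrib[of "\<lambda>u. _ * u"] cong: if_cong)
      then show ?thesis using that by (simp add: hs_sum_def)
    qed
    moreover have "(\<Sum>z<d. \<Sum>x<d. \<Sum>y<d. cnj (Y x z) * f x y * Y y z) = f a a"
    proof -
      have "(\<Sum>y<d. cnj (Y x z) * f x y * Y y z) = (if x = a then if z = b then f a a else 0 else 0)" for x z
        using that by (simp add: Y_def if_distrib[of "\<lambda>u. _ * u"] cong: if_cong)
      then have "(\<Sum>x<d. \<Sum>y<d. cnj (Y x z) * f x y * Y y z) = (if z = b then f a a else 0)" for z
        using that by simp
      then show ?thesis using that by simp
    qed
    ultimately show ?thesis using is_state_cauchy_schwarz[OF assms, of Y] by simp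
  qed
  have "hs_sq d f \<le> (\<Sum>x<d. \<Sum>y<d. Re (f x x))"
    unfolding hs_sq_def by (intro sum_mono entry) auto
  also have "\<dots> = real d * Re (\<Sum>x<d. f x x)" by (simp add: sum_distrib_left)
  finally show ?thesis by (simp add: is_state_trace[OF assms])
qed

section \<open>From matrices to functions of two indices\<close>

lemma mat_adjoint_index:
  assumes "i < dim_col A" "j < dim_row A"
  shows "mat_adjoint A $$ (i, j) = cnj (A $$ (j, i))"
  using assms unfolding mat_adjoint_def by (simp add: mat_of_rows_index)

lemma mat_adjoint_dim: "dim_row (mat_adjoint A) = dim_col A" "dim_col (mat_adjoint A) = dim_row A"
  unfolding mat_adjoint_def by simp_all

lemma mult_mat_index_sum:
  assumes "A \<in> carrier_mat n m" "B \<in> carrier_mat m k" "i < n" "j < k"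
  shows "(A * B) $$ (i, j) = (\<Sum>l<m. A $$ (i, l) * B $$ (l, j))"
  using assms by (auto simp: scalar_prod_def lessThan_atLeast0 intro!: sum.cong)

lemma mat_adjoint_carrier: "A \<in> carrier_mat n m \<Longrightarrow> mat_adjoint A \<in> carrier_mat m n"
  by (auto simp: mat_adjoint_dim intro!: carrier_matI)

abbreviation entries :: "complex mat \<Rightarrow> nat \<Rightarrow> nat \<Rightarrow> complex" where
  "entries M \<equiv> \<lambda>x y. M $$ (x, y)"

lemma unitary_op_columns:
  assumes "unitary_op n U" "a < 2 ^ n" "b < 2 ^ n"
  shows "(\<Sum>x<2 ^ n. cnj (U $$ (x, a)) * U $$ (x, b)) = of_bool (a = b)"
proof -
  have U: "U \<in> carrier_mat (2 ^ n) (2 ^ n)" and eq: "mat_adjoint U * U = 1\<^sub>m (2 ^ n)"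
    using assms by (auto simp: unitary_op_def)
  have "(mat_adjoint U * U) $$ (a, b) = (\<Sum>x<2 ^ n. cnj (U $$ (x, a)) * U $$ (x, b))"
    unfolding mult_mat_index_sum[OF mat_adjoint_carrier[OF U] U assms(2,3)]
    using U assms by (intro sum.cong refl) (simp add: mat_adjoint_index)
  moreover have "1\<^sub>m (2 ^ n) $$ (a, b) = (of_bool (a = b) :: complex)" using assms by simp
  ultimately show ?thesis unfolding eq by simp
qed

lemma conj_op_entries:
  assumes "U \<in> carrier_mat d d" "\<rho> \<in> carrier_mat d d" "x < d" "y < d"
  shows "(U * \<rho> * mat_adjoint U) $$ (x, y) = conj_op d (entries U) (entries \<rho>) x y"
proof -
  have "(U * \<rho> * mat_adjoint U) $$ (x, y) = (\<Sum>b<d. (U * \<rho>) $$ (x, b) * mat_adjoint U $$ (b, y))"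
    using assms by (intro mult_mat_index_sum[of _ d d _ d] mat_adjoint_carrier mult_carrier_mat)
  also have "\<dots> = (\<Sum>b<d. \<Sum>a<d. U $$ (x, a) * \<rho> $$ (a, b) * cnj (U $$ (y, b)))"
  proof (intro sum.cong refl)
    fix b assume "b \<in> {..<d}"
    then have "(U * \<rho>) $$ (x, b) = (\<Sum>a<d. U $$ (x, a) * \<rho> $$ (a, b))" "mat_adjoint U $$ (b, y) = cnj (U $$ (y, b))"
      using assms by (intro mult_mat_index_sum[of U d d \<rho> d] mat_adjoint_index; simp)+
    then show "(U * \<rho>) $$ (x, b) * mat_adjoint U $$ (b, y) = (\<Sum>a<d. U $$ (x, a) * \<rho> $$ (a, b) * cnj (U $$ (y, b)))"
      by (simp only: sum_distrib_right)
  qed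
  also have "\<dots> = conj_op d (entries U) (entries \<rho>) x y"
    unfolding conj_op_def by (rule sum.swap)
  finally show ?thesis .
qed

lemma is_state_cong:
  assumes "\<And>x y. x < d \<Longrightarrow> y < d \<Longrightarrow> f x y = g x y"
  shows "is_state d f = is_state d g"
proof -
  have "(\<Sum>x<d. \<Sum>y<d. cnj (v x) * f x y * v y) = (\<Sum>x<d. \<Sum>y<d. cnj (v x) * g x y * v y)" for v
    using assms by (intro sum.cong refl) simp
  moreover have "(\<Sum>x<d. f x x) = (\<Sum>x<d. g x x)" using assms by (intro sum.cong refl) simp
  moreover have "(\<forall>x<d. \<forall>y<d. f y x = cnj (f x y)) = (\<forall>x<d. \<forall>y<d. g y x = cnj (g x y))"
    by (intro all_cong1 imp_cong refl) (simp only: assms)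
  ultimately show ?thesis unfolding is_state_def by (simp only:)
qed

lemma hs_sq_cong:
  assumes "\<And>x y. x < d \<Longrightarrow> y < d \<Longrightarrow> f x y = g x y"
  shows "hs_sq d f = hs_sq d g"
  unfolding hs_sq_def using assms by (intro sum.cong refl) simp

lemma noise_cong:
  assumes "\<And>x y. x < 2 ^ n \<Longrightarrow> y < 2 ^ n \<Longrightarrow> f x y = g x y"
  shows "noise n \<mu> f = noise n \<mu> g"
  unfolding noise_def using assms by (intro ext sum.cong refl) simp

lemma density_op_is_state:
  assumes "density_op n \<rho>"
  shows "is_state (2 ^ n) (entries \<rho>)"
  unfolding is_state_def
proof (intro conjI allI impI)
  have \<rho>: "\<rho> \<in> carrier_mat (2 ^ n) (2 ^ n)" and h: "mat_adjoint \<rho> = \<rho>"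
    and p: "\<And>v. v \<in> carrier_vec (2 ^ n) \<Longrightarrow> 0 \<le> Re ((\<rho> *\<^sub>v v) \<bullet>c v)" and t: "mat_trace \<rho> = 1"
    using assms by (auto simp: density_op_def)
  show "\<rho> $$ (y, x) = cnj (\<rho> $$ (x, y))" if "x < 2 ^ n" "y < 2 ^ n" for x y
    using that \<rho> mat_adjoint_index[of y \<rho> x] h by simp
  show "(\<Sum>x<2 ^ n. \<rho> $$ (x, x)) = 1" using t \<rho> by (simp add: mat_trace_def)
  fix v
  have "(\<rho> *\<^sub>v vec (2 ^ n) v) \<bullet>c vec (2 ^ n) v = (\<Sum>x<2 ^ n. \<Sum>y<2 ^ n. cnj (v x) * \<rho> $$ (x, y) * v y)"
    using \<rho> by (auto simp: scalar_prod_def lessThan_atLeast0 sum_distrib_right sum_distrib_left mult_ac intro!: sum.cong)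
  then show "0 \<le> Re (\<Sum>x<2 ^ n. \<Sum>y<2 ^ n. cnj (v x) * \<rho> $$ (x, y) * v y)"
    using p[of "vec (2 ^ n) v"] by simp
qed

lemma noisy_state_carrier:
  assumes "density_op n \<rho>\<^sub>0"
  shows "noisy_state n lam U \<rho>\<^sub>0 l \<in> carrier_mat (2 ^ n) (2 ^ n)"
  using assms by (cases l) (auto simp: density_op_def channel_power_def)

lemma noisy_state_Suc_entries:
  assumes "noisy_state n lam U \<rho>\<^sub>0 l \<in> carrier_mat (2 ^ n) (2 ^ n)" "unitary_op n (U (Suc l))"
    and "x < 2 ^ n" "y < 2 ^ n"
  shows "noisy_state n lam U \<rho>\<^sub>0 (Suc l) $$ (x, y) =
    noise n (1 - lam) (conj_op (2 ^ n) (entries (U (Suc l))) (entries (noisy_state n lam U \<rho>\<^sub>0 l))) x y"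
proof -
  have "noise n (1 - lam) (entries (U (Suc l) * noisy_state n lam U \<rho>\<^sub>0 l * mat_adjoint (U (Suc l)))) =
    noise n (1 - lam) (conj_op (2 ^ n) (entries (U (Suc l))) (entries (noisy_state n lam U \<rho>\<^sub>0 l)))"
    using assms by (intro noise_cong conj_op_entries) (auto simp: unitary_op_def)
  then show ?thesis using assms(3,4) by (simp add: channel_power_depolarize)
qed

text \<open>Unitaries leave Q = 2^n tr rho^2 unchanged, and a noise layer replaces it by at most its
  power with exponent \<theta> = 1 - 1 / 2^(k+1). The base 4^n is the crude initial bound 2^n times
  2^n.\<close>

lemma noisy_state_bound:
  assumes lam: "0 \<le> lam" "lam \<le> 1" and k: "(1 - lam) ^ (2 ^ k) \<le> 1/32"
    and \<rho>: "density_op n \<rho>\<^sub>0" and U: "\<forall>k\<ge>1. unitary_op n (U k)"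
  defines "f \<equiv> \<lambda>l. entries (noisy_state n lam U \<rho>\<^sub>0 l)"
  shows "is_state (2 ^ n) (f l) \<and> 2 ^ n * hs_sq (2 ^ n) (f l) \<le> (4 ^ n) powr ((1 - 1 / 2 ^ Suc k) ^ l)"
proof (induction l)
  case 0
  have s: "is_state (2 ^ n) (f 0)" unfolding f_def by (simp add: density_op_is_state[OF \<rho>])
  have "2 ^ n * hs_sq (2 ^ n) (f 0) \<le> 2 ^ n * 2 ^ n"
    using is_state_hs_sq_le[OF s] by simp
  also have "\<dots> = (4::real) ^ n" by (simp flip: power_mult_distrib)
  finally show ?case using s by simp
next
  case (Suc l)
  let ?g = "conj_op (2 ^ n) (entries (U (Suc l))) (f l)"
  have Uc: "(\<Sum>x<2 ^ n. cnj (U (Suc l) $$ (x, a)) * U (Suc l) $$ (x, b)) = of_bool (a = b)"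
    if "a < 2 ^ n" "b < 2 ^ n" for a b
    using U that by (intro unitary_op_columns) auto
  have s: "is_state (2 ^ n) (f l)" using Suc by blast
  have g: "is_state (2 ^ n) ?g" "hs_sq (2 ^ n) ?g = hs_sq (2 ^ n) (f l)"
    by (rule conj_op_unitary[OF Uc s]; assumption)+
  have f: "f (Suc l) x y = noise n (1 - lam) ?g x y" if "x < 2 ^ n" "y < 2 ^ n" for x y
    unfolding f_def using U that by (intro noisy_state_Suc_entries noisy_state_carrier \<rho>) auto
  have s': "is_state (2 ^ n) (f (Suc l))"
    using is_state_cong[of "2 ^ n" "f (Suc l)" "noise n (1 - lam) ?g"] f is_state_noise[OF g(1), of "1 - lam"] lam by simp
  let ?\<theta> = "1 - 1 / 2 ^ Suc k :: real"
  have \<theta>: "0 \<le> ?\<theta>" using one_le_power[of "2::real" "Suc k"] by (simp add: field_simps)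
  have "2 ^ n * hs_sq (2 ^ n) (f (Suc l)) = 2 ^ n * hs_sq (2 ^ n) (noise n (1 - lam) ?g)"
    using hs_sq_cong[of "2 ^ n" "f (Suc l)" "noise n (1 - lam) ?g"] f by simp
  also have "\<dots> \<le> (2 ^ n * hs_sq (2 ^ n) ?g) powr ?\<theta>"
    using lam k by (intro noise_contraction g(1)) auto
  also have "\<dots> \<le> ((4 ^ n) powr (?\<theta> ^ l)) powr ?\<theta>"
    unfolding g(2) using Suc \<theta> by (intro powr_mono2) (auto simp: hs_sq_nonneg)
  also have "\<dots> = (4 ^ n) powr (?\<theta> ^ Suc l)" unfolding powr_powr by (simp add: mult.commute)
  finally show ?case using s' by blast
qed

section \<open>Singular value decomposition\<close>

text \<open>The index set is arbitrary, so that pairs of indices can serve as coordinates and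
  families of operators become families of vectors.\<close>

definition orthonormal :: "'a set \<Rightarrow> nat \<Rightarrow> (nat \<Rightarrow> 'a \<Rightarrow> complex) \<Rightarrow> bool" where
  "orthonormal I m b \<longleftrightarrow>
     (\<forall>\<alpha><m. \<forall>\<beta><m. (\<Sum>i\<in>I. cnj (b \<alpha> i) * b \<beta> i) = of_bool (\<alpha> = \<beta>))"

lemma orthonormalD:
  "orthonormal I m b \<Longrightarrow> \<alpha> < m \<Longrightarrow> \<beta> < m \<Longrightarrow> (\<Sum>i\<in>I. cnj (b \<alpha> i) * b \<beta> i) = of_bool (\<alpha> = \<beta>)"
  by (simp add: orthonormal_def)

lemma sum_of_bool_mult:
  fixes f :: "nat \<Rightarrow> complex"
  assumes "\<alpha> < m"
  shows "(\<Sum>\<beta><m. f \<beta> * of_bool (\<alpha> = \<beta>)) = f \<alpha>" "(\<Sum>\<beta><m. of_bool (\<alpha> = \<beta>) * f \<beta>) = f \<alpha>"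
    "(\<Sum>\<beta><m. f \<beta> * of_bool (\<beta> = \<alpha>)) = f \<alpha>"
proof -
  have "f \<beta> * of_bool (\<alpha> = \<beta>) = (if \<alpha> = \<beta> then f \<beta> else 0)" "of_bool (\<alpha> = \<beta>) * f \<beta> = (if \<alpha> = \<beta> then f \<beta> else 0)"
    "f \<beta> * of_bool (\<beta> = \<alpha>) = (if \<alpha> = \<beta> then f \<beta> else 0)" for \<beta>
    by auto
  then show "(\<Sum>\<beta><m. f \<beta> * of_bool (\<alpha> = \<beta>)) = f \<alpha>" "(\<Sum>\<beta><m. of_bool (\<alpha> = \<beta>) * f \<beta>) = f \<alpha>"
    "(\<Sum>\<beta><m. f \<beta> * of_bool (\<beta> = \<alpha>)) = f \<alpha>"
    using assms by simp_all
qed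

lemma orthonormal_coeff:
  assumes "orthonormal I m b" "\<alpha> < m"
  shows "(\<Sum>i\<in>I. cnj (b \<alpha> i) * (\<Sum>\<beta><m. c \<beta> * b \<beta> i)) = c \<alpha>"
proof -
  have "(\<Sum>i\<in>I. cnj (b \<alpha> i) * (\<Sum>\<beta><m. c \<beta> * b \<beta> i)) = (\<Sum>\<beta><m. c \<beta> * (\<Sum>i\<in>I. cnj (b \<alpha> i) * b \<beta> i))"
    unfolding sum_distrib_left by (subst sum.swap) (simp add: mult_ac)
  also have "\<dots> = (\<Sum>\<beta><m. c \<beta> * of_bool (\<alpha> = \<beta>))"
    using assms by (intro sum.cong refl) (simp add: orthonormalD)
  finally show ?thesis using assms by (simp only: sum_of_bool_mult)
qed

text \<open>The residual of \<open>g\<close> after projection is orthogonal to the family, and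
  Pythagoras gives its norm.\<close>

lemma orthonormal_residual:
  assumes "orthonormal I m b"
  defines "c \<equiv> \<lambda>g \<alpha>. \<Sum>i\<in>I. cnj (b \<alpha> i) * g i"
  shows "(\<Sum>i\<in>I. (cmod (g i - (\<Sum>\<alpha><m. c g \<alpha> * b \<alpha> i)))\<^sup>2) = (\<Sum>i\<in>I. (cmod (g i))\<^sup>2) - (\<Sum>\<alpha><m. (cmod (c g \<alpha>))\<^sup>2)"
    and "\<alpha> < m \<Longrightarrow> (\<Sum>i\<in>I. cnj (b \<alpha> i) * (g i - (\<Sum>\<beta><m. c g \<beta> * b \<beta> i))) = 0"
proof -
  define s where "s i = (\<Sum>\<alpha><m. c g \<alpha> * b \<alpha> i)" for i
  have orth: "(\<Sum>i\<in>I. cnj (b \<alpha> i) * (g i - s i)) = 0" if "\<alpha> < m" for \<alpha>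
    using orthonormal_coeff[OF assms(1) that, of "c g"]
    by (simp add: right_diff_distrib sum_subtractf s_def c_def)
  then show "\<alpha> < m \<Longrightarrow> (\<Sum>i\<in>I. cnj (b \<alpha> i) * (g i - (\<Sum>\<beta><m. c g \<beta> * b \<beta> i))) = 0"
    by (simp add: s_def)
  have "(\<Sum>i\<in>I. cnj (s i) * (g i - s i)) = (\<Sum>\<alpha><m. cnj (c g \<alpha>) * (\<Sum>i\<in>I. cnj (b \<alpha> i) * (g i - s i)))"
    unfolding s_def[of i for i] cnj_sum sum_distrib_left sum_distrib_right
    unfolding s_def[symmetric] by (subst sum.swap) (simp add: mult_ac)
  also have "\<dots> = 0" by (simp add: orth)
  finally have s0: "(\<Sum>i\<in>I. cnj (s i) * (g i - s i)) = 0" .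
  have gs: "(\<Sum>i\<in>I. cnj (g i) * s i) = (\<Sum>\<alpha><m. of_real ((cmod (c g \<alpha>))\<^sup>2))"
  proof -
    have "(\<Sum>i\<in>I. cnj (g i) * s i) = (\<Sum>\<alpha><m. c g \<alpha> * (\<Sum>i\<in>I. cnj (g i) * b \<alpha> i))"
      unfolding s_def sum_distrib_left by (subst sum.swap) (simp add: mult_ac)
    also have "\<dots> = (\<Sum>\<alpha><m. c g \<alpha> * cnj (c g \<alpha>))"
      by (simp add: c_def mult.commute)
    finally show ?thesis by (simp only: complex_norm_square)
  qed
  have "complex_of_real (\<Sum>i\<in>I. (cmod (g i - s i))\<^sup>2) = (\<Sum>i\<in>I. cnj (g i - s i) * (g i - s i))"
    by (simp only: of_real_sum complex_norm_square mult.commute)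
  also have "\<dots> = (\<Sum>i\<in>I. cnj (g i) * (g i - s i)) - (\<Sum>i\<in>I. cnj (s i) * (g i - s i))"
    by (simp add: left_diff_distrib sum_subtractf)
  also have "\<dots> = (\<Sum>i\<in>I. g i * cnj (g i)) - (\<Sum>i\<in>I. cnj (g i) * s i)"
    unfolding s0 by (simp add: right_diff_distrib sum_subtractf mult.commute)
  also have "\<dots> = complex_of_real ((\<Sum>i\<in>I. (cmod (g i))\<^sup>2) - (\<Sum>\<alpha><m. (cmod (c g \<alpha>))\<^sup>2))"
    unfolding gs by (simp only: of_real_sum of_real_diff complex_norm_square)
  finally show "(\<Sum>i\<in>I. (cmod (g i - (\<Sum>\<alpha><m. c g \<alpha> * b \<alpha> i)))\<^sup>2) = (\<Sum>i\<in>I. (cmod (g i))\<^sup>2) - (\<Sum>\<alpha><m. (cmod (c g \<alpha>))\<^sup>2)"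
    unfolding of_real_eq_iff s_def .
qed

lemma bessel:
  assumes "orthonormal I m b"
  shows "(\<Sum>\<alpha><m. (cmod (\<Sum>i\<in>I. cnj (b \<alpha> i) * g i))\<^sup>2) \<le> (\<Sum>i\<in>I. (cmod (g i))\<^sup>2)"
proof -
  have "0 \<le> (\<Sum>i\<in>I. (cmod (g i - (\<Sum>\<alpha><m. (\<Sum>i\<in>I. cnj (b \<alpha> i) * g i) * b \<alpha> i)))\<^sup>2)" by (simp add: sum_nonneg)
  then show ?thesis unfolding orthonormal_residual(1)[OF assms] by simp
qed

lemma orthonormal_norm:
  assumes "orthonormal I m b" "\<alpha> < m"
  shows "(\<Sum>i\<in>I. (cmod (b \<alpha> i))\<^sup>2) = 1"
proof -
  have "complex_of_real (\<Sum>i\<in>I. (cmod (b \<alpha> i))\<^sup>2) = 1"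
    using orthonormalD[OF assms assms(2)] by (simp only: of_real_sum complex_norm_square mult.commute) simp
  then show ?thesis by (simp only: of_real_eq_1_iff)
qed

lemma unit_vector_sums:
  assumes "finite I" "j \<in> I"
  shows "(\<Sum>i\<in>I. f i * of_bool (i = j)) = (f j :: complex)"
    and "(\<Sum>i\<in>I. (cmod (of_bool (i = j)))\<^sup>2) = 1"
proof -
  have "f i * of_bool (i = j) = (if i = j then f i else 0)" "(cmod (of_bool (i = j)))\<^sup>2 = (if i = j then 1 else 0)" for i
    by auto
  then show "(\<Sum>i\<in>I. f i * of_bool (i = j)) = f j" "(\<Sum>i\<in>I. (cmod (of_bool (i = j)))\<^sup>2) = 1"
    using assms by simp_all
qed

lemma bessel_unit:
  assumes "finite I" "orthonormal I m b" "j \<in> I"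
  shows "(\<Sum>\<alpha><m. (cmod (b \<alpha> j))\<^sup>2) \<le> 1"
  using bessel[OF assms(2), of "\<lambda>i. of_bool (i = j)"] assms by (simp add: unit_vector_sums)

lemma orthonormal_sum_norms:
  assumes "orthonormal I m b"
  shows "(\<Sum>i\<in>I. \<Sum>\<alpha><m. (cmod (b \<alpha> i))\<^sup>2) = real m"
  using assms by (subst sum.swap) (simp add: orthonormal_norm)

text \<open>Count the total squared norm in two ways: each vector contributes 1, and each coordinate
  at most 1 by Bessel.\<close>

lemma orthonormal_le_card:
  assumes "finite I" "orthonormal I m b"
  shows "m \<le> card I"
proof -
  have "real m = (\<Sum>i\<in>I. \<Sum>\<alpha><m. (cmod (b \<alpha> i))\<^sup>2)" using orthonormal_sum_norms[OF assms(2)] by simp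
  also have "\<dots> \<le> (\<Sum>i\<in>I. 1)" by (intro sum_mono bessel_unit[OF assms])
  finally show ?thesis by simp
qed

section \<open>Extending orthonormal families to bases\<close>

lemma orthonormal_extend:
  assumes b: "orthonormal I m b"
    and y: "\<And>\<alpha>. \<alpha> < m \<Longrightarrow> (\<Sum>i\<in>I. cnj (b \<alpha> i) * y i) = 0"
    and n: "(\<Sum>i\<in>I. (cmod (y i))\<^sup>2) = N" "N > 0"
  shows "orthonormal I (Suc m) (b(m := (\<lambda>i. y i / complex_of_real (sqrt N))))"
proof -
  let ?w = "\<lambda>i. y i / complex_of_real (sqrt N)"
  have bw: "(\<Sum>i\<in>I. cnj (b \<alpha> i) * ?w i) = 0" if "\<alpha> < m" for \<alpha>
    using y[OF that] by (simp flip: sum_divide_distrib)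
  have wb: "(\<Sum>i\<in>I. cnj (?w i) * b \<alpha> i) = 0" if "\<alpha> < m" for \<alpha>
  proof -
    have "(\<Sum>i\<in>I. cnj (?w i) * b \<alpha> i) = cnj (\<Sum>i\<in>I. cnj (b \<alpha> i) * ?w i)" by (simp add: mult.commute)
    then show ?thesis unfolding bw[OF that] by simp
  qed
  have ww: "(\<Sum>i\<in>I. cnj (?w i) * ?w i) = 1"
  proof -
    have "(\<Sum>i\<in>I. cnj (?w i) * ?w i) = complex_of_real (\<Sum>i\<in>I. (cmod (?w i))\<^sup>2)"
      by (simp only: of_real_sum complex_norm_square mult.commute)
    also have "(\<Sum>i\<in>I. (cmod (?w i))\<^sup>2) = 1"
      using n by (simp add: norm_divide power_divide flip: sum_divide_distrib)
    finally show ?thesis by simp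
  qed
  show ?thesis
    unfolding orthonormal_def
  proof (intro allI impI)
    fix \<alpha> \<beta> assume "\<alpha> < Suc m" "\<beta> < Suc m"
    then consider "\<alpha> < m" "\<beta> < m" | "\<alpha> = m" "\<beta> < m" | "\<alpha> < m" "\<beta> = m" | "\<alpha> = m" "\<beta> = m" by linarith
    then show "(\<Sum>i\<in>I. cnj ((b(m := ?w)) \<alpha> i) * (b(m := ?w)) \<beta> i) = of_bool (\<alpha> = \<beta>)"
    proof cases
      case 1 then show ?thesis using orthonormalD[OF b] by simp
    next
      case 2 then show ?thesis using wb[of \<beta>] by simp
    next
      case 3 then show ?thesis using bw[of \<alpha>] by simp
    next
      case 4 then show ?thesis using ww by simp
    qed
  qed
qed

text \<open>By the same count, m < card I leaves some coordinate with weight below 1. The coordinate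
  vector there is not in the span, and its normalized residual extends the family.\<close>

lemma orthonormal_extend_one:
  assumes I: "finite I" and b: "orthonormal I m b" and m: "m < card I"
  shows "\<exists>w. orthonormal I (Suc m) (b(m := w))"
proof -
  have "\<exists>j\<in>I. (\<Sum>\<alpha><m. (cmod (b \<alpha> j))\<^sup>2) < 1"
  proof (rule ccontr)
    assume "\<not> ?thesis"
    then have "(\<Sum>i\<in>I. 1) \<le> (\<Sum>i\<in>I. \<Sum>\<alpha><m. (cmod (b \<alpha> i))\<^sup>2)" by (intro sum_mono) (auto simp: not_less)
    then show False using m by (simp add: orthonormal_sum_norms[OF b])
  qed
  then obtain j where j: "j \<in> I" "(\<Sum>\<alpha><m. (cmod (b \<alpha> j))\<^sup>2) < 1" by blast
  have c: "(\<Sum>i\<in>I. cnj (b \<alpha> i) * of_bool (i = j)) = cnj (b \<alpha> j)" for \<alpha>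
    using I j by (simp add: unit_vector_sums)
  note r = orthonormal_residual[OF b, where g = "\<lambda>i. of_bool (i = j)", unfolded c unit_vector_sums(2)[OF I j(1)]]
  show ?thesis
    using orthonormal_extend[OF b r(2) r(1)] j(2) by auto
qed

lemma orthonormal_extend_basis:
  assumes I: "finite I" and b: "orthonormal I m b"
  shows "\<exists>b'. orthonormal I (card I) b' \<and> (\<forall>\<alpha><m. b' \<alpha> = b \<alpha>)"
  using orthonormal_le_card[OF assms] b
proof (induction m arbitrary: b rule: inc_induct)
  case base
  then show ?case by blast
next
  case (step m)
  obtain w where "orthonormal I (Suc m) (b(m := w))" using orthonormal_extend_one[OF I step.prems step.hyps(2)] by blast
  from step.IH[OF this] obtain b' where "orthonormal I (card I) b'" "\<forall>\<alpha><Suc m. b' \<alpha> = (b(m := w)) \<alpha>" by blast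
  then show ?case by (intro exI[of _ b']) auto
qed

text \<open>In a family of full size the count is tight, so every coordinate has weight exactly 1
  and every coordinate vector has zero residual.\<close>

lemma orthonormal_complete:
  assumes I: "finite I" and b: "orthonormal I (card I) b" and ij: "i \<in> I" "j \<in> I"
  shows "(\<Sum>\<alpha><card I. b \<alpha> i * cnj (b \<alpha> j)) = of_bool (i = j)"
proof -
  have c: "(\<Sum>i\<in>I. cnj (b \<alpha> i) * of_bool (i = j)) = cnj (b \<alpha> j)" if "j \<in> I" for \<alpha> j
    using I that by (simp add: unit_vector_sums)
  have one: "(\<Sum>\<alpha><card I. (cmod (b \<alpha> j))\<^sup>2) = 1"
  proof (rule ccontr)
    assume "\<not> ?thesis"
    then have "(\<Sum>\<alpha><card I. (cmod (b \<alpha> j))\<^sup>2) < 1" using bessel_unit[OF I b ij(2)] by simp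
    then have "(\<Sum>i\<in>I. \<Sum>\<alpha><card I. (cmod (b \<alpha> i))\<^sup>2) < (\<Sum>i\<in>I. 1)"
      using bessel_unit[OF I b] ij I by (intro sum_strict_mono_ex1) auto
    then show False by (simp add: orthonormal_sum_norms[OF b])
  qed
  have "(\<Sum>i\<in>I. (cmod (of_bool (i = j) - (\<Sum>\<alpha><card I. cnj (b \<alpha> j) * b \<alpha> i)))\<^sup>2) = 0"
    using orthonormal_residual(1)[OF b, of "\<lambda>i. of_bool (i = j)", unfolded c[OF ij(2)] unit_vector_sums(2)[OF I ij(2)]]
    by (simp add: one)
  then have "(cmod (of_bool (i = j) - (\<Sum>\<alpha><card I. cnj (b \<alpha> j) * b \<alpha> i)))\<^sup>2 = 0"
    using I ij by (subst (asm) sum_nonneg_eq_0_iff) auto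
  then show ?thesis by (simp add: mult.commute)
qed

lemma orthonormal_expand:
  assumes I: "finite I" and b: "orthonormal I (card I) b" and i: "i \<in> I"
  shows "g i = (\<Sum>\<alpha><card I. b \<alpha> i * (\<Sum>j\<in>I. cnj (b \<alpha> j) * g j))"
proof -
  have "(\<Sum>\<alpha><card I. b \<alpha> i * (\<Sum>j\<in>I. cnj (b \<alpha> j) * g j)) = (\<Sum>j\<in>I. (\<Sum>\<alpha><card I. b \<alpha> i * cnj (b \<alpha> j)) * g j)"
    unfolding sum_distrib_left sum_distrib_right by (subst sum.swap) (simp add: mult.assoc)
  also have "\<dots> = (\<Sum>j\<in>I. g j * of_bool (j = i))"
    using orthonormal_complete[OF I b i] by (intro sum.cong refl) (auto simp: mult.commute)
  finally show ?thesis using unit_vector_sums(1)[OF I i] by simp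
qed

text \<open>Eigenvectors are found one at a time. Complete those already found to a basis, compress
  H to their orthogonal complement and take a complex eigenvector there. Since H is hermitian, the
  complement is invariant, so this is an eigenvector of H itself.\<close>

lemma hermitian_eigenbasis:
  assumes I: "finite I" and H: "\<And>i j. i \<in> I \<Longrightarrow> j \<in> I \<Longrightarrow> H j i = cnj (H i j)"
    and "m \<le> card I"
  shows "\<exists>b e. orthonormal I m b \<and> (\<forall>\<alpha><m. \<forall>i\<in>I. (\<Sum>j\<in>I. H i j * b \<alpha> j) = e \<alpha> * b \<alpha> i)"
  using assms(3)
proof (induction m)
  case 0
  then show ?case by (simp add: orthonormal_def)
next
  case (Suc m)
  then obtain b e where b: "orthonormal I m b"
    and e: "\<And>\<alpha> i. \<alpha> < m \<Longrightarrow> i \<in> I \<Longrightarrow> (\<Sum>j\<in>I. H i j * b \<alpha> j) = e \<alpha> * b \<alpha> i" by auto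
  obtain b' where b': "orthonormal I (card I) b'" "\<And>\<alpha>. \<alpha> < m \<Longrightarrow> b' \<alpha> = b \<alpha>"
    using orthonormal_extend_basis[OF I b] by blast
  define k where "k = card I - m"
  have k: "0 < k" "m + k = card I" using Suc.prems by (auto simp: k_def)
  define Hv where "Hv y i = (\<Sum>j\<in>I. H i j * y j)" for y i
  \<comment> \<open>the compression of \<open>H\<close> to the orthogonal complement of the eigenvectors found so far\<close>
  define A where "A = mat k k (\<lambda>(s, t). \<Sum>i\<in>I. cnj (b' (m + s) i) * Hv (b' (m + t)) i)"
  have A: "A \<in> carrier_mat k k" by (simp add: A_def)
  obtain a where "eigenvalue A a" using spectrum_non_empty[OF A k(1)] unfolding spectrum_def by auto
  then obtain z where z: "z \<in> carrier_vec k" "z \<noteq> 0\<^sub>v k" "A *\<^sub>v z = a \<cdot>\<^sub>v z"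
    using A unfolding eigenvalue_def eigenvector_def by auto
  define y where "y i = (\<Sum>t<k. z $ t * b' (m + t) i)" for i
  have Hy: "Hv y i = (\<Sum>t<k. z $ t * Hv (b' (m + t)) i)" for i
    unfolding Hv_def y_def sum_distrib_left by (subst sum.swap) (simp add: mult_ac)
  have by0: "(\<Sum>i\<in>I. cnj (b' \<alpha> i) * y i) = (if \<alpha> < m then 0 else z $ (\<alpha> - m))" if "\<alpha> < card I" for \<alpha>
  proof -
    have "(\<Sum>i\<in>I. cnj (b' \<alpha> i) * y i) = (\<Sum>t<k. z $ t * (\<Sum>i\<in>I. cnj (b' \<alpha> i) * b' (m + t) i))"
      unfolding y_def sum_distrib_left by (subst sum.swap) (simp add: mult_ac)
    also have "\<dots> = (\<Sum>t<k. z $ t * of_bool (\<alpha> = m + t))"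
      using that k by (intro sum.cong refl) (simp add: orthonormalD[OF b'(1)])
    also have "\<dots> = (if \<alpha> < m then 0 else z $ (\<alpha> - m))"
    proof (cases "\<alpha> < m")
      case False
      then have "z $ t * of_bool (\<alpha> = m + t) = z $ t * of_bool (\<alpha> - m = t)" for t by auto
      then show ?thesis using False that k by (simp only: sum_of_bool_mult) simp
    qed simp
    finally show ?thesis .
  qed
  \<comment> \<open>Compares the coordinates of H y and a y in the full basis. Along the earlier
    eigenvectors both vanish by hermiticity; along the complement this is the eigenvalue equation of
    the compression.\<close>
  have bHy: "(\<Sum>i\<in>I. cnj (b' \<alpha> i) * Hv y i) = a * (\<Sum>i\<in>I. cnj (b' \<alpha> i) * y i)" if \<alpha>: "\<alpha> < card I" for \<alpha>
  proof (cases "\<alpha> < m")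
    case True
    have "(\<Sum>i\<in>I. cnj (b' \<alpha> i) * Hv y i) = (\<Sum>j\<in>I. cnj (Hv (b' \<alpha>) j) * y j)"
      unfolding Hv_def cnj_sum sum_distrib_left sum_distrib_right
      by (subst sum.swap) (intro sum.cong refl, simp add: H[symmetric])
    also have "\<dots> = (\<Sum>j\<in>I. cnj (e \<alpha>) * (cnj (b' \<alpha> j) * y j))"
      using e[OF True] b'(2)[OF True] by (intro sum.cong refl) (simp add: Hv_def)
    also have "\<dots> = 0" using by0[OF \<alpha>] True by (simp flip: sum_distrib_left)
    finally show ?thesis using by0[OF \<alpha>] True by simp
  next
    case False
    define s where "s = \<alpha> - m"
    have s: "s < k" "\<alpha> = m + s" using False \<alpha> k by (auto simp: s_def)
    have "(\<Sum>i\<in>I. cnj (b' \<alpha> i) * Hv y i) = (\<Sum>t<k. (\<Sum>i\<in>I. cnj (b' (m + s) i) * Hv (b' (m + t)) i) * z $ t)"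
      unfolding Hy s(2) sum_distrib_left sum_distrib_right by (subst sum.swap) (simp add: mult_ac)
    also have "\<dots> = (A *\<^sub>v z) $ s"
      using s z(1) by (simp add: A_def scalar_prod_def lessThan_atLeast0)
    also have "\<dots> = a * z $ s" using s z by simp
    finally show ?thesis using by0[OF \<alpha>] False by (simp add: s_def)
  qed
  have ev: "Hv y i = a * y i" if i: "i \<in> I" for i
  proof -
    have "Hv y i = (\<Sum>\<alpha><card I. b' \<alpha> i * (a * (\<Sum>i\<in>I. cnj (b' \<alpha> i) * y i)))"
      by (subst orthonormal_expand[OF I b'(1) i]) (simp add: bHy)
    also have "\<dots> = a * y i"
      by (subst (2) orthonormal_expand[OF I b'(1) i]) (simp add: sum_distrib_left mult_ac)
    finally show ?thesis .
  qed
  have yb: "(\<Sum>i\<in>I. cnj (b \<alpha> i) * y i) = 0" if "\<alpha> < m" for \<alpha>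
    using by0[of \<alpha>] b'(2)[OF that] that k by simp
  obtain t where t: "t < k" "z $ t \<noteq> 0"
    using z(1,2) by (metis carrier_vecD eq_vecI index_zero_vec)
  \<comment> \<open>\<open>y\<close> is nonzero since one of its coordinates in the basis is a
    nonzero entry of \<open>z\<close>; Bessel turns this into a positive norm.\<close>
  have "(\<Sum>i\<in>I. (cmod (y i))\<^sup>2) > 0"
  proof -
    have "0 < (cmod (\<Sum>i\<in>I. cnj (b' (m + t) i) * y i))\<^sup>2" using by0[of "m + t"] t k by simp
    also have "\<dots> \<le> (\<Sum>\<alpha><card I. (cmod (\<Sum>i\<in>I. cnj (b' \<alpha> i) * y i))\<^sup>2)"
      using t k by (intro member_le_sum[of "m + t" "{..<card I}"
        "\<lambda>\<alpha>. (cmod (\<Sum>i\<in>I. cnj (b' \<alpha> i) * y i))\<^sup>2"]) auto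
    also have "\<dots> \<le> (\<Sum>i\<in>I. (cmod (y i))\<^sup>2)" by (rule bessel[OF b'(1)])
    finally show ?thesis .
  qed
  from orthonormal_extend[OF b yb refl this]
  obtain N where N: "orthonormal I (Suc m) (b(m := (\<lambda>i. y i / complex_of_real N)))" by blast
  have "(\<Sum>j\<in>I. H i j * (b(m := (\<lambda>i. y i / complex_of_real N))) \<alpha> j)
      = (e(m := a)) \<alpha> * (b(m := (\<lambda>i. y i / complex_of_real N))) \<alpha> i" if "\<alpha> < Suc m" "i \<in> I" for \<alpha> i
  proof (cases "\<alpha> = m")
    case True
    then show ?thesis using ev[OF that(2)] by (simp add: Hv_def flip: sum_divide_distrib)
  next
    case False
    then show ?thesis using e[of \<alpha> i] that by simp
  qed
  then show ?case using N by blast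
qed

text \<open>Take an orthonormal eigenbasis b of M^dag M. The images M b_k are mutually orthogonal;
  the nonzero ones, normalized, are the left vectors and their norms the coefficients. The right
  vectors are conjugates of the b_k because the decomposition is bilinear in \<open>u\<close> and
  \<open>v\<close>.\<close>

lemma singular_value_decomposition:
  assumes I: "finite I" and J: "finite J"
  shows "\<exists>r c u v. (\<forall>k<r. 0 < c k) \<and> orthonormal I r u \<and> orthonormal J r v
    \<and> (\<forall>i\<in>I. \<forall>j\<in>J. M i j = (\<Sum>k<r. complex_of_real (c k) * u k i * v k j))"
proof -
  define H where "H j j' = (\<Sum>i\<in>I. cnj (M i j) * M i j')" for j j'
  have herm: "H j i = cnj (H i j)" for i j by (simp add: H_def mult.commute)
  have "\<exists>b e. orthonormal J (card J) b \<and> (\<forall>\<alpha><card J. \<forall>i\<in>J. (\<Sum>j\<in>J. H i j * b \<alpha> j) = e \<alpha> * b \<alpha> i)"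
    by (rule hermitian_eigenbasis[OF J herm order.refl])
  then
  obtain b e where be: "orthonormal J (card J) b \<and> (\<forall>\<alpha><card J. \<forall>i\<in>J. (\<Sum>j\<in>J. H i j * b \<alpha> j) = e \<alpha> * b \<alpha> i)"
    by (elim exE)
  have b: "orthonormal J (card J) b" using be by (rule conjunct1)
  have e: "(\<Sum>j\<in>J. H i j * b \<alpha> j) = e \<alpha> * b \<alpha> i" if "\<alpha> < card J" "i \<in> J" for \<alpha> i
    using be that by simp
  define p where "p = card J"
  define w where "w k i = (\<Sum>j\<in>J. M i j * b k j)" for k i
  define N where "N k = (\<Sum>i\<in>I. (cmod (w k i))\<^sup>2)" for k
  have ww: "(\<Sum>i\<in>I. cnj (w k i) * w l i) = e l * of_bool (k = l)" if "k < p" "l < p" for k l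
  proof -
    have "(\<Sum>i\<in>I. cnj (w k i) * w l i) = (\<Sum>i\<in>I. \<Sum>j\<in>J. \<Sum>j'\<in>J. cnj (b k j) * (cnj (M i j) * M i j' * b l j'))"
      unfolding w_def cnj_sum sum_product by (simp add: mult_ac)
    also have "\<dots> = (\<Sum>j\<in>J. \<Sum>j'\<in>J. \<Sum>i\<in>I. cnj (b k j) * (cnj (M i j) * M i j' * b l j'))"
      by (subst sum.swap, subst (2) sum.swap) (rule refl)
    also have "\<dots> = (\<Sum>j\<in>J. cnj (b k j) * (\<Sum>j'\<in>J. H j j' * b l j'))"
      by (simp add: H_def sum_distrib_left sum_distrib_right)
    also have "\<dots> = e l * (\<Sum>j\<in>J. cnj (b k j) * b l j)"
      using e[of l] that by (simp add: p_def sum_distrib_left mult_ac)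
    also have "\<dots> = e l * of_bool (k = l)" using orthonormalD[OF b, of k l] that by (simp add: p_def)
    finally show ?thesis .
  qed
  have wN: "(\<Sum>i\<in>I. cnj (w k i) * w l i) = complex_of_real (N k) * of_bool (k = l)" if "k < p" "l < p" for k l
  proof (cases "k = l")
    case True
    then show ?thesis by (simp add: N_def complex_norm_square mult.commute del: of_real_power)
  next
    case False
    then show ?thesis using ww[OF that] by simp
  qed
  have N0: "0 \<le> N k" for k by (simp add: N_def sum_nonneg)
  have wz: "w k i = 0" if "N k = 0" "i \<in> I" for k i
  proof -
    have "(cmod (w k i))\<^sup>2 = 0" using that I unfolding N_def by (subst (asm) sum_nonneg_eq_0_iff) auto
    then show ?thesis by simp
  qed
  have M: "M i j = (\<Sum>k<p. w k i * cnj (b k j))" if "i \<in> I" "j \<in> J" for i j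
  proof -
    have "(\<Sum>k<p. w k i * cnj (b k j)) = (\<Sum>j'\<in>J. M i j' * (\<Sum>k<p. b k j' * cnj (b k j)))"
      unfolding w_def sum_distrib_left sum_distrib_right by (subst sum.swap) (simp add: mult.assoc)
    also have "\<dots> = (\<Sum>j'\<in>J. M i j' * of_bool (j' = j))"
      using orthonormal_complete[OF J b _ that(2)] by (simp add: p_def)
    finally show ?thesis using unit_vector_sums(1)[OF J that(2)] by simp
  qed
  \<comment> \<open>Only nonzero images may enter, as the coefficients must be positive;
    \<open>h\<close> renumbers them consecutively.\<close>
  define S where "S = {k. k < p \<and> N k \<noteq> 0}"
  define r where "r = card S"
  have S: "finite S" by (simp add: S_def)
  obtain h where h: "bij_betw h {..<r} S"
    using ex_bij_betw_nat_finite[OF S] unfolding r_def lessThan_atLeast0 by blast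
  have hS: "h k < p" "N (h k) \<noteq> 0" if "k < r" for k
    using bij_betwE[OF h] that unfolding S_def by auto
  have hi: "h k = h l \<longleftrightarrow> k = l" if "k < r" "l < r" for k l
    using bij_betw_imp_inj_on[OF h] that by (auto simp: inj_on_def)
  show ?thesis
  proof (intro exI[of _ r] exI[of _ "\<lambda>k. sqrt (N (h k))"] exI[of _ "\<lambda>k i. w (h k) i / sqrt (N (h k))"]
      exI[of _ "\<lambda>k j. cnj (b (h k) j)"] conjI allI impI ballI)
    show "0 < sqrt (N (h k))" if "k < r" for k using hS(2)[OF that] N0[of "h k"] by simp
    show "orthonormal I r (\<lambda>k i. w (h k) i / sqrt (N (h k)))"
      unfolding orthonormal_def
    proof (intro allI impI)
      fix k l assume kl: "k < r" "l < r"
      have "(\<Sum>i\<in>I. cnj (w (h k) i / sqrt (N (h k))) * (w (h l) i / sqrt (N (h l)))) =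
        (\<Sum>i\<in>I. cnj (w (h k) i) * w (h l) i) / (sqrt (N (h k)) * sqrt (N (h l)))"
        by (simp add: sum_divide_distrib)
      also have "\<dots> = of_bool (k = l)"
        unfolding wN[OF hS(1)[OF kl(1)] hS(1)[OF kl(2)]] using hi[OF kl] hS(2)[OF kl(1)] N0[of "h k"]
        by (auto simp flip: of_real_mult)
      finally show "(\<Sum>i\<in>I. cnj (w (h k) i / sqrt (N (h k))) * (w (h l) i / sqrt (N (h l)))) = of_bool (k = l)" .
    qed
    show "orthonormal J r (\<lambda>k j. cnj (b (h k) j))"
      unfolding orthonormal_def
    proof (intro allI impI)
      fix k l assume kl: "k < r" "l < r"
      have "(\<Sum>i\<in>J. cnj (cnj (b (h k) i)) * cnj (b (h l) i)) = (\<Sum>i\<in>J. cnj (b (h l) i) * b (h k) i)"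
        by (simp add: mult.commute)
      also have "\<dots> = of_bool (k = l)"
        using orthonormalD[OF b, of "h l" "h k"] hS(1)[OF kl(1)] hS(1)[OF kl(2)] hi[OF kl] by (auto simp: p_def)
      finally show "(\<Sum>i\<in>J. cnj (cnj (b (h k) i)) * cnj (b (h l) i)) = of_bool (k = l)" .
    qed
    fix i j assume ij: "i \<in> I" "j \<in> J"
    have "M i j = (\<Sum>k\<in>S. w k i * cnj (b k j))"
      unfolding M[OF ij] using wz[OF _ ij(1)] by (intro sum.mono_neutral_right) (auto simp: S_def)
    also have "\<dots> = (\<Sum>k<r. w (h k) i * cnj (b (h k) j))"
      using sum.reindex_bij_betw[OF h, of "\<lambda>k. w k i * cnj (b k j)"] by simp
    also have "\<dots> = (\<Sum>k<r. complex_of_real (sqrt (N (h k))) * (w (h k) i / sqrt (N (h k))) * cnj (b (h k) j))"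
      using hS(2) by (intro sum.cong refl) simp
    finally show "M i j = (\<Sum>k<r. complex_of_real (sqrt (N (h k))) * (w (h k) i / sqrt (N (h k))) * cnj (b (h k) j))" .
  qed
qed

section \<open>Operator Schmidt decompositions\<close>

lemma sub_index_less:
  assumes "finite S"
  shows "sub_index S x < 2 ^ card S"
  using horner_sum_of_bool_2_less[of "map (bit x) (sorted_list_of_set S)"] assms
  unfolding sub_index_def by (simp add: horner_sum_of_bool_2_less del: sum_list_simps)

lemma sub_index_eqD:
  assumes S: "finite S" and eq: "sub_index S x = sub_index S y" and i: "i \<in> S"
  shows "bit x i = bit y i"
proof -
  let ?l = "sorted_list_of_set S"
  obtain j where j: "j < length ?l" "?l ! j = i"
    using i S by (metis in_set_conv_nth set_sorted_list_of_set)
  have "bit (sub_index S x) j = bit x i" "bit (sub_index S y) j = bit y i"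
    unfolding sub_index_def bit_horner_sum_bit_iff using j by simp_all
  then show ?thesis using eq by simp
qed

lemma bipartitionD:
  assumes "bipartition n A B"
  shows "finite A" "finite B" "card A + card B = n"
proof -
  have u: "A \<union> B = {..<n}" "A \<inter> B = {}" using assms by (auto simp: bipartition_def)
  show fin: "finite A" "finite B" using u(1) by (metis finite_Un finite_lessThan)+
  show "card A + card B = n" using card_Un_disjoint[OF fin u(2)] u(1) by simp
qed

text \<open>Injective because A and B together determine every digit; surjective because both sides
  have \<open>2 ^ n\<close> elements.\<close>

lemma sub_index_bij:
  assumes "bipartition n A B"
  shows "bij_betw (\<lambda>x. (sub_index A x, sub_index B x)) {..<2 ^ n} ({..<2 ^ card A} \<times> {..<2 ^ card B})"
proof -
  note f = bipartitionD[OF assms]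
  have inj: "inj_on (\<lambda>x. (sub_index A x, sub_index B x)) {..<2 ^ n}"
  proof (rule inj_onI)
    fix x y assume xy: "x \<in> {..<2 ^ n}" "y \<in> {..<2 ^ n}"
      and eq: "(sub_index A x, sub_index B x) = (sub_index A y, sub_index B y)"
    have "bit x i = bit y i" if "i < n" for i
    proof -
      have "i \<in> A \<or> i \<in> B" using that assms by (auto simp: bipartition_def)
      then show ?thesis using eq sub_index_eqD f by auto
    qed
    then show "x = y"
      using xy by (intro qubit_eqI[of x n y]) (auto simp: qubit_def)
  qed
  have "(\<lambda>x. (sub_index A x, sub_index B x)) ` {..<2 ^ n} = {..<2 ^ card A} \<times> {..<2 ^ card B}"
  proof (rule card_subset_eq)
    show "(\<lambda>x. (sub_index A x, sub_index B x)) ` {..<2 ^ n} \<subseteq> {..<2 ^ card A} \<times> {..<2 ^ card B}"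
      using f by (auto simp: sub_index_less)
    show "card ((\<lambda>x. (sub_index A x, sub_index B x)) ` {..<2 ^ n}) = card ({..<2 ^ card A :: nat} \<times> {..<2 ^ card B :: nat})"
      using card_image[OF inj] f(3) by (simp add: card_cartesian_product flip: power_add)
  qed simp
  then show ?thesis using inj by (simp add: bij_betw_def)
qed

lemma sum_sub_index:
  fixes h :: "nat \<Rightarrow> nat \<Rightarrow> complex"
  assumes "bipartition n A B"
  shows "(\<Sum>x<2 ^ n. h (sub_index A x) (sub_index B x)) = (\<Sum>a<2 ^ card A. \<Sum>b<2 ^ card B. h a b)"
  using sum.reindex_bij_betw[OF sub_index_bij[OF assms], of "\<lambda>(a, b). h a b"]
  by (simp add: sum.cartesian_product)

lemma sum_sum_sub_index:
  fixes g :: "nat \<Rightarrow> nat \<Rightarrow> nat \<Rightarrow> nat \<Rightarrow> complex"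
  assumes "bipartition n A B"
  shows "(\<Sum>x<2 ^ n. \<Sum>y<2 ^ n. g (sub_index A x) (sub_index A y) (sub_index B x) (sub_index B y)) =
    (\<Sum>a<2 ^ card A. \<Sum>a'<2 ^ card A. \<Sum>b<2 ^ card B. \<Sum>b'<2 ^ card B. g a a' b b')"
proof -
  have "(\<Sum>x<2 ^ n. \<Sum>y<2 ^ n. g (sub_index A x) (sub_index A y) (sub_index B x) (sub_index B y)) =
    (\<Sum>x<2 ^ n. \<Sum>a'<2 ^ card A. \<Sum>b'<2 ^ card B. g (sub_index A x) a' (sub_index B x) b')"
  proof (rule sum.cong[OF refl])
    fix x
    show "(\<Sum>y<2 ^ n. g (sub_index A x) (sub_index A y) (sub_index B x) (sub_index B y)) =
        (\<Sum>a'<2 ^ card A. \<Sum>b'<2 ^ card B. g (sub_index A x) a' (sub_index B x) b')"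
      by (rule sum_sub_index[OF assms, of "\<lambda>a' b'. g (sub_index A x) a' (sub_index B x) b'"])
  qed
  also have "\<dots> = (\<Sum>a<2 ^ card A. \<Sum>b<2 ^ card B. \<Sum>a'<2 ^ card A. \<Sum>b'<2 ^ card B. g a a' b b')"
    by (rule sum_sub_index[OF assms, of "\<lambda>a b. \<Sum>a'<2 ^ card A. \<Sum>b'<2 ^ card B. g a a' b b'"])
  also have "\<dots> = (\<Sum>a<2 ^ card A. \<Sum>a'<2 ^ card A. \<Sum>b<2 ^ card B. \<Sum>b'<2 ^ card B. g a a' b b')"
    by (intro sum.cong refl sum.swap)
  finally show ?thesis .
qed

lemma hs_inner_entries:
  assumes "X \<in> carrier_mat d d" "Y \<in> carrier_mat d d"
  shows "hs_inner X Y = (\<Sum>p\<in>{..<d} \<times> {..<d}. cnj (X $$ p) * Y $$ p)"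
proof -
  have "hs_inner X Y = (\<Sum>i<d. (mat_adjoint X * Y) $$ (i, i))"
    using assms by (simp add: hs_inner_def mat_trace_def mat_adjoint_dim)
  also have "\<dots> = (\<Sum>i<d. \<Sum>k<d. cnj (X $$ (k, i)) * Y $$ (k, i))"
  proof (intro sum.cong refl)
    fix i assume "i \<in> {..<d}"
    then show "(mat_adjoint X * Y) $$ (i, i) = (\<Sum>k<d. cnj (X $$ (k, i)) * Y $$ (k, i))"
      using assms by (subst mult_mat_index_sum[OF mat_adjoint_carrier[OF assms(1)] assms(2)])
        (auto simp: mat_adjoint_index intro!: sum.cong)
  qed
  also have "\<dots> = (\<Sum>p\<in>{..<d} \<times> {..<d}. cnj (X $$ p) * Y $$ p)"
    by (subst sum.swap) (simp add: sum.cartesian_product case_prod_beta)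
  finally show ?thesis .
qed

lemma hs_orthonormal_iff:
  "hs_orthonormal d r X \<longleftrightarrow> (\<forall>\<alpha><r. X \<alpha> \<in> carrier_mat d d)
     \<and> orthonormal ({..<d} \<times> {..<d}) r (\<lambda>\<alpha> p. X \<alpha> $$ p)"
proof -
  have "(hs_inner (X \<alpha>) (X \<beta>) = (if \<alpha> = \<beta> then 1 else 0)) =
    ((\<Sum>p\<in>{..<d} \<times> {..<d}. cnj (X \<alpha> $$ p) * X \<beta> $$ p) = of_bool (\<alpha> = \<beta>))"
    if "X \<alpha> \<in> carrier_mat d d" "X \<beta> \<in> carrier_mat d d" for \<alpha> \<beta>
    by (simp only: hs_inner_entries[OF that] of_bool_def)
  then show ?thesis
    unfolding hs_orthonormal_def orthonormal_def
    by (intro conj_cong refl all_cong1 imp_cong) blast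
qed

text \<open>Singular value decomposition of the realigned matrix: its rows are pairs of A-indices
  and its columns pairs of B-indices, so its singular vectors are operators on A and on B.\<close>

lemma op_schmidt_exists:
  assumes AB: "bipartition n A B" and \<rho>: "\<rho> \<in> carrier_mat (2 ^ n) (2 ^ n)"
  shows "\<exists>cs L R. op_schmidt_decomp n A B \<rho> cs L R"
proof -
  define dA dB where "dA = (2::nat) ^ card A" and "dB = (2::nat) ^ card B"
  define idx where "idx = the_inv_into {..<2 ^ n} (\<lambda>x. (sub_index A x, sub_index B x))"
  have idx: "idx (sub_index A x, sub_index B x) = x" if "x < 2 ^ n" for x
    using the_inv_into_f_f[OF bij_betw_imp_inj_on[OF sub_index_bij[OF AB]], of x] that by (simp add: idx_def)
  define M where "M p q = \<rho> $$ (idx (fst p, fst q), idx (snd p, snd q))" for p q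
  obtain r c u v where svd: "\<forall>k<r. 0 < c k" "orthonormal ({..<dA} \<times> {..<dA}) r u" "orthonormal ({..<dB} \<times> {..<dB}) r v"
    "\<forall>p\<in>{..<dA} \<times> {..<dA}. \<forall>q\<in>{..<dB} \<times> {..<dB}. M p q = (\<Sum>k<r. complex_of_real (c k) * u k p * v k q)"
    using singular_value_decomposition[of "{..<dA} \<times> {..<dA}" "{..<dB} \<times> {..<dB}" M] by auto
  define L R where "L k = mat dA dA (u k)" and "R k = mat dB dB (v k)" for k
  have "op_schmidt_decomp n A B \<rho> (map c [0..<r]) L R"
    unfolding op_schmidt_decomp_def
  proof (intro conjI)
    show "\<forall>c\<in>set (map c [0..<r]). 0 < c" using svd(1) by auto
    have "orthonormal ({..<dA} \<times> {..<dA}) r (\<lambda>\<alpha> p. L \<alpha> $$ p) = orthonormal ({..<dA} \<times> {..<dA}) r u"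
      unfolding orthonormal_def by (intro all_cong1 imp_cong refl arg_cong2[of _ _ _ _ "(=)"] sum.cong) (auto simp: L_def)
    then show "hs_orthonormal (2 ^ card A) (length (map c [0..<r])) L"
      using svd(2) by (simp add: hs_orthonormal_iff L_def dA_def)
    have "orthonormal ({..<dB} \<times> {..<dB}) r (\<lambda>\<alpha> p. R \<alpha> $$ p) = orthonormal ({..<dB} \<times> {..<dB}) r v"
      unfolding orthonormal_def by (intro all_cong1 imp_cong refl arg_cong2[of _ _ _ _ "(=)"] sum.cong) (auto simp: R_def)
    then show "hs_orthonormal (2 ^ card B) (length (map c [0..<r])) R"
      using svd(3) by (simp add: hs_orthonormal_iff R_def dB_def)
    show "\<rho> = mat (2 ^ n) (2 ^ n) (\<lambda>(x, y). \<Sum>\<alpha><length (map c [0..<r]).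
        complex_of_real (map c [0..<r] ! \<alpha>) * tensor_op n A B (L \<alpha>) (R \<alpha>) $$ (x, y))"
    proof (rule eq_matI)
      fix x y assume "x < dim_row (mat (2 ^ n) (2 ^ n) (\<lambda>(x, y). \<Sum>\<alpha><length (map c [0..<r]).
        complex_of_real (map c [0..<r] ! \<alpha>) * tensor_op n A B (L \<alpha>) (R \<alpha>) $$ (x, y)))"
        "y < dim_col (mat (2 ^ n) (2 ^ n) (\<lambda>(x, y). \<Sum>\<alpha><length (map c [0..<r]).
        complex_of_real (map c [0..<r] ! \<alpha>) * tensor_op n A B (L \<alpha>) (R \<alpha>) $$ (x, y)))"
      then have xy: "x < 2 ^ n" "y < 2 ^ n" by simp_all
      note f = bipartitionD[OF AB]
      have l: "sub_index A x < dA" "sub_index A y < dA" "sub_index B x < dB" "sub_index B y < dB"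
        using f by (simp_all add: dA_def dB_def sub_index_less)
      have "\<rho> $$ (x, y) = M (sub_index A x, sub_index A y) (sub_index B x, sub_index B y)"
        using xy by (simp add: M_def idx)
      also have "\<dots> = (\<Sum>k<r. complex_of_real (c k) * u k (sub_index A x, sub_index A y) * v k (sub_index B x, sub_index B y))"
        using svd(4) l by simp
      finally show "\<rho> $$ (x, y) = mat (2 ^ n) (2 ^ n) (\<lambda>(x, y). \<Sum>\<alpha><length (map c [0..<r]).
          complex_of_real (map c [0..<r] ! \<alpha>) * tensor_op n A B (L \<alpha>) (R \<alpha>) $$ (x, y)) $$ (x, y)"
        using xy l by (simp add: tensor_op_def L_def R_def mult.assoc)
    qed (use \<rho> in auto)
  qed
  then show ?thesis by blast
qed

lemma op_schmidt_coeffs: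
  assumes "bipartition n A B" "\<rho> \<in> carrier_mat (2 ^ n) (2 ^ n)"
  obtains L R where "op_schmidt_decomp n A B \<rho> (op_schmidt_coeffs n A B \<rho>) L R"
  using someI_ex[OF op_schmidt_exists[OF assms]] unfolding op_schmidt_coeffs_def by blast

lemma op_schmidt_tensor_orthonormal:
  assumes AB: "bipartition n A B" and s: "op_schmidt_decomp n A B \<rho> cs L R"
  shows "orthonormal ({..<2 ^ n} \<times> {..<2 ^ n}) (length cs) (\<lambda>\<alpha> p. tensor_op n A B (L \<alpha>) (R \<alpha>) $$ p)"
  unfolding orthonormal_def
proof (intro allI impI)
  fix \<alpha> \<beta> assume ab: "\<alpha> < length cs" "\<beta> < length cs"
  let ?l = "\<lambda>a a'. cnj (L \<alpha> $$ (a, a')) * L \<beta> $$ (a, a')" and ?r = "\<lambda>b b'. cnj (R \<alpha> $$ (b, b')) * R \<beta> $$ (b, b')"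
  have L: "(\<Sum>a<2 ^ card A. \<Sum>a'<2 ^ card A. ?l a a') = of_bool (\<alpha> = \<beta>)"
    using s ab orthonormalD[of "{..<2 ^ card A} \<times> {..<2 ^ card A}" "length cs" "\<lambda>\<alpha> p. L \<alpha> $$ p"]
    by (simp add: op_schmidt_decomp_def hs_orthonormal_iff sum.cartesian_product case_prod_beta)
  have R: "(\<Sum>b<2 ^ card B. \<Sum>b'<2 ^ card B. ?r b b') = of_bool (\<alpha> = \<beta>)"
    using s ab orthonormalD[of "{..<2 ^ card B} \<times> {..<2 ^ card B}" "length cs" "\<lambda>\<alpha> p. R \<alpha> $$ p"]
    by (simp add: op_schmidt_decomp_def hs_orthonormal_iff sum.cartesian_product case_prod_beta)
  have "(\<Sum>p\<in>{..<2 ^ n} \<times> {..<2 ^ n}. cnj (tensor_op n A B (L \<alpha>) (R \<alpha>) $$ p) * tensor_op n A B (L \<beta>) (R \<beta>) $$ p) =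
    (\<Sum>x<2 ^ n. \<Sum>y<2 ^ n. ?l (sub_index A x) (sub_index A y) * ?r (sub_index B x) (sub_index B y))"
    unfolding sum.cartesian_product
    by (intro sum.cong refl) (auto simp: tensor_op_def)
  also have "\<dots> = (\<Sum>a<2 ^ card A. \<Sum>a'<2 ^ card A. \<Sum>b<2 ^ card B. \<Sum>b'<2 ^ card B. ?l a a' * ?r b b')"
    by (rule sum_sum_sub_index[OF AB])
  also have "\<dots> = (\<Sum>a<2 ^ card A. \<Sum>a'<2 ^ card A. ?l a a') * (\<Sum>b<2 ^ card B. \<Sum>b'<2 ^ card B. ?r b b')"
    by (simp only: sum_distrib_left[symmetric] sum_distrib_right[symmetric])
  also have "\<dots> = of_bool (\<alpha> = \<beta>)" unfolding L R by simp
  finally show "(\<Sum>p\<in>{..<2 ^ n} \<times> {..<2 ^ n}. cnj (tensor_op n A B (L \<alpha>) (R \<alpha>) $$ p) * tensor_op n A B (L \<beta>) (R \<beta>) $$ p) = of_bool (\<alpha> = \<beta>)" .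
qed

lemma op_schmidt_entries:
  assumes "op_schmidt_decomp n A B \<rho> cs L R" "p \<in> {..<2 ^ n} \<times> {..<2 ^ n}"
  shows "\<rho> $$ p = (\<Sum>\<alpha><length cs. complex_of_real (cs ! \<alpha>) * tensor_op n A B (L \<alpha>) (R \<alpha>) $$ p)"
proof -
  have "\<rho> = mat (2 ^ n) (2 ^ n) (\<lambda>(x, y).
         \<Sum>\<alpha><length cs. complex_of_real (cs ! \<alpha>) * tensor_op n A B (L \<alpha>) (R \<alpha>) $$ (x, y))"
    using assms(1) unfolding op_schmidt_decomp_def by blast
  from arg_cong[OF this, of "\<lambda>M. M $$ p"] show ?thesis using assms(2) by auto
qed

lemma op_schmidt_coeff:
  assumes AB: "bipartition n A B" and s: "op_schmidt_decomp n A B \<rho> cs L R" and "\<alpha> < length cs"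
  shows "complex_of_real (cs ! \<alpha>) = (\<Sum>p\<in>{..<2 ^ n} \<times> {..<2 ^ n}. cnj (tensor_op n A B (L \<alpha>) (R \<alpha>) $$ p) * \<rho> $$ p)"
  using orthonormal_coeff[OF op_schmidt_tensor_orthonormal[OF AB s] assms(3), of "\<lambda>\<alpha>. complex_of_real (cs ! \<alpha>)"]
  by (simp add: op_schmidt_entries[OF s])

text \<open>Parseval: the residual of rho after projection onto the product operators
  vanishes.\<close>

lemma op_schmidt_sum_squares:
  assumes AB: "bipartition n A B" and s: "op_schmidt_decomp n A B \<rho> cs L R"
  shows "(\<Sum>\<alpha><length cs. (cs ! \<alpha>)\<^sup>2) = hs_sq (2 ^ n) (entries \<rho>)"
proof -
  have "hs_sq (2 ^ n) (entries \<rho>) = (\<Sum>p\<in>{..<2 ^ n} \<times> {..<2 ^ n}. (cmod (\<rho> $$ p))\<^sup>2)"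
    by (simp add: hs_sq_def sum.cartesian_product case_prod_beta)
  also have "\<dots> = (\<Sum>\<alpha><length cs. (cmod (complex_of_real (cs ! \<alpha>)))\<^sup>2)"
  proof -
    let ?I = "{..<2 ^ n} \<times> {..<2 ^ n} :: (nat \<times> nat) set" and ?T = "\<lambda>\<alpha> p. tensor_op n A B (L \<alpha>) (R \<alpha>) $$ p"
    have c: "(\<Sum>p\<in>?I. cnj (?T \<alpha> p) * \<rho> $$ p) = complex_of_real (cs ! \<alpha>)" if "\<alpha> < length cs" for \<alpha>
      using op_schmidt_coeff[OF AB s that] by simp
    have "\<rho> $$ p - (\<Sum>\<alpha><length cs. (\<Sum>p\<in>?I. cnj (?T \<alpha> p) * \<rho> $$ p) * ?T \<alpha> p) = 0" if "p \<in> ?I" for p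
      by (subst op_schmidt_entries[OF s that]) (simp add: c)
    then have "(\<Sum>p\<in>?I. (cmod (\<rho> $$ p - (\<Sum>\<alpha><length cs. (\<Sum>p\<in>?I. cnj (?T \<alpha> p) * \<rho> $$ p) * ?T \<alpha> p)))\<^sup>2) = 0"
      by (intro sum.neutral ballI) (simp only: norm_zero zero_power2)
    then show ?thesis
      unfolding orthonormal_residual(1)[OF op_schmidt_tensor_orthonormal[OF AB s]] by (simp add: c)
  qed
  finally show ?thesis by simp
qed

text \<open>The product operators are orthonormal in a space of dimension 4^n; this caps the
  logarithm of the rank at 2 n.\<close>

lemma op_schmidt_length:
  assumes AB: "bipartition n A B" and s: "op_schmidt_decomp n A B \<rho> cs L R"
  shows "length cs \<le> 4 ^ n"
proof -
  have "length cs \<le> card ({..<2 ^ n :: nat} \<times> {..<2 ^ n :: nat})"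
    by (rule orthonormal_le_card[OF _ op_schmidt_tensor_orthonormal[OF AB s]]) simp
  also have "\<dots> = 4 ^ n" by (simp add: card_cartesian_product flip: power_mult_distrib)
  finally show ?thesis .
qed

text \<open>The trace is the sum of the coefficients times tr L tr R. By Bessel against the identity
  the squared traces sum to at most 2^|A| and 2^|B|, and Cauchy-Schwarz combines them. For a state
  this forces some coefficient to be at least 2^(-n/2).\<close>

lemma op_schmidt_trace_le:
  assumes AB: "bipartition n A B" and s: "op_schmidt_decomp n A B \<rho> cs L R"
    and M: "\<And>\<alpha>. \<alpha> < length cs \<Longrightarrow> cs ! \<alpha> \<le> M" and "0 \<le> M"
  shows "cmod (\<Sum>x<2 ^ n. \<rho> $$ (x, x)) \<le> M * sqrt (2 ^ n)"
proof -
  have pos: "0 \<le> cs ! \<alpha>" if "\<alpha> < length cs" for \<alpha> using s that by (auto simp: op_schmidt_decomp_def less_imp_le)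
  define l r where "l \<alpha> = (\<Sum>a<2 ^ card A. L \<alpha> $$ (a, a))" and "r \<alpha> = (\<Sum>b<2 ^ card B. R \<alpha> $$ (b, b))" for \<alpha>
  have bes: "(\<Sum>\<alpha><m. (cmod (\<Sum>x<d. X \<alpha> $$ (x, x)))\<^sup>2) \<le> real d" if "hs_orthonormal d m X" for d m X
  proof -
    have o: "orthonormal ({..<d} \<times> {..<d}) m (\<lambda>\<alpha> p. X \<alpha> $$ p)" using that by (simp add: hs_orthonormal_iff)
    have "(\<Sum>p\<in>{..<d} \<times> {..<d}. cnj (X \<alpha> $$ p) * of_bool (fst p = snd p)) = cnj (\<Sum>x<d. X \<alpha> $$ (x, x))" for \<alpha>
    proof -
      have "(\<Sum>p\<in>{..<d} \<times> {..<d}. cnj (X \<alpha> $$ p) * of_bool (fst p = snd p)) = (\<Sum>x<d. \<Sum>y<d. cnj (X \<alpha> $$ (x, y)) * of_bool (x = y))"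
        unfolding sum.cartesian_product by (intro sum.cong refl) auto
      also have "\<dots> = (\<Sum>x<d. cnj (X \<alpha> $$ (x, x)))"
        by (intro sum.cong refl) (simp only: sum_of_bool_mult lessThan_iff)
      finally show ?thesis by simp
    qed
    moreover have "(\<Sum>p\<in>{..<d} \<times> {..<d}. (cmod (of_bool (fst p = snd p)))\<^sup>2) = real d"
    proof -
      have "(\<Sum>p\<in>{..<d} \<times> {..<d}. (cmod (of_bool (fst p = snd p)))\<^sup>2) = (\<Sum>x<d. \<Sum>y<d. if x = y then 1 else 0)"
        unfolding sum.cartesian_product by (intro sum.cong refl) auto
      then show ?thesis by simp
    qed
    ultimately show ?thesis using bessel[OF o, of "\<lambda>p. of_bool (fst p = snd p)"] by (simp del: cnj_sum)
  qed
  have tr: "(\<Sum>x<2 ^ n. tensor_op n A B (L \<alpha>) (R \<alpha>) $$ (x, x)) = l \<alpha> * r \<alpha>" for \<alpha>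
    using sum_sub_index[OF AB, of "\<lambda>a b. L \<alpha> $$ (a, a) * R \<alpha> $$ (b, b)"]
    by (simp add: tensor_op_def l_def r_def sum_product)
  have "(\<Sum>x<2 ^ n. \<rho> $$ (x, x)) = (\<Sum>\<alpha><length cs. complex_of_real (cs ! \<alpha>) * (l \<alpha> * r \<alpha>))"
    unfolding tr[symmetric] sum_distrib_left
    by (subst sum.swap) (simp add: op_schmidt_entries[OF s])
  then have "cmod (\<Sum>x<2 ^ n. \<rho> $$ (x, x)) \<le> (\<Sum>\<alpha><length cs. (cs ! \<alpha>) * (cmod (l \<alpha>) * cmod (r \<alpha>)))"
    using norm_sum[of "\<lambda>\<alpha>. complex_of_real (cs ! \<alpha>) * (l \<alpha> * r \<alpha>)" "{..<length cs}"] pos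
    by (simp add: norm_mult)
  also have "\<dots> \<le> (\<Sum>\<alpha><length cs. M * (cmod (l \<alpha>) * cmod (r \<alpha>)))"
    using M by (intro sum_mono mult_right_mono) auto
  also have "\<dots> = M * (\<Sum>\<alpha><length cs. \<bar>cmod (l \<alpha>)\<bar> * \<bar>cmod (r \<alpha>)\<bar>)" by (simp add: sum_distrib_left)
  also have "\<dots> \<le> M * (sqrt (\<Sum>\<alpha><length cs. (cmod (l \<alpha>))\<^sup>2) * sqrt (\<Sum>\<alpha><length cs. (cmod (r \<alpha>))\<^sup>2))"
    using L2_set_mult_ineq[of "\<lambda>\<alpha>. cmod (l \<alpha>)" "\<lambda>\<alpha>. cmod (r \<alpha>)" "{..<length cs}"] \<open>0 \<le> M\<close>
    by (intro mult_left_mono) (simp_all add: L2_set_def)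
  also have "\<dots> \<le> M * (sqrt (real (2 ^ card A)) * sqrt (real (2 ^ card B)))"
    using s bes[of "2 ^ card A" "length cs" L] bes[of "2 ^ card B" "length cs" R] \<open>0 \<le> M\<close>
    by (intro mult_left_mono mult_mono real_sqrt_le_mono) (auto simp: op_schmidt_decomp_def l_def r_def sum_nonneg)
  also have "sqrt (real (2 ^ card A)) * sqrt (real (2 ^ card B)) = sqrt (2 ^ n)"
    using bipartitionD(3)[OF AB] by (simp flip: real_sqrt_mult power_add)
  finally show ?thesis .
qed

section \<open>Upper bounds on the entropies\<close>

text \<open>Termwise ln x <= x - 1 at x = w i / p i. The families may have different totals, which
  the last summand records.\<close>

lemma gibbs_inequality:
  fixes p w :: "nat \<Rightarrow> real"
  assumes "\<And>i. i < r \<Longrightarrow> 0 < p i" "\<And>i. i < r \<Longrightarrow> 0 < w i"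
  shows "- (\<Sum>i<r. p i * log 2 (p i)) \<le> - (\<Sum>i<r. p i * log 2 (w i)) + ((\<Sum>i<r. w i) - (\<Sum>i<r. p i)) / ln 2"
proof -
  have "p i * log 2 (w i) - p i * log 2 (p i) \<le> (w i - p i) / ln 2" if "i < r" for i
  proof -
    have "p i * (ln (w i) - ln (p i)) = p i * ln (w i / p i)" using assms(1,2)[OF that] by (simp add: ln_div)
    also have "\<dots> \<le> p i * (w i / p i - 1)"
      using assms that by (intro mult_left_mono ln_le_minus_one) (auto simp: less_imp_le)
    also have "\<dots> = w i - p i" using assms(1)[OF that] by (simp add: right_diff_distrib)
    finally have "p i * (ln (w i) - ln (p i)) / ln 2 \<le> (w i - p i) / ln 2" by (intro divide_right_mono) auto
    then show ?thesis by (simp add: log_def right_diff_distrib diff_divide_distrib)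
  qed
  then have "(\<Sum>i<r. p i * log 2 (w i) - p i * log 2 (p i)) \<le> (\<Sum>i<r. (w i - p i) / ln 2)"
    by (intro sum_mono) auto
  then show ?thesis by (simp add: sum_subtractf flip: sum_divide_distrib)
qed

lemma sum_list_nth: "(\<Sum>c\<leftarrow>cs. f c) = (\<Sum>\<alpha><length cs. f (cs ! \<alpha>) :: real)"
  by (simp add: sum_list_sum_nth lessThan_atLeast0)

lemma log_le_of_le_power4:
  assumes "0 < r" "r \<le> 4 ^ n"
  shows "log 2 (real r) \<le> 2 * real n"
proof -
  have "real r \<le> real (4 ^ n)" using assms(2) by (simp only: of_nat_le_iff)
  then have "log 2 (real r) \<le> log 2 (4 ^ n)"
    using assms(1) by (subst log_le_cancel_iff) auto
  also have "(4::real) ^ n = 2 powr (2 * real n)" by (simp add: powr_mult powr_powr[symmetric] powr_realpow)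
  finally show ?thesis by simp
qed

lemma ln2_ge_half: "1 / 2 \<le> ln (2::real)"
  using ln_le_minus_one[of "1 / 2 :: real"] by (simp add: ln_div)

text \<open>Comparison with the uniform weights 1 / r, where r is at most 4^n. The squared
  coefficients sum to the purity rather than to 1, so small purity suppresses the term growing with
  n.\<close>

lemma op_entropy_le:
  assumes AB: "bipartition n A B" and \<rho>: "\<rho> \<in> carrier_mat (2 ^ n) (2 ^ n)"
    and q: "hs_sq (2 ^ n) (entries \<rho>) > 0"
  shows "op_entropy n A B \<rho> \<le> 2 * real n * hs_sq (2 ^ n) (entries \<rho>) + 2"
proof -
  define q where "q = hs_sq (2 ^ n) (entries \<rho>)"
  define cs where "cs = op_schmidt_coeffs n A B \<rho>"
  obtain L R where s: "op_schmidt_decomp n A B \<rho> cs L R"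
    using op_schmidt_coeffs[OF AB \<rho>] unfolding cs_def by blast
  define r where "r = length cs"
  have pos: "0 < (cs ! \<alpha>)\<^sup>2" if "\<alpha> < r" for \<alpha>
    using s that unfolding op_schmidt_decomp_def r_def by (intro zero_less_power) auto
  have sq: "(\<Sum>\<alpha><r. (cs ! \<alpha>)\<^sup>2) = q" unfolding r_def q_def by (rule op_schmidt_sum_squares[OF AB s])
  have r: "0 < r" using sq assms(3) by (cases "r = 0") (auto simp: q_def)
  have "op_entropy n A B \<rho> = - (\<Sum>\<alpha><r. (cs ! \<alpha>)\<^sup>2 * log 2 ((cs ! \<alpha>)\<^sup>2))"
    by (simp add: op_entropy_def sum_list_nth cs_def r_def)
  also have "\<dots> \<le> - (\<Sum>\<alpha><r. (cs ! \<alpha>)\<^sup>2 * log 2 (1 / real r)) + ((\<Sum>\<alpha><r. 1 / real r) - (\<Sum>\<alpha><r. (cs ! \<alpha>)\<^sup>2)) / ln 2"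
    using pos r by (intro gibbs_inequality) auto
  also have "\<dots> = q * log 2 (real r) + (1 - q) / ln 2"
    unfolding sum_distrib_right[symmetric] sq using r by (simp add: log_divide)
  also have "\<dots> \<le> q * (2 * real n) + 2"
  proof (intro add_mono mult_left_mono)
    show "log 2 (real r) \<le> 2 * real n"
      using r op_schmidt_length[OF AB s] by (intro log_le_of_le_power4) (simp_all add: r_def)
    show "0 \<le> q" using assms(3) by (simp add: q_def)
    have "1 - q \<le> 1" using \<open>0 \<le> q\<close> by simp
    also have "1 \<le> 2 * ln (2::real)" using ln2_ge_half by simp
    finally show "(1 - q) / ln 2 \<le> 2" by (simp add: divide_le_eq)
  qed
  finally show ?thesis by (simp add: q_def mult.commute)
qed

lemma trace_square_hs_sq:
  assumes \<rho>: "\<rho> \<in> carrier_mat d d" and s: "is_state d (entries \<rho>)"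
  shows "Re (mat_trace (\<rho> * \<rho>)) = hs_sq d (entries \<rho>)"
proof -
  have "mat_trace (\<rho> * \<rho>) = (\<Sum>i<d. (\<rho> * \<rho>) $$ (i, i))" using \<rho> by (simp add: mat_trace_def)
  also have "\<dots> = (\<Sum>i<d. \<Sum>k<d. \<rho> $$ (i, k) * \<rho> $$ (k, i))"
    by (intro sum.cong refl mult_mat_index_sum[OF \<rho> \<rho>]) auto
  also have "\<dots> = (\<Sum>i<d. \<Sum>k<d. \<rho> $$ (i, k) * cnj (\<rho> $$ (i, k)))"
    by (intro sum.cong refl arg_cong2[of _ _ _ _ "(*)"] is_state_herm[OF s]) auto
  also have "\<dots> = complex_of_real (hs_sq d (entries \<rho>))"
    unfolding hs_sq_def of_real_sum complex_norm_square ..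
  finally show ?thesis by simp
qed

text \<open>An estimate of Fano type. With largest weight p, comparison with weights that put one
  half on that label and 1 / (2 r) on each other label gives at most 1 + (1 - p) log r, and 1 - p is
  at most ln Q.\<close>

lemma op_entropy_norm_le:
  assumes AB: "bipartition n A B" and \<rho>: "\<rho> \<in> carrier_mat (2 ^ n) (2 ^ n)"
    and st: "is_state (2 ^ n) (entries \<rho>)"
  shows "op_entropy_norm n A B \<rho> \<le> 1 + 2 * real n * ln (2 ^ n * hs_sq (2 ^ n) (entries \<rho>))"
proof -
  define q where "q = hs_sq (2 ^ n) (entries \<rho>)"
  define Q where "Q = 2 ^ n * q"
  have Q: "1 \<le> Q" using is_state_hs_sq_ge[OF st] by (simp add: Q_def q_def)
  have q: "0 < q" using Q hs_sq_nonneg[of "2 ^ n" "entries \<rho>"] unfolding Q_def q_def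
    by (metis less_eq_real_def mult_zero_right not_one_le_zero)
  define cs where "cs = op_schmidt_coeffs n A B \<rho>"
  obtain L R where s: "op_schmidt_decomp n A B \<rho> cs L R"
    using op_schmidt_coeffs[OF AB \<rho>] unfolding cs_def by blast
  define r where "r = length cs"
  have cpos: "0 < cs ! \<alpha>" if "\<alpha> < r" for \<alpha>
    using s that unfolding op_schmidt_decomp_def r_def by auto
  define p where "p \<alpha> = (cs ! \<alpha>)\<^sup>2 / q" for \<alpha>
  have pos: "0 < p \<alpha>" if "\<alpha> < r" for \<alpha> using cpos[OF that] q by (simp add: p_def)
  have sp: "(\<Sum>\<alpha><r. p \<alpha>) = 1"
    using op_schmidt_sum_squares[OF AB s] q unfolding p_def r_def q_def by (simp flip: sum_divide_distrib)
  have r: "0 < r" using sp by (cases "r = 0") auto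
  have "finite ((!) cs ` {..<r})" "(!) cs ` {..<r} \<noteq> {}" using r by auto
  from Max_in[OF this] obtain \<alpha>0 where \<alpha>0: "\<alpha>0 < r" "Max ((!) cs ` {..<r}) = cs ! \<alpha>0" by auto
  have mx: "cs ! \<alpha> \<le> cs ! \<alpha>0" if "\<alpha> < length cs" for \<alpha>
    unfolding \<alpha>0(2)[symmetric] using that by (intro Max_ge) (auto simp: r_def)
  have "1 \<le> cs ! \<alpha>0 * sqrt (2 ^ n)"
    using op_schmidt_trace_le[OF AB s mx] cpos[OF \<alpha>0(1)] is_state_trace[OF st] by simp
  then have "1\<^sup>2 \<le> (cs ! \<alpha>0 * sqrt (2 ^ n))\<^sup>2" by (intro power_mono) auto
  then have "1 \<le> (cs ! \<alpha>0)\<^sup>2 * 2 ^ n" by (simp add: power_mult_distrib)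
  \<comment> \<open>Trace one makes the largest squared coefficient at least 2^-n; dividing by the
    purity gives 1 / Q.\<close>
  then have "1 / Q \<le> p \<alpha>0" using q by (simp add: Q_def p_def field_simps)
  moreover have "- ln Q \<le> 1 / Q - 1" using ln_le_minus_one[of "1 / Q"] Q by (simp add: ln_div)
  ultimately have \<delta>: "1 - p \<alpha>0 \<le> ln Q" by simp
  define w where "w \<alpha> = (if \<alpha> = \<alpha>0 then 1 / 2 else 1 / (2 * real r))" for \<alpha>
  have wpos: "0 < w \<alpha>" for \<alpha> using r by (simp add: w_def)
  have sw: "(\<Sum>\<alpha><r. w \<alpha>) \<le> 1"
  proof -
    have "(\<Sum>\<alpha><r. w \<alpha>) \<le> (\<Sum>\<alpha><r. (if \<alpha> = \<alpha>0 then 1 / 2 else 0) + 1 / (2 * real r))"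
      by (intro sum_mono) (simp add: w_def)
    also have "\<dots> = 1" using \<alpha>0(1) r by (simp add: sum.distrib)
    finally show ?thesis .
  qed
  have lr: "0 \<le> log 2 (real r)" using r by simp
  have "op_entropy_norm n A B \<rho> = - (\<Sum>\<alpha><r. p \<alpha> * log 2 (p \<alpha>))"
    by (simp add: op_entropy_norm_def sum_list_nth cs_def r_def p_def q_def Let_def trace_square_hs_sq[OF \<rho> st])
  also have "\<dots> \<le> - (\<Sum>\<alpha><r. p \<alpha> * log 2 (w \<alpha>)) + ((\<Sum>\<alpha><r. w \<alpha>) - (\<Sum>\<alpha><r. p \<alpha>)) / ln 2"
    using pos wpos by (intro gibbs_inequality) auto
  also have "\<dots> \<le> - (\<Sum>\<alpha><r. p \<alpha> * log 2 (w \<alpha>))"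
    using sw sp by (simp add: divide_nonpos_pos)
  also have "\<dots> = (\<Sum>\<alpha><r. p \<alpha> + (p \<alpha> * log 2 (real r) - (if \<alpha> = \<alpha>0 then p \<alpha>0 * log 2 (real r) else 0)))"
    unfolding sum_negf[symmetric] using r
    by (intro sum.cong refl) (auto simp: w_def log_divide log_mult algebra_simps)
  also have "\<dots> = 1 + (1 - p \<alpha>0) * log 2 (real r)"
    using \<alpha>0(1) sp by (simp add: sum.distrib sum_subtractf sum_distrib_right[symmetric] left_diff_distrib)
  also have "\<dots> \<le> 1 + ln Q * (2 * real n)"
    using r op_schmidt_length[OF AB s] Q \<delta> lr
    by (intro add_left_mono mult_mono log_le_of_le_power4) (simp_all add: r_def)
  finally show ?thesis by (simp add: Q_def q_def mult.commute)
qed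

section \<open>Entropy bounds along noisy circuits\<close>

lemma contraction_exponent:
  assumes "0 < lam" "lam \<le> (1::real)"
  obtains k where "(1 - lam) ^ (2 ^ k) \<le> 1/32"
proof -
  obtain m where m: "(1 - lam) ^ m < 1/32" using real_arch_pow_inv[of "1/32" "1 - lam"] assms by auto
  have "(1 - lam) ^ (2 ^ m) \<le> (1 - lam) ^ m" using assms by (intro power_decreasing) auto
  then show thesis using m that[of m] by simp
qed

lemma op_entropy_noisy:
  assumes lam: "0 < lam" "lam \<le> 1"
  shows "\<exists>(L_abs::nat) C::real. C > 0 \<and>
         (\<forall>n \<rho>\<^sub>0 U A B l. n \<ge> 2 \<longrightarrow> density_op n \<rho>\<^sub>0 \<longrightarrow> (\<forall>k\<ge>1. unitary_op n (U k)) \<longrightarrow>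
            bipartition n A B \<longrightarrow> l \<ge> L_abs \<longrightarrow>
            op_entropy n A B (noisy_state n lam U \<rho>\<^sub>0 l) \<le> C * log 2 (real n))"
proof -
  obtain k where k: "(1 - lam) ^ (2 ^ k) \<le> 1/32" using contraction_exponent[OF lam] .
  define \<theta> :: real where "\<theta> = 1 - 1 / 2 ^ Suc k"
  have \<theta>: "0 \<le> \<theta>" "\<theta> < 1" using one_le_power[of "2::real" "Suc k"] by (simp_all add: \<theta>_def field_simps)
  \<comment> \<open>Exponent 1/4 brings the bound on 2^n tr rho^2 down to (4^n)^(1/4) = 2^(n/2), so
    the purity is at most 2^(-n/2).\<close>
  obtain L where L: "\<theta> ^ L < 1/4" using real_arch_pow_inv[of "1/4" \<theta>] \<theta> by auto
  show ?thesis
  \<comment> \<open>10 = 8 + 2: with q the purity, 2 n q is at most 8 because n q / 4 is at most 1,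
    and \<open>op_entropy_le\<close> adds 2. The factor log n is at least 1.\<close>
  proof (intro exI[of _ L] exI[of _ "10::real"] conjI allI impI)
    fix n :: nat and \<rho>\<^sub>0 and U :: "nat \<Rightarrow> complex mat" and A B and l :: nat
    assume n: "n \<ge> 2" and \<rho>: "density_op n \<rho>\<^sub>0" and U: "\<forall>k\<ge>1. unitary_op n (U k)" and AB: "bipartition n A B" and l: "l \<ge> L"
    let ?\<rho> = "noisy_state n lam U \<rho>\<^sub>0 l"
    define q where "q = hs_sq (2 ^ n) (entries ?\<rho>)"
    have st: "is_state (2 ^ n) (entries ?\<rho>)" and b: "2 ^ n * q \<le> (4 ^ n) powr (\<theta> ^ l)"
      using noisy_state_bound[OF less_imp_le[OF lam(1)] lam(2) k \<rho> U] by (auto simp: q_def \<theta>_def)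
    have "1 \<le> 2 ^ n * q" using is_state_hs_sq_ge[OF st] by (simp add: q_def)
    then have q0: "0 < q" by (metis less_eq_real_def mult_zero_right not_one_le_zero q_def hs_sq_nonneg)
    have "\<theta> ^ l \<le> \<theta> ^ L" using \<theta> l by (intro power_decreasing) auto
    then have "\<theta> ^ l \<le> 1/4" using L by simp
    then have "(4 ^ n :: real) powr (\<theta> ^ l) \<le> (4 ^ n) powr (1/4)" by (intro powr_mono) auto
    with b have "2 ^ n * q \<le> (4 ^ n) powr (1/4)" by simp
    also have "(4 ^ n :: real) = 2 powr (2 * real n)" by (simp add: powr_mult powr_powr[symmetric] powr_realpow)
    also have "(2 powr (2 * real n)) powr (1/4) = (2::real) powr (real n / 2)" by (simp add: powr_powr)
    finally have "2 ^ n * q \<le> 2 powr (real n / 2)" .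
    moreover have "(2::real) ^ n = 2 powr (real n / 2) * 2 powr (real n / 2)" by (simp add: powr_realpow flip: powr_add)
    ultimately have "2 powr (real n / 2) * q \<le> 1" by simp
    moreover have "real n / 4 \<le> 2 powr (real n / 2)"
    proof -
      have "real n / 4 \<le> real n / 2 * ln 2" using mult_left_mono[OF ln2_ge_half, of "real n / 2"] by simp
      also have "\<dots> \<le> exp (real n / 2 * ln 2)" using exp_ge_add_one_self[of "real n / 2 * ln 2"] by linarith
      finally show ?thesis by (simp add: powr_def mult.commute)
    qed
    ultimately have "real n / 4 * q \<le> 1" using q0 by (meson less_imp_le mult_right_mono order.trans)
    then have "op_entropy n A B ?\<rho> \<le> 10"
      using op_entropy_le[OF AB noisy_state_carrier[OF \<rho>], of lam U l] q0 by (simp add: q_def)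
    also have "10 \<le> 10 * log 2 (real n)" using n by simp
    finally show "op_entropy n A B ?\<rho> \<le> 10 * log 2 (real n)" .
  qed simp
qed

lemma op_entropy_norm_noisy:
  assumes lam: "0 < lam" "lam \<le> 1"
  shows "\<exists>(K::real) C::real. K > 0 \<and> C > 0 \<and>
         (\<forall>n \<rho>\<^sub>0 U A B l. n \<ge> 2 \<longrightarrow> density_op n \<rho>\<^sub>0 \<longrightarrow> (\<forall>k\<ge>1. unitary_op n (U k)) \<longrightarrow>
            bipartition n A B \<longrightarrow> real l \<ge> K * log 2 (real n) \<longrightarrow>
            op_entropy_norm n A B (noisy_state n lam U \<rho>\<^sub>0 l) \<le> C * log 2 (real n))"
proof -
  obtain k where k: "(1 - lam) ^ (2 ^ k) \<le> 1/32" using contraction_exponent[OF lam] .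
  define \<theta> :: real where "\<theta> = 1 - 1 / 2 ^ Suc k"
  have "(1::real) < 2 ^ Suc k" by (rule one_less_power) auto
  then have \<theta>: "0 < \<theta>" "\<theta> < 1" by (simp_all add: \<theta>_def field_simps)
  define s where "s = - log 2 \<theta>"
  have s: "0 < s" using \<theta> by (simp add: s_def)
  show ?thesis
  \<comment> \<open>The factor 2 / s makes \<theta>^l at most n^-2, so 2 n ln Q <= 4 n^2 \<theta>^l
    <= 4; the additive 1 of \<open>op_entropy_norm_le\<close> gives 5.\<close>
  proof (rule exI[of _ "2 / s"], rule exI[of _ "5::real"], intro conjI allI impI)
    fix n :: nat and \<rho>\<^sub>0 and U :: "nat \<Rightarrow> complex mat" and A B and l :: nat
    assume n: "n \<ge> 2" and \<rho>: "density_op n \<rho>\<^sub>0" and U: "\<forall>k\<ge>1. unitary_op n (U k)" and AB: "bipartition n A B"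
      and l: "real l \<ge> 2 / s * log 2 (real n)"
    let ?\<rho> = "noisy_state n lam U \<rho>\<^sub>0 l"
    define Q where "Q = 2 ^ n * hs_sq (2 ^ n) (entries ?\<rho>)"
    have st: "is_state (2 ^ n) (entries ?\<rho>)" and b: "Q \<le> (4 ^ n) powr (\<theta> ^ l)"
      using noisy_state_bound[OF less_imp_le[OF lam(1)] lam(2) k \<rho> U] by (auto simp: Q_def \<theta>_def)
    have Q1: "1 \<le> Q" using is_state_hs_sq_ge[OF st] by (simp add: Q_def)
    have ln2: "ln (2::real) \<le> 1" using ln_le_minus_one[of "2::real"] by simp
    have "ln Q \<le> ln ((4 ^ n) powr (\<theta> ^ l))" using b Q1 by (subst ln_le_cancel_iff) auto
    also have "\<dots> = \<theta> ^ l * (2 * real n * ln 2)"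
    proof -
      have "ln (4::real) = 2 * ln 2" using ln_realpow[of "2::real" 2] by simp
      then show ?thesis by (simp add: ln_powr ln_realpow)
    qed
    also have "\<dots> \<le> \<theta> ^ l * (2 * real n * 1)" using \<theta> ln2 by (intro mult_left_mono) auto
    finally have lnQ: "ln Q \<le> 2 * real n * \<theta> ^ l" by (simp add: mult_ac)
    have "\<theta> ^ l \<le> 1 / (real n)\<^sup>2"
    proof -
      have "2 * log 2 (real n) \<le> s * real l" using l s by (simp add: field_simps)
      then have "log 2 (\<theta> ^ l) \<le> log 2 (1 / (real n)\<^sup>2)"
        using \<theta> n by (simp add: s_def log_nat_power log_divide mult.commute)
      then show ?thesis using \<theta> n by (subst (asm) log_le_cancel_iff) auto
    qed
    then have "(real n)\<^sup>2 * \<theta> ^ l \<le> 1" using n by (simp add: field_simps)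
    have "2 * real n * ln Q \<le> 2 * real n * (2 * real n * \<theta> ^ l)" using lnQ by (intro mult_left_mono) auto
    also have "\<dots> = 4 * ((real n)\<^sup>2 * \<theta> ^ l)" by (simp add: power2_eq_square)
    also have "\<dots> \<le> 4" using \<open>(real n)\<^sup>2 * \<theta> ^ l \<le> 1\<close> by simp
    finally have "op_entropy_norm n A B ?\<rho> \<le> 5"
      using op_entropy_norm_le[OF AB noisy_state_carrier[OF \<rho>] st] by (simp add: Q_def)
    also have "5 \<le> 5 * log 2 (real n)" using n by simp
    finally show "op_entropy_norm n A B ?\<rho> \<le> 5 * log 2 (real n)" .
  qed (use s in simp_all)
qed

section \<open>Noisy classically correlated pairs\<close>

lemma sum_pairs:
  fixes g :: "nat \<Rightarrow> 'a::comm_monoid_add"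
  shows "(\<Sum>x<2 ^ (2 * m). g x) = (\<Sum>v<2 ^ m. \<Sum>u<2 ^ m. g (u + 2 ^ m * v))"
  using sum_lessThan_mult[of g "2 ^ m" "2 ^ m"] by (simp add: mult_2 power_add)

lemma prod_pairs:
  fixes h :: "nat \<Rightarrow> 'a::comm_monoid_mult"
  shows "(\<Prod>i<2 * m. h i) = (\<Prod>i<m. h i * h (i + m))"
proof -
  have "(\<Prod>i<m + k. h i) = (\<Prod>i<m. h i) * (\<Prod>i<k. h (i + m))" for k
    by (induction k) (simp_all add: add.commute mult.assoc)
  then show ?thesis by (simp add: prod.distrib mult_2)
qed

lemma sum_prod_pairs:
  fixes \<phi> :: "nat \<Rightarrow> nat \<Rightarrow> nat \<Rightarrow> 'a::comm_semiring_1"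
  shows "(\<Sum>x<2 ^ (2 * m). \<Prod>i<m. \<phi> i (qubit x i) (qubit x (i + m))) = (\<Prod>i<m. \<Sum>a<2. \<Sum>b<2. \<phi> i a b)"
proof -
  have "(\<Sum>x<2 ^ (2 * m). \<Prod>i<m. \<phi> i (qubit x i) (qubit x (i + m))) =
     (\<Sum>v<2 ^ m. \<Sum>u<2 ^ m. \<Prod>i<m. \<phi> i (qubit u i) (qubit v i))"
    unfolding sum_pairs by (intro sum.cong refl prod.cong) (simp add: qubit_concat)
  then show ?thesis
    using sum_sum_prod_qubit[where n = m and f = \<phi>] by (subst (asm) sum.swap) simp
qed

text \<open>Joint law of two uniform bits with correlation t.\<close>

definition pair_factor :: "real \<Rightarrow> nat \<Rightarrow> nat \<Rightarrow> real" where
  "pair_factor t a b = (if a = b then 1 + t else 1 - t) / 4"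

text \<open>Bit i of the first half is paired with bit i of the second half, so every pair straddles
  the cut between the halves.\<close>

definition pair_weight :: "nat \<Rightarrow> real \<Rightarrow> nat \<Rightarrow> real" where
  "pair_weight m t x = (\<Prod>i<m. pair_factor t (qubit x i) (qubit x (i + m)))"

definition pair_state :: "nat \<Rightarrow> complex mat" where
  "pair_state m = mat (2 ^ (2 * m)) (2 ^ (2 * m)) (\<lambda>(x, y). of_bool (x = y) * complex_of_real (pair_weight m 1 x))"

lemma pair_weight_nonneg: "0 \<le> t \<Longrightarrow> t \<le> 1 \<Longrightarrow> 0 \<le> pair_weight m t x"
  unfolding pair_weight_def pair_factor_def by (intro prod_nonneg) auto

lemma pair_weight_sum: "(\<Sum>x<2 ^ (2 * m). pair_weight m t x) = 1"
  unfolding pair_weight_def sum_prod_pairs[where \<phi> = "\<lambda>i. pair_factor t"]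
  by (simp add: sum_less_2 pair_factor_def field_simps)

lemma pair_weight_sum_squares: "(\<Sum>x<2 ^ (2 * m). (pair_weight m t x)\<^sup>2) = ((1 + t\<^sup>2) / 4) ^ m"
proof -
  have "(\<Sum>x<2 ^ (2 * m). (pair_weight m t x)\<^sup>2) = (\<Sum>x<2 ^ (2 * m). \<Prod>i<m. (pair_factor t (qubit x i) (qubit x (i + m)))\<^sup>2)"
    by (simp add: pair_weight_def prod_power_distrib)
  also have "\<dots> = (\<Prod>i<m. \<Sum>a<2. \<Sum>b<2. (pair_factor t a b)\<^sup>2)"
    by (rule sum_prod_pairs[where \<phi> = "\<lambda>i a b. (pair_factor t a b)\<^sup>2"])
  also have "(\<Sum>a<2. \<Sum>b<2. (pair_factor t a b)\<^sup>2) = (1 + t\<^sup>2) / 4"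
    by (simp add: sum_less_2 pair_factor_def power2_eq_square field_simps)
  finally show ?thesis by simp
qed

lemma pair_weight_marginals:
  assumes "0 \<le> t" "t \<le> 1"
  shows "u < 2 ^ m \<Longrightarrow> (\<Sum>v<2 ^ m. pair_weight m t (u + 2 ^ m * v)) = 1 / 2 ^ m"
    and "(\<Sum>u<2 ^ m. pair_weight m t (u + 2 ^ m * v)) = 1 / 2 ^ m"
proof -
  have w: "pair_weight m t (u + 2 ^ m * v) = (\<Prod>i<m. pair_factor t (qubit u i) (qubit v i))" if "u < 2 ^ m" for u v
    unfolding pair_weight_def using that by (intro prod.cong refl) (simp add: qubit_concat)
  have s: "(\<Sum>b<2. pair_factor t a b) = 1/2" "(\<Sum>b<2. pair_factor t b a) = 1/2" if "a < 2" for a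
    using that by (auto simp: less_2_cases_iff sum_less_2 pair_factor_def field_simps)
  show "(\<Sum>v<2 ^ m. pair_weight m t (u + 2 ^ m * v)) = 1 / 2 ^ m" if "u < 2 ^ m"
    using sum_prod_qubit[where n = m and f = "\<lambda>i b. pair_factor t (qubit u i) b"]
    by (simp add: w[OF that] s qubit_less_2 power_one_over)
  have "(\<Sum>u<2 ^ m. pair_weight m t (u + 2 ^ m * v)) = (\<Sum>u<2 ^ m. \<Prod>i<m. pair_factor t (qubit u i) (qubit v i))"
    by (intro sum.cong refl w) simp
  also have "\<dots> = 1 / 2 ^ m"
    using sum_prod_qubit[where n = m and f = "\<lambda>i b. pair_factor t b (qubit v i)"]
    by (simp add: s qubit_less_2 power_one_over)
  finally show "(\<Sum>u<2 ^ m. pair_weight m t (u + 2 ^ m * v)) = 1 / 2 ^ m" .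
qed

lemma density_op_pair_state: "density_op (2 * m) (pair_state m)"
  unfolding density_op_def
proof (intro conjI ballI)
  show c: "pair_state m \<in> carrier_mat (2 ^ (2 * m)) (2 ^ (2 * m))" by (simp add: pair_state_def)
  show "mat_adjoint (pair_state m) = pair_state m"
    by (intro eq_matI) (auto simp: mat_adjoint_index mat_adjoint_dim pair_state_def)
  show "mat_trace (pair_state m) = 1"
    using arg_cong[OF pair_weight_sum[of m 1], of complex_of_real] by (simp add: mat_trace_def pair_state_def)
  fix v :: "complex vec" assume v: "v \<in> carrier_vec (2 ^ (2 * m))"
  have e: "(pair_state m *\<^sub>v v) $ x = complex_of_real (pair_weight m 1 x) * v $ x" if "x < 2 ^ (2 * m)" for x
  proof -
    have "(pair_state m *\<^sub>v v) $ x = (\<Sum>y<2 ^ (2 * m). complex_of_real (pair_weight m 1 x) * v $ y * of_bool (x = y))"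
    proof -
      have "(pair_state m *\<^sub>v v) $ x = (\<Sum>y<2 ^ (2 * m). pair_state m $$ (x, y) * v $ y)"
        using that v c by (simp add: scalar_prod_def lessThan_atLeast0)
      also have "\<dots> = (\<Sum>y<2 ^ (2 * m). complex_of_real (pair_weight m 1 x) * v $ y * of_bool (x = y))"
        using that by (intro sum.cong refl) (simp add: pair_state_def)
      finally show ?thesis .
    qed
    then show ?thesis by (simp only: sum_of_bool_mult[OF that])
  qed
  have "(pair_state m *\<^sub>v v) \<bullet>c v = (\<Sum>x<2 ^ (2 * m). (pair_state m *\<^sub>v v) $ x * cnj (v $ x))"
    using v by (auto simp: scalar_prod_def lessThan_atLeast0 intro!: sum.cong)
  also have "\<dots> = (\<Sum>x<2 ^ (2 * m). complex_of_real (pair_weight m 1 x * (cmod (v $ x))\<^sup>2))"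
    by (intro sum.cong refl) (simp add: e complex_norm_square mult.assoc del: of_real_power)
  finally have "Re ((pair_state m *\<^sub>v v) \<bullet>c v) = (\<Sum>x<2 ^ (2 * m). pair_weight m 1 x * (cmod (v $ x))\<^sup>2)"
    by (simp only: Re_sum Re_complex_of_real)
  then show "0 \<le> Re ((pair_state m *\<^sub>v v) \<bullet>c v)" by (simp add: sum_nonneg pair_weight_nonneg)
qed

lemma unitary_op_one: "unitary_op n (1\<^sub>m (2 ^ n))"
proof -
  have "mat_adjoint (1\<^sub>m (2 ^ n) :: complex mat) = 1\<^sub>m (2 ^ n)"
    by (intro eq_matI) (auto simp: mat_adjoint_index mat_adjoint_dim)
  then show ?thesis by (simp add: unitary_op_def)
qed

text \<open>Noise acts on both bits of a pair, and each action multiplies the correlation by \<mu>.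
  Diagonal operators stay diagonal because the kernel vanishes from equal to unequal digits.\<close>

lemma noise_pair_weight:
  assumes "x < 2 ^ (2 * m)" "y < 2 ^ (2 * m)"
  shows "noise (2 * m) \<mu> (\<lambda>x y. of_bool (x = y) * complex_of_real (pair_weight m t x)) x y =
    of_bool (x = y) * complex_of_real (pair_weight m (\<mu>\<^sup>2 * t) x)"
proof -
  let ?k = "\<lambda>x'. noise_kernel (2 * m) \<mu> x' x' x y"
  have "noise (2 * m) \<mu> (\<lambda>x y. of_bool (x = y) * complex_of_real (pair_weight m t x)) x y =
     (\<Sum>x'<2 ^ (2 * m). \<Sum>y'<2 ^ (2 * m). (complex_of_real (pair_weight m t x') * complex_of_real (noise_kernel (2 * m) \<mu> x' y' x y)) * of_bool (x' = y'))"
    unfolding noise_def by (intro sum.cong refl) simp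
  also have "\<dots> = complex_of_real (\<Sum>x'<2 ^ (2 * m). pair_weight m t x' * ?k x')"
    unfolding of_real_sum of_real_mult by (intro sum.cong refl) (simp only: sum_of_bool_mult lessThan_iff)
  also have "(\<Sum>x'<2 ^ (2 * m). pair_weight m t x' * ?k x') = of_bool (x = y) * pair_weight m (\<mu>\<^sup>2 * t) x"
  proof (cases "x = y")
    case False
    have "\<exists>i<2 * m. qubit x i \<noteq> qubit y i"
    proof (rule ccontr)
      assume "\<not> ?thesis"
      then have "x = y" using assms by (intro qubit_eqI[of x "2 * m" y]) auto
      with False show False by simp
    qed
    then obtain i where i: "i < 2 * m" "qubit x i \<noteq> qubit y i" by blast
    have "?k x' = 0" for x'
      unfolding noise_kernel_def using i by (intro prod_zero bexI[of _ i]) (auto simp: dep_kernel_def)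
    then show ?thesis using False by simp
  next
    case True
    have one: "(\<Sum>a<2. \<Sum>b<2. pair_factor t a b * (dep_kernel \<mu> a a c c * dep_kernel \<mu> b b d d)) = pair_factor (\<mu>\<^sup>2 * t) c d"
      if "c < 2" "d < 2" for c d
      using that by (auto simp: less_2_cases_iff sum_less_2 pair_factor_def dep_kernel_def power2_eq_square field_simps)
    have "(\<Sum>x'<2 ^ (2 * m). pair_weight m t x' * ?k x') = (\<Sum>x'<2 ^ (2 * m). \<Prod>i<m. pair_factor t (qubit x' i) (qubit x' (i + m)) *
       (dep_kernel \<mu> (qubit x' i) (qubit x' i) (qubit x i) (qubit x i) *
        dep_kernel \<mu> (qubit x' (i + m)) (qubit x' (i + m)) (qubit x (i + m)) (qubit x (i + m))))"
      using True by (simp add: pair_weight_def noise_kernel_def prod_pairs prod.distrib)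
    also have "\<dots> = pair_weight m (\<mu>\<^sup>2 * t) x"
      using sum_prod_pairs[where m = m and \<phi> = "\<lambda>i a b. pair_factor t a b * (dep_kernel \<mu> a a (qubit x i) (qubit x i) *
        dep_kernel \<mu> b b (qubit x (i + m)) (qubit x (i + m)))"]
      by (simp add: one qubit_less_2 pair_weight_def)
    finally show ?thesis using True by simp
  qed
  finally show ?thesis by simp
qed

lemma conj_op_one:
  assumes "x < d" "y < d"
  shows "conj_op d (entries (1\<^sub>m d)) f x y = f x y"
proof -
  have "conj_op d (entries (1\<^sub>m d)) f x y = (\<Sum>a<d. \<Sum>b<d. (of_bool (x = a) * f a b) * of_bool (y = b))"
    unfolding conj_op_def using assms by (intro sum.cong refl) (auto simp: one_mat_def)
  also have "\<dots> = (\<Sum>a<d. of_bool (x = a) * f a y)" by (simp only: sum_of_bool_mult[OF assms(2)])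
  also have "\<dots> = f x y" by (simp only: sum_of_bool_mult[OF assms(1)])
  finally show ?thesis .
qed

lemma noisy_pair_state:
  assumes "x < 2 ^ (2 * m)" "y < 2 ^ (2 * m)"
  shows "noisy_state (2 * m) lam (\<lambda>_. 1\<^sub>m (2 ^ (2 * m))) (pair_state m) l $$ (x, y) =
    of_bool (x = y) * complex_of_real (pair_weight m ((1 - lam) ^ (2 * l)) x)"
  using assms
proof (induction l arbitrary: x y)
  case 0
  then show ?case by (simp add: pair_state_def)
next
  case (Suc l)
  have "noisy_state (2 * m) lam (\<lambda>_. 1\<^sub>m (2 ^ (2 * m))) (pair_state m) (Suc l) $$ (x, y) =
    noise (2 * m) (1 - lam) (conj_op (2 ^ (2 * m)) (entries (1\<^sub>m (2 ^ (2 * m))))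
      (entries (noisy_state (2 * m) lam (\<lambda>_. 1\<^sub>m (2 ^ (2 * m))) (pair_state m) l))) x y"
    using Suc.prems by (intro noisy_state_Suc_entries noisy_state_carrier density_op_pair_state unitary_op_one)
  also have "\<dots> = noise (2 * m) (1 - lam) (\<lambda>x y. of_bool (x = y) * complex_of_real (pair_weight m ((1 - lam) ^ (2 * l)) x)) x y"
    by (rule fun_cong[OF fun_cong[OF noise_cong]]) (simp only: conj_op_one Suc.IH)
  also have "\<dots> = of_bool (x = y) * complex_of_real (pair_weight m ((1 - lam)\<^sup>2 * (1 - lam) ^ (2 * l)) x)"
    by (rule noise_pair_weight[OF Suc.prems])
  also have "(1 - lam)\<^sup>2 * (1 - lam) ^ (2 * l) = (1 - lam) ^ (2 * Suc l)" by (simp add: power2_eq_square)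
  finally show ?case .
qed

section \<open>Schmidt coefficients of noisy pairs across the cut\<close>

lemma sub_index_low: "sub_index {..<m} x = take_bit m x"
  by (simp add: sub_index_def horner_sum_bit_eq_take_bit lessThan_atLeast0)

lemma sub_index_high: "sub_index {m..<2 * m} x = take_bit m (drop_bit m x)"
proof -
  have "map (bit x) [m..<2 * m] = map (bit (drop_bit m x)) [0..<m]"
    by (intro nth_equalityI) (simp_all add: bit_drop_bit_eq)
  then show ?thesis by (simp add: sub_index_def horner_sum_bit_eq_take_bit)
qed

lemma sub_index_concat:
  assumes "u < 2 ^ m" "v < 2 ^ m"
  shows "sub_index {..<m} (u + 2 ^ m * v) = u" "sub_index {m..<2 * m} (u + 2 ^ m * v) = v"
  using assms by (simp_all add: sub_index_low sub_index_high take_bit_eq_mod drop_bit_eq_div)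

lemma bipartition_halves: "0 < m \<Longrightarrow> bipartition (2 * m) {..<m} {m..<2 * m}"
  by (auto simp: bipartition_def)

text \<open>A Schur-test argument. The coefficient is a sum of pair weights times diagonal entries
  of L and R; bound |L_uu| |R_vv| by the mean of the squares. Both marginals of the weights are
  uniform, and the squared diagonal entries sum to at most 1.\<close>

lemma op_schmidt_coeff_pair_weight:
  assumes m: "0 < m" and t: "0 \<le> t" "t \<le> 1"
    and s: "op_schmidt_decomp (2 * m) {..<m} {m..<2 * m} \<rho> cs L R"
    and \<rho>: "\<And>x y. x < 2 ^ (2 * m) \<Longrightarrow> y < 2 ^ (2 * m) \<Longrightarrow>
      \<rho> $$ (x, y) = of_bool (x = y) * complex_of_real (pair_weight m t x)"
    and \<alpha>: "\<alpha> < length cs"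
  shows "cs ! \<alpha> \<le> 1 / 2 ^ m"
proof -
  let ?A = "{..<m}" and ?B = "{m..<2 * m}"
  define l r where "l u = (cmod (L \<alpha> $$ (u, u)))\<^sup>2" and "r v = (cmod (R \<alpha> $$ (v, v)))\<^sup>2" for u v
  let ?w = "\<lambda>u v. pair_weight m t (u + 2 ^ m * v)"
  have dle: "(\<Sum>x<2 ^ m. (cmod (X \<alpha> $$ (x, x)))\<^sup>2) \<le> 1" if "hs_orthonormal (2 ^ m) (length cs) X" for X
  proof -
    let ?D = "{..<2 ^ m :: nat} \<times> {..<2 ^ m :: nat}"
    have "(\<Sum>x<2 ^ m. (cmod (X \<alpha> $$ (x, x)))\<^sup>2) = (\<Sum>p\<in>(\<lambda>x. (x, x)) ` {..<2 ^ m}. (cmod (X \<alpha> $$ p))\<^sup>2)"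
      by (subst sum.reindex) (auto simp: inj_on_def)
    also have "\<dots> \<le> (\<Sum>p\<in>?D. (cmod (X \<alpha> $$ p))\<^sup>2)" by (intro sum_mono2) auto
    also have "\<dots> = 1" using orthonormal_norm[of ?D "length cs" "\<lambda>\<alpha> p. X \<alpha> $$ p"] that \<alpha> by (simp add: hs_orthonormal_iff)
    finally show ?thesis .
  qed
  have l: "(\<Sum>u<2 ^ m. l u) \<le> 1" and r: "(\<Sum>v<2 ^ m. r v) \<le> 1"
    unfolding l_def r_def using s by (auto intro!: dle simp: op_schmidt_decomp_def mult_2)
  let ?T = "\<lambda>p. tensor_op (2 * m) ?A ?B (L \<alpha>) (R \<alpha>) $$ p"
  have "complex_of_real (cs ! \<alpha>) = (\<Sum>x<2 ^ (2 * m). \<Sum>y<2 ^ (2 * m). cnj (?T (x, y)) * \<rho> $$ (x, y))"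
    using op_schmidt_coeff[OF bipartition_halves[OF m] s \<alpha>] by (simp add: sum.cartesian_product case_prod_beta)
  also have "\<dots> = (\<Sum>x<2 ^ (2 * m). \<Sum>y<2 ^ (2 * m). (cnj (?T (x, y)) * complex_of_real (pair_weight m t x)) * of_bool (x = y))"
    by (intro sum.cong refl) (simp add: \<rho>)
  also have "\<dots> = (\<Sum>x<2 ^ (2 * m). cnj (?T (x, x)) * complex_of_real (pair_weight m t x))"
    by (intro sum.cong refl) (simp only: sum_of_bool_mult lessThan_iff)
  finally have c: "complex_of_real (cs ! \<alpha>) = (\<Sum>x<2 ^ (2 * m). cnj (?T (x, x)) * complex_of_real (pair_weight m t x))" .
  have "cs ! \<alpha> \<le> cmod (complex_of_real (cs ! \<alpha>))" by simp
  also have "\<dots> \<le> (\<Sum>x<2 ^ (2 * m). cmod (?T (x, x)) * pair_weight m t x)"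
    unfolding c using norm_sum[of "\<lambda>x. cnj (?T (x, x)) * complex_of_real (pair_weight m t x)" "{..<2 ^ (2 * m)}"]
    by (simp add: norm_mult pair_weight_nonneg t)
  also have "\<dots> = (\<Sum>v<2 ^ m. \<Sum>u<2 ^ m. cmod (?T (u + 2 ^ m * v, u + 2 ^ m * v)) * ?w u v)"
    by (rule sum_pairs)
  also have "\<dots> \<le> (\<Sum>v<2 ^ m. \<Sum>u<2 ^ m. (l u + r v) / 2 * ?w u v)"
  proof (intro sum_mono mult_right_mono pair_weight_nonneg t)
    fix u v :: nat assume uv: "v \<in> {..<2 ^ m}" "u \<in> {..<2 ^ m}"
    have "u + 2 ^ m * v < 2 ^ m * Suc v" using uv by simp
    also have "\<dots> \<le> 2 ^ m * 2 ^ m" using uv by (intro mult_left_mono) auto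
    finally have x: "u + 2 ^ m * v < 2 ^ (2 * m)" by (simp add: mult_2 power_add)
    have "cmod (?T (u + 2 ^ m * v, u + 2 ^ m * v)) = cmod (L \<alpha> $$ (u, u)) * cmod (R \<alpha> $$ (v, v))"
      using x uv by (simp add: tensor_op_def sub_index_concat norm_mult)
    also have "\<dots> \<le> (l u + r v) / 2"
      using sum_squares_bound[of "cmod (L \<alpha> $$ (u, u))" "cmod (R \<alpha> $$ (v, v))"] by (simp add: l_def r_def)
    finally show "cmod (?T (u + 2 ^ m * v, u + 2 ^ m * v)) \<le> (l u + r v) / 2" .
  qed
  also have "\<dots> = (\<Sum>u<2 ^ m. l u / 2 * (\<Sum>v<2 ^ m. ?w u v)) + (\<Sum>v<2 ^ m. r v / 2 * (\<Sum>u<2 ^ m. ?w u v))"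
    unfolding add_divide_distrib distrib_right sum.distrib sum_distrib_left
    by (intro arg_cong2[of _ _ _ _ "(+)"] sum.swap refl)
  also have "\<dots> = (\<Sum>u<2 ^ m. l u) / 2 / 2 ^ m + (\<Sum>v<2 ^ m. r v) / 2 / 2 ^ m"
    by (simp add: pair_weight_marginals t flip: sum_divide_distrib)
  also have "\<dots> \<le> 1 / 2 / 2 ^ m + 1 / 2 / 2 ^ m"
    using l r by (intro add_mono divide_right_mono) auto
  finally show ?thesis by simp
qed

text \<open>A min-entropy bound. The purity is ((1 + y) / 4)^m with y = (1 - lam)^(4 l), and squared
  coefficients are at most 4^-m, so every normalized weight is at most (1 + y)^-m. The entropy, an
  average of the values - log p, is then at least m log (1 + y).\<close>

lemma op_entropy_norm_pair_state:
  assumes m: "0 < m" and lam: "0 < lam" "lam < 1"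
  defines "U \<equiv> \<lambda>_::nat. 1\<^sub>m (2 ^ (2 * m)) :: complex mat"
  shows "real m * (1 - lam) ^ (4 * l) / 2
    \<le> op_entropy_norm (2 * m) {..<m} {m..<2 * m} (noisy_state (2 * m) lam U (pair_state m) l)"
proof -
  let ?A = "{..<m}" and ?B = "{m..<2 * m}"
  define \<rho> where "\<rho> = noisy_state (2 * m) lam U (pair_state m) l"
  define t where "t = (1 - lam) ^ (2 * l)"
  have t: "0 \<le> t" "t \<le> 1" using lam by (simp_all add: t_def power_le_one)
  define y where "y = t\<^sup>2"
  have y: "0 \<le> y" "y \<le> 1" using t by (simp_all add: y_def power_le_one)
  have \<rho>: "\<rho> $$ (x, y) = of_bool (x = y) * complex_of_real (pair_weight m t x)"
    if "x < 2 ^ (2 * m)" "y < 2 ^ (2 * m)" for x y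
    unfolding \<rho>_def U_def t_def by (rule noisy_pair_state[OF that])
  have c: "\<rho> \<in> carrier_mat (2 ^ (2 * m)) (2 ^ (2 * m))"
    unfolding \<rho>_def by (rule noisy_state_carrier[OF density_op_pair_state])
  \<comment> \<open>\<open>noisy_state_bound\<close> takes such an exponent; it is invoked here for
    the fact that rho is a state.\<close>
  obtain k where k: "(1 - lam) ^ (2 ^ k) \<le> 1/32" using contraction_exponent[of lam] lam by auto
  have st: "is_state (2 ^ (2 * m)) (entries \<rho>)"
    using noisy_state_bound[OF _ _ k density_op_pair_state[of m], where U = U and l = l] lam unitary_op_one[of "2 * m"]
    by (simp add: U_def \<rho>_def)
  have q: "hs_sq (2 ^ (2 * m)) (entries \<rho>) = ((1 + y) / 4) ^ m"
  proof -
    have "hs_sq (2 ^ (2 * m)) (entries \<rho>) = (\<Sum>x<2 ^ (2 * m). \<Sum>z<2 ^ (2 * m). if x = z then (pair_weight m t x)\<^sup>2 else 0)"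
      unfolding hs_sq_def by (intro sum.cong refl) (simp add: \<rho>)
    also have "\<dots> = (\<Sum>x<2 ^ (2 * m). (pair_weight m t x)\<^sup>2)" by simp
    finally show ?thesis by (simp add: pair_weight_sum_squares y_def)
  qed
  define q where "q = ((1 + y) / 4) ^ m"
  have q0: "0 < q" using y by (simp add: q_def)
  define cs where "cs = op_schmidt_coeffs (2 * m) ?A ?B \<rho>"
  obtain L R where s: "op_schmidt_decomp (2 * m) ?A ?B \<rho> cs L R"
    using op_schmidt_coeffs[OF bipartition_halves[OF m] c] unfolding cs_def by blast
  define p where "p \<alpha> = (cs ! \<alpha>)\<^sup>2 / q" for \<alpha>
  have cpos: "0 < cs ! \<alpha>" if "\<alpha> < length cs" for \<alpha>
    using s that unfolding op_schmidt_decomp_def by auto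
  have sp: "(\<Sum>\<alpha><length cs. p \<alpha>) = 1"
    using op_schmidt_sum_squares[OF bipartition_halves[OF m] s] q0 unfolding p_def q q_def[symmetric]
    by (simp flip: sum_divide_distrib)
  have ple: "real m * log 2 (1 + y) * p \<alpha> \<le> - (p \<alpha> * log 2 (p \<alpha>))" if a: "\<alpha> < length cs" for \<alpha>
  proof -
    have p0: "0 < p \<alpha>" using cpos[OF a] q0 by (simp add: p_def)
    have "cs ! \<alpha> \<le> 1 / 2 ^ m" using op_schmidt_coeff_pair_weight[OF m t s \<rho> a] by simp
    then have "(cs ! \<alpha>)\<^sup>2 \<le> (1 / 2 ^ m)\<^sup>2" using cpos[OF a] by (intro power_mono) auto
    also have "(1 / 2 ^ m)\<^sup>2 = 1 / (4::real) ^ m" by (simp add: power_divide power2_eq_square flip: power_mult_distrib)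
    finally have "p \<alpha> \<le> 1 / (1 + y) ^ m" using q0 y by (simp add: p_def q_def field_simps)
    then have "log 2 (p \<alpha>) \<le> log 2 (1 / (1 + y) ^ m)" using p0 y by (subst log_le_cancel_iff) auto
    also have "\<dots> = - (real m * log 2 (1 + y))" using y by (simp add: log_divide log_nat_power)
    finally have "real m * log 2 (1 + y) \<le> - log 2 (p \<alpha>)" by simp
    from mult_right_mono[OF this, of "p \<alpha>"] p0 show ?thesis by (simp add: mult.commute)
  qed
  \<comment> \<open>A linear lower bound on the logarithm, valid because y is at most 1.\<close>
  have "y / 2 \<le> log 2 (1 + y)"
  proof -
    have "y / 2 \<le> y / (1 + y)" using y by (intro divide_left_mono) auto
    also have "\<dots> = 1 - 1 / (1 + y)" using y by (simp add: field_simps)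
    also have "\<dots> \<le> ln (1 + y)" using ln_le_minus_one[of "1 / (1 + y)"] y by (simp add: ln_div)
    also have "\<dots> \<le> ln (1 + y) / ln 2"
      using y ln_le_minus_one[of "2::real"] by (simp add: le_divide_eq mult_left_le)
    finally show ?thesis by (simp add: log_def)
  qed
  then have "real m * (y / 2) \<le> real m * log 2 (1 + y)" by (intro mult_left_mono) auto
  also have "\<dots> = (\<Sum>\<alpha><length cs. real m * log 2 (1 + y) * p \<alpha>)" by (simp add: sp flip: sum_distrib_left)
  also have "\<dots> \<le> (\<Sum>\<alpha><length cs. - (p \<alpha> * log 2 (p \<alpha>)))" by (intro sum_mono ple) simp
  also have "\<dots> = op_entropy_norm (2 * m) ?A ?B \<rho>"
    by (simp add: op_entropy_norm_def sum_list_nth cs_def p_def q_def q Let_def trace_square_hs_sq[OF c st] sum_negf)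
  finally show ?thesis
    by (simp add: \<rho>_def y_def t_def power_mult[symmetric] mult.commute)
qed

text \<open>With n = 2 m, the constant 1/8 makes (1 - lam)^(4 l) at least n^(-1/2), and m n^(-1/2) /
  2 = sqrt n / 4.\<close>

lemma pair_state_entropy_ge:
  assumes lam: "0 < lam" "lam < 1" and m: "0 < m"
    and l: "real l \<le> - 1 / (8 * log 2 (1 - lam)) * log 2 (real (2 * m))"
  shows "sqrt (real (2 * m)) / 4 \<le> op_entropy_norm (2 * m) {..<m} {m..<2 * m}
    (noisy_state (2 * m) lam (\<lambda>_. 1\<^sub>m (2 ^ (2 * m))) (pair_state m) l)"
proof -
  define s where "s = - log 2 (1 - lam)"
  have s: "0 < s" using lam by (simp add: s_def)
  have n: "0 < real (2 * m)" using m by simp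
  define n where "n = real (2 * m)"
  have "real l \<le> 1 / (8 * s) * log 2 n" using l by (simp add: s_def n_def)
  then have "4 * real l * s \<le> log 2 n / 2" using s by (simp add: field_simps)
  moreover have "log 2 (1 / sqrt n) = - (log 2 n / 2)"
    using n unfolding n_def[symmetric] by (simp add: log_divide log_powr flip: powr_half_sqrt)
  moreover have "log 2 ((1 - lam) ^ (4 * l)) = - (4 * real l * s)"
    using lam by (simp add: log_nat_power s_def)
  ultimately have "log 2 (1 / sqrt (real (2 * m))) \<le> log 2 ((1 - lam) ^ (4 * l))"
    unfolding n_def[symmetric] by linarith
  then have "1 / sqrt (real (2 * m)) \<le> (1 - lam) ^ (4 * l)"
    using n lam by (subst (asm) log_le_cancel_iff) auto
  then have "real m * (1 / sqrt (real (2 * m))) / 2 \<le> real m * (1 - lam) ^ (4 * l) / 2"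
    by (intro divide_right_mono mult_left_mono) auto
  moreover have "real m * (1 / sqrt (real (2 * m))) / 2 = sqrt (real (2 * m)) / 4"
    using real_sqrt_pow2[of "real (2 * m)"] n by (simp add: field_simps power2_eq_square)
  ultimately show ?thesis
    using op_entropy_norm_pair_state[OF m lam, of l] by simp
qed

section \<open>Assembly of the bounds and the crossover depth\<close>

theorem theorem1:
  shows
    "(\<forall>lam::real. 0 < lam \<and> lam \<le> 1 \<longrightarrow>
       (\<exists>(L_abs::nat) (C::real). C > 0 \<and>
         (\<forall>n \<rho>\<^sub>0 U A B l. n \<ge> 2 \<longrightarrow> density_op n \<rho>\<^sub>0 \<longrightarrow> (\<forall>k\<ge>1. unitary_op n (U k)) \<longrightarrow>
            bipartition n A B \<longrightarrow> l \<ge> L_abs \<longrightarrow>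
            op_entropy n A B (noisy_state n lam U \<rho>\<^sub>0 l) \<le> C * log 2 (real n))))
     \<and>
     (\<forall>lam::real. 0 < lam \<and> lam \<le> 1 \<longrightarrow>
       (\<exists>(K::real) (C::real). K > 0 \<and> C > 0 \<and>
         (\<forall>n \<rho>\<^sub>0 U A B l. n \<ge> 2 \<longrightarrow> density_op n \<rho>\<^sub>0 \<longrightarrow> (\<forall>k\<ge>1. unitary_op n (U k)) \<longrightarrow>
            bipartition n A B \<longrightarrow> real l \<ge> K * log 2 (real n) \<longrightarrow>
            op_entropy_norm n A B (noisy_state n lam U \<rho>\<^sub>0 l) \<le> C * log 2 (real n))))
     \<and>
     (\<forall>lam::real. 0 < lam \<and> lam < 1 \<longrightarrow>
       (\<exists>(\<kappa>::real) (N::nat \<Rightarrow> nat). \<kappa> > 0 \<and> strict_mono N \<and>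
         (\<exists>\<rho>\<^sub>0 U A B.
            (\<forall>j. N j \<ge> 2 \<and> density_op (N j) (\<rho>\<^sub>0 j) \<and> (\<forall>k\<ge>1. unitary_op (N j) (U j k)) \<and>
                 bipartition (N j) (A j) (B j)) \<and>
            filterlim
              (\<lambda>j. 1 / log 2 (real (N j)) *
                 Min ((\<lambda>l. op_entropy_norm (N j) (A j) (B j)
                              (noisy_state (N j) lam (U j) (\<rho>\<^sub>0 j) l))
                        ` {l. real l \<le> \<kappa> * log 2 (real (N j))}))
              at_top sequentially) \<and>
         (\<exists>C\<^sub>0>0. \<forall>C\<ge>C\<^sub>0.
            (\<forall>n\<ge>2. \<exists>L. low_entropy_from lam C n L) \<and>
            (\<lambda>n. real (crossover_depth lam C n)) \<in> O(\<lambda>n. log 2 (real n)) \<and>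
            (\<lambda>j. real (crossover_depth lam C (N j))) \<in> \<Theta>(\<lambda>j. log 2 (real (N j))))))"
proof (intro conjI allI impI)
  fix lam :: real assume lam: "0 < lam \<and> lam \<le> 1"
  then show "\<exists>(L_abs::nat) (C::real). C > 0 \<and>
         (\<forall>n \<rho>\<^sub>0 U A B l. n \<ge> 2 \<longrightarrow> density_op n \<rho>\<^sub>0 \<longrightarrow> (\<forall>k\<ge>1. unitary_op n (U k)) \<longrightarrow>
            bipartition n A B \<longrightarrow> l \<ge> L_abs \<longrightarrow>
            op_entropy n A B (noisy_state n lam U \<rho>\<^sub>0 l) \<le> C * log 2 (real n))"
    by (intro op_entropy_noisy) auto
  show "\<exists>(K::real) (C::real). K > 0 \<and> C > 0 \<and>
         (\<forall>n \<rho>\<^sub>0 U A B l. n \<ge> 2 \<longrightarrow> density_op n \<rho>\<^sub>0 \<longrightarrow> (\<forall>k\<ge>1. unitary_op n (U k)) \<longrightarrow>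
            bipartition n A B \<longrightarrow> real l \<ge> K * log 2 (real n) \<longrightarrow>
            op_entropy_norm n A B (noisy_state n lam U \<rho>\<^sub>0 l) \<le> C * log 2 (real n))"
    using lam by (intro op_entropy_norm_noisy) auto
next
  fix lam :: real assume lam: "0 < lam \<and> lam < 1"
  define \<kappa> where "\<kappa> = - 1 / (8 * log 2 (1 - lam))"
  have \<kappa>: "0 < \<kappa>" using lam by (simp add: \<kappa>_def divide_neg_neg mult_pos_neg)
  \<comment> \<open>Even qubit numbers, starting at 2, so that both halves are nonempty.\<close>
  define N where "N j = 2 * Suc j" for j
  define U :: "nat \<Rightarrow> nat \<Rightarrow> complex mat" where "U j = (\<lambda>_. 1\<^sub>m (2 ^ N j))" for j
  let ?S = "\<lambda>j l. op_entropy_norm (N j) {..<Suc j} {Suc j..<N j} (noisy_state (N j) lam (U j) (pair_state (Suc j)) l)"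
  have low: "sqrt (real (N j)) / 4 \<le> ?S j l" if "real l \<le> \<kappa> * log 2 (real (N j))" for j l
    unfolding N_def U_def using pair_state_entropy_ge[of lam "Suc j" l] lam that by (simp only: N_def \<kappa>_def)
  have N2: "2 \<le> N j" for j by (simp add: N_def)
  have log1: "1 \<le> log 2 (real n)" if "2 \<le> n" for n using that by simp
  have inst: "N j \<ge> 2 \<and> density_op (N j) (pair_state (Suc j)) \<and> (\<forall>k\<ge>1. unitary_op (N j) (U j k)) \<and>
      bipartition (N j) {..<Suc j} {Suc j..<N j}" for j
    using N2 density_op_pair_state[of "Suc j"] unitary_op_one[of "N j"] bipartition_halves[of "Suc j"]
    unfolding U_def N_def by blast
  have lim: "filterlim (\<lambda>j. 1 / log 2 (real (N j)) * Min (?S j ` {l. real l \<le> \<kappa> * log 2 (real (N j))})) at_top sequentially"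
  proof (rule filterlim_at_top_mono)
    show "filterlim (\<lambda>j. 1 / log 2 (real (N j)) * (sqrt (real (N j)) / 4)) at_top sequentially"
      unfolding N_def by real_asymp
    show "\<forall>\<^sub>F j in sequentially. 1 / log 2 (real (N j)) * (sqrt (real (N j)) / 4)
        \<le> 1 / log 2 (real (N j)) * Min (?S j ` {l. real l \<le> \<kappa> * log 2 (real (N j))})"
    proof (intro always_eventually allI mult_left_mono)
      fix j
      have lg: "1 \<le> log 2 (real (N j))" using log1[OF N2] .
      \<comment> \<open>\<open>Min\<close> is meaningful over a finite nonempty set: a floor bounds
        the depths, and depth 0 always qualifies.\<close>
      have "{l. real l \<le> \<kappa> * log 2 (real (N j))} \<subseteq> {..nat \<lfloor>\<kappa> * log 2 (real (N j))\<rfloor>}" by (auto simp: le_nat_floor)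
      then have fin: "finite {l. real l \<le> \<kappa> * log 2 (real (N j))}" by (rule finite_subset) simp
      have "0 \<in> {l. real l \<le> \<kappa> * log 2 (real (N j))}" using \<kappa> lg by simp
      then have "{l. real l \<le> \<kappa> * log 2 (real (N j))} \<noteq> {}" by blast
      then show "sqrt (real (N j)) / 4 \<le> Min (?S j ` {l. real l \<le> \<kappa> * log 2 (real (N j))})"
        using fin low by (subst Min_ge_iff) blast+
      show "0 \<le> 1 / log 2 (real (N j))" using lg by simp
    qed
  qed
  \<comment> \<open>\<open>C0\<close> becomes the threshold: the upper bound passes to every larger
    constant with the same \<open>K\<close>.\<close>
  obtain K C0 where K: "0 < K" and C0: "0 < C0" and up: "\<And>n \<rho>\<^sub>0 (U :: nat \<Rightarrow> complex mat) A B l. n \<ge> 2 \<Longrightarrow> density_op n \<rho>\<^sub>0 \<Longrightarrow>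
      (\<forall>k\<ge>1. unitary_op n (U k)) \<Longrightarrow> bipartition n A B \<Longrightarrow> real l \<ge> K * log 2 (real n) \<Longrightarrow>
      op_entropy_norm n A B (noisy_state n lam U \<rho>\<^sub>0 l) \<le> C0 * log 2 (real n)"
    using op_entropy_norm_noisy[of lam] lam by auto
  have cross: "(\<forall>n\<ge>2. \<exists>L. low_entropy_from lam C n L) \<and>
            (\<lambda>n. real (crossover_depth lam C n)) \<in> O(\<lambda>n. log 2 (real n)) \<and>
            (\<lambda>j. real (crossover_depth lam C (N j))) \<in> \<Theta>(\<lambda>j. log 2 (real (N j)))" if C: "C0 \<le> C" for C
  proof -
    have ex: "low_entropy_from lam C n (nat \<lceil>K * log 2 (real n)\<rceil>)" if n: "2 \<le> n" for n
      unfolding low_entropy_from_def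
    proof (intro allI impI)
      fix \<rho>\<^sub>0 and U :: "nat \<Rightarrow> complex mat" and A B and l
      assume a: "density_op n \<rho>\<^sub>0" "\<forall>k\<ge>1. unitary_op n (U k)" "bipartition n A B" "nat \<lceil>K * log 2 (real n)\<rceil> \<le> l"
      have "K * log 2 (real n) \<le> real l" using a(4) by linarith
      then have "op_entropy_norm n A B (noisy_state n lam U \<rho>\<^sub>0 l) \<le> C0 * log 2 (real n)" by (intro up n a)
      also have "\<dots> \<le> C * log 2 (real n)" using C log1[OF n] by (intro mult_right_mono) auto
      finally show "op_entropy_norm n A B (noisy_state n lam U \<rho>\<^sub>0 l) \<le> C * log 2 (real n)" .
    qed
    have le: "real (crossover_depth lam C n) \<le> (K + 1) * log 2 (real n)" if n: "2 \<le> n" for n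
    proof -
      have "crossover_depth lam C n \<le> nat \<lceil>K * log 2 (real n)\<rceil>"
        unfolding crossover_depth_def by (rule Least_le[of "low_entropy_from lam C n", OF ex[OF n]])
      moreover have "0 \<le> K * log 2 (real n)" using K log1[OF n] by simp
      \<comment> \<open>Rounding up costs at most 1, which log n absorbs since n is at least
        2.\<close>
      ultimately have "real (crossover_depth lam C n) \<le> K * log 2 (real n) + 1" by linarith
      then show ?thesis using log1[OF n] by (simp add: distrib_right)
    qed
    have "\<forall>\<^sub>F j in sequentially. C * log 2 (real (N j)) < sqrt (real (N j)) / 4"
      unfolding N_def by real_asymp
    \<comment> \<open>For fixed C and large j the pair states exceed C log n at every depth up to
      \<kappa> log n, so the crossover depth, from which the entropy is low for every state, must
      lie beyond.\<close>
    then have ge: "\<forall>\<^sub>F j in sequentially. \<kappa> * log 2 (real (N j)) \<le> real (crossover_depth lam C (N j))"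
    proof eventually_elim
      case (elim j)
      have "low_entropy_from lam C (N j) (crossover_depth lam C (N j))"
        unfolding crossover_depth_def by (rule LeastI[of "low_entropy_from lam C (N j)", OF ex[OF N2]])
      then have "?S j (crossover_depth lam C (N j)) \<le> C * log 2 (real (N j))"
        unfolding low_entropy_from_def using inst[of j] by blast
      then have "\<not> real (crossover_depth lam C (N j)) \<le> \<kappa> * log 2 (real (N j))" using low[of "crossover_depth lam C (N j)" j] elim by linarith
      then show ?case by simp
    qed
    show ?thesis
    proof (intro conjI bigthetaI)
      show "\<forall>n\<ge>2. \<exists>L. low_entropy_from lam C n L" using ex by blast
      show "(\<lambda>n. real (crossover_depth lam C n)) \<in> O(\<lambda>n. log 2 (real n))"
        using le log1 by (intro bigoI[of _ "K + 1"] eventually_sequentiallyI[of 2]) force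
      show "(\<lambda>j. real (crossover_depth lam C (N j))) \<in> O(\<lambda>j. log 2 (real (N j)))"
      proof (intro bigoI[of _ "K + 1"] always_eventually allI)
        show "norm (real (crossover_depth lam C (N j))) \<le> (K + 1) * norm (log 2 (real (N j)))" for j
          using le[OF N2, of j] log1[OF N2, of j] by simp
      qed
      show "(\<lambda>j. real (crossover_depth lam C (N j))) \<in> \<Omega>(\<lambda>j. log 2 (real (N j)))"
        using \<kappa> by (intro landau_omega.bigI[of \<kappa>] eventually_mono[OF ge])
          (use log1[OF N2] in \<open>simp_all add: abs_of_nonneg order.trans[OF zero_le_one]\<close>)
    qed
  qed
  show "\<exists>(\<kappa>::real) (N::nat \<Rightarrow> nat). \<kappa> > 0 \<and> strict_mono N \<and>
         (\<exists>\<rho>\<^sub>0 U A B.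
            (\<forall>j. N j \<ge> 2 \<and> density_op (N j) (\<rho>\<^sub>0 j) \<and> (\<forall>k\<ge>1. unitary_op (N j) (U j k)) \<and>
                 bipartition (N j) (A j) (B j)) \<and>
            filterlim
              (\<lambda>j. 1 / log 2 (real (N j)) *
                 Min ((\<lambda>l. op_entropy_norm (N j) (A j) (B j)
                              (noisy_state (N j) lam (U j) (\<rho>\<^sub>0 j) l))
                        ` {l. real l \<le> \<kappa> * log 2 (real (N j))}))
              at_top sequentially) \<and>
         (\<exists>C\<^sub>0>0. \<forall>C\<ge>C\<^sub>0.
            (\<forall>n\<ge>2. \<exists>L. low_entropy_from lam C n L) \<and>
            (\<lambda>n. real (crossover_depth lam C n)) \<in> O(\<lambda>n. log 2 (real n)) \<and>
            (\<lambda>j. real (crossover_depth lam C (N j))) \<in> \<Theta>(\<lambda>j. log 2 (real (N j))))"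
  proof (rule exI[of _ \<kappa>], rule exI[of _ N], intro conjI)
    show "strict_mono N" by (simp add: strict_mono_def N_def)
    show "\<exists>\<rho>\<^sub>0 U A B.
            (\<forall>j. N j \<ge> 2 \<and> density_op (N j) (\<rho>\<^sub>0 j) \<and> (\<forall>k\<ge>1. unitary_op (N j) (U j k)) \<and>
                 bipartition (N j) (A j) (B j)) \<and>
            filterlim
              (\<lambda>j. 1 / log 2 (real (N j)) *
                 Min ((\<lambda>l. op_entropy_norm (N j) (A j) (B j)
                              (noisy_state (N j) lam (U j) (\<rho>\<^sub>0 j) l))
                        ` {l. real l \<le> \<kappa> * log 2 (real (N j))}))
              at_top sequentially"
      by (rule exI[of _ "\<lambda>j. pair_state (Suc j)"], rule exI[of _ U], rule exI[of _ "\<lambda>j. {..<Suc j}"],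
          rule exI[of _ "\<lambda>j. {Suc j..<N j}"], rule conjI, rule allI, rule inst, rule lim)
    show "\<exists>C\<^sub>0>0. \<forall>C\<ge>C\<^sub>0.
            (\<forall>n\<ge>2. \<exists>L. low_entropy_from lam C n L) \<and>
            (\<lambda>n. real (crossover_depth lam C n)) \<in> O(\<lambda>n. log 2 (real n)) \<and>
            (\<lambda>j. real (crossover_depth lam C (N j))) \<in> \<Theta>(\<lambda>j. log 2 (real (N j)))"
      using C0 cross by blast
  qed (rule \<kappa>)
qed

end
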